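(* Let $\gamma=(1+\sqrt5)/2$. The set of points $(\hat{\lambda}_2(\xi),\hat{\omega}_2(\xi))$, where $\xi$ runs through all real numbers with $[\mathbb{Q}(\xi):\mathbb{Q}]>2$, is a dense subset of the curve $\mathcal{C}=\{(1-\omega^{-1},\omega)\,;\,2\le\omega\le\gamma^2\}$.
   Context: For real $\xi$, $\hat{\lambda}_2(\xi)$ is the supremum of all real $\lambda$ such that for every sufficiently large $X$ the inequalities $|x_0|\le X$, $|x_0\xi-x_1|\le X^{-\lambda}$, $|x_0\xi^2-x_2|\le X^{-\lambda}$ have a solution $(x_0,x_1,x_2)\in\mathbb{Z}^3\setminus\{0\}$. Likewise $\hat{\omega}_2(\xi)$ is the supremum of all real $\omega$ such that for every sufficiently large $X$ the inequalities $|x_0+x_1\xi+x_2\xi^2|\le X^{-\omega}$, $|x_1|\le X$, $|x_2|\le X$ have a solution $(x_0,x_1,x_2)\in\mathbb{Z}^3\setminus\{0\}$. *)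

theory Defs
  imports "HOL-Analysis.Analysis" "HOL-Computational_Algebra.Polynomial"
begin

definition lambda_hat2 :: "real \<Rightarrow> ereal" where
  "lambda_hat2 \<xi> = Sup {ereal l | l. eventually (\<lambda>X::real.
      \<exists>x0 x1 x2 :: int. (x0, x1, x2) \<noteq> (0, 0, 0) \<and>
        \<bar>real_of_int x0\<bar> \<le> X \<and>
        \<bar>real_of_int x0 * \<xi> - real_of_int x1\<bar> \<le> X powr (- l) \<and>
        \<bar>real_of_int x0 * \<xi>\<^sup>2 - real_of_int x2\<bar> \<le> X powr (- l)) at_top}"

definition omega_hat2 :: "real \<Rightarrow> ereal" where
  "omega_hat2 \<xi> = Sup {ereal w | w. eventually (\<lambda>X::real.
      \<exists>x0 x1 x2 :: int. (x0, x1, x2) \<noteq> (0, 0, 0) \<and>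
        \<bar>real_of_int x0 + real_of_int x1 * \<xi> + real_of_int x2 * \<xi>\<^sup>2\<bar> \<le> X powr (- w) \<and>
        \<bar>real_of_int x1\<bar> \<le> X \<and> \<bar>real_of_int x2\<bar> \<le> X) at_top}"

definition deg_gt_2 :: "real \<Rightarrow> bool" where
  "deg_gt_2 \<xi> \<longleftrightarrow> \<not> (\<exists>p :: rat poly. p \<noteq> 0 \<and> degree p \<le> 2 \<and> poly (map_poly of_rat p) \<xi> = 0)"

definition golden :: real where
  "golden = (1 + sqrt 5) / 2"

definition curveC :: "(real \<times> real) set" where
  "curveC = {(1 - 1 / w, w) | w. 2 \<le> w \<and> w \<le> golden\<^sup>2}"

end

theory Submission
  imports Defs
begin

text \<open>Jarnik's identity \<open>\<lambda> = 1 - 1/\<omega>\<close>: a good simultaneous approximation \<open>x\<close> yields a good linear form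
  either inside the lattice orthogonal to \<open>x\<close>, by the pigeonhole principle, or as the cross product of \<open>x\<close>
  with a second approximation; linear forms yield simultaneous approximations in the same way.
  The range of \<open>\<omega>\<close> then follows from Dirichlet's box principle and from the bound of Davenport and
  Schmidt, which compares two estimates for minimal points \<open>x\<^sub>i\<close>: the nonzero integer
  \<open>x\<^sub>i\<^sub>0 x\<^sub>i\<^sub>2 - x\<^sub>i\<^sub>1\<^sup>2\<close>, and the determinant of three consecutive independent points.

  For density, let \<open>A\<close> and \<open>B\<close> be symmetric matrices of determinant \<open>a\<close> that are congruent to the matrix
  unit \<open>E\<^sub>1\<^sub>1\<close> modulo \<open>a\<close>. The palindromic prefixes \<open>x\<^sub>k\<close> of the Fibonacci word in \<open>A\<close> and \<open>B\<close> are symmetric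
  matrices approximating \<open>(1, \<xi>, \<xi>\<^sup>2)\<close>, and they satisfy \<open>x\<^sub>k\<^sub>+\<^sub>2 = x\<^sub>k\<^sub>+\<^sub>1 M\<^sub>k x\<^sub>k\<close> with \<open>M\<^sub>k\<close> alternately
  \<open>AB\<close> and \<open>BA\<close>. The fixed-point form \<open>z\<^sub>k\<close> of \<open>M\<^sub>k x\<^sub>k\<close> annihilates \<open>x\<^sub>k\<^sub>+\<^sub>2\<close> and is extremely
  small at \<open>(1, \<xi>, \<xi>\<^sup>2)\<close>. If the determinant of a word is the power \<open>\<delta>\<close> of its norm,
  these forms give \<open>\<omega> = \<gamma>\<^sup>2 - \<gamma>\<delta>\<close>. Congruence to \<open>E\<^sub>1\<^sub>1\<close> makes the \<open>x\<^sub>k\<close> primitive and the \<open>z\<^sub>k\<close> nearly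
  primitive, so that no smaller form can do better. Taking \<open>a\<close> and the matrix entries to be large powers
  of \<open>2\<close> makes \<open>\<delta>\<close> approach any rational number in \<open>(0, \<gamma>\<^sup>-\<^sup>2)\<close>.\<close>

section \<open>Admissible exponents\<close>

text \<open>Size and error bounds are independent parameters, because the constructions below lose
  constant factors in both.\<close>

definition simul :: "real \<Rightarrow> real \<Rightarrow> real \<Rightarrow> int \<Rightarrow> int \<Rightarrow> int \<Rightarrow> bool" where
  "simul \<xi> A B x0 x1 x2 \<longleftrightarrow> (x0, x1, x2) \<noteq> (0, 0, 0) \<and> \<bar>real_of_int x0\<bar> \<le> A \<and>
     \<bar>real_of_int x0 * \<xi> - real_of_int x1\<bar> \<le> B \<and> \<bar>real_of_int x0 * \<xi>\<^sup>2 - real_of_int x2\<bar> \<le> B"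

definition dual :: "real \<Rightarrow> real \<Rightarrow> real \<Rightarrow> int \<Rightarrow> int \<Rightarrow> int \<Rightarrow> bool" where
  "dual \<xi> A B y0 y1 y2 \<longleftrightarrow> (y0, y1, y2) \<noteq> (0, 0, 0) \<and>
     \<bar>real_of_int y0 + real_of_int y1 * \<xi> + real_of_int y2 * \<xi>\<^sup>2\<bar> \<le> B \<and>
     \<bar>real_of_int y1\<bar> \<le> A \<and> \<bar>real_of_int y2\<bar> \<le> A"

definition lambda_admissible :: "real \<Rightarrow> real \<Rightarrow> bool" where
  "lambda_admissible \<xi> l \<longleftrightarrow> (\<forall>\<^sub>F X in at_top. \<exists>x0 x1 x2. simul \<xi> X (X powr - l) x0 x1 x2)"

definition omega_admissible :: "real \<Rightarrow> real \<Rightarrow> bool" where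
  "omega_admissible \<xi> w \<longleftrightarrow> (\<forall>\<^sub>F Y in at_top. \<exists>y0 y1 y2. dual \<xi> Y (Y powr - w) y0 y1 y2)"

lemma lambda_hat2_eq: "lambda_hat2 \<xi> = Sup {ereal l | l. lambda_admissible \<xi> l}"
  unfolding lambda_hat2_def lambda_admissible_def simul_def by simp

lemma omega_hat2_eq: "omega_hat2 \<xi> = Sup {ereal w | w. omega_admissible \<xi> w}"
  unfolding omega_hat2_def omega_admissible_def dual_def by simp

lemma simul_mono: "simul \<xi> A B x0 x1 x2 \<Longrightarrow> A \<le> A' \<Longrightarrow> B \<le> B' \<Longrightarrow> simul \<xi> A' B' x0 x1 x2"
  unfolding simul_def by auto

lemma dual_mono: "dual \<xi> A B x0 x1 x2 \<Longrightarrow> A \<le> A' \<Longrightarrow> B \<le> B' \<Longrightarrow> dual \<xi> A' B' x0 x1 x2"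
  unfolding dual_def by auto

text \<open>The ratio of the two sides is a constant times \<open>X powr (l' - l)\<close>, which
  tends to 0.\<close>

lemma eventually_scaled_powr_le:
  fixes C l l' :: real
  assumes "C > 0" "l' < l"
  shows "\<forall>\<^sub>F X in at_top. C * (X / C) powr - l \<le> X powr - l'"
proof -
  have "((\<lambda>X::real. X powr (l' - l)) \<longlongrightarrow> 0) at_top"
    using assms by (intro tendsto_neg_powr filterlim_ident) auto
  moreover have "C powr (- 1 - l) > 0" using assms by simp
  ultimately have "\<forall>\<^sub>F X in at_top. X powr (l' - l) < C powr (- 1 - l)"
    by (rule order_tendstoD(2))
  with eventually_gt_at_top[of 0] show ?thesis
  proof eventually_elim
    case (elim X)
    have "C * (X / C) powr - l = C powr (1 + l) * X powr - l"
      using assms elim by (simp add: powr_divide powr_add powr_minus field_simps)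
    also have "X powr - l = X powr (l' - l) * X powr - l'"
      using elim by (simp flip: powr_add)
    also have "C powr (1 + l) * (X powr (l' - l) * X powr - l')
        \<le> C powr (1 + l) * (C powr (- 1 - l) * X powr - l')"
      using elim by (intro mult_left_mono mult_right_mono) auto
    also have "\<dots> = X powr - l'"
      using assms by (simp flip: powr_add mult.assoc)
    finally show ?case .
  qed
qed

lemma filterlim_divide_const_at_top: "C > 0 \<Longrightarrow> filterlim (\<lambda>X::real. X / C) at_top at_top"
  using filterlim_tendsto_pos_mult_at_top[OF tendsto_const, of "1 / C" "\<lambda>X::real. X" at_top]
  by (simp add: filterlim_ident)

text \<open>Substituting \<open>X / C\<close> for \<open>X\<close> corrects the box, and the drop
  from \<open>l\<close> to \<open>l'\<close> pays for the constant in the error. Existence proofs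
  below may therefore work up to constants.\<close>

lemma lambda_admissible_scaled:
  assumes ev: "\<forall>\<^sub>F X in at_top. \<exists>x0 x1 x2. simul \<xi> (C * X) (C * X powr - l) x0 x1 x2"
    and C: "C > 0" and l: "l' < l"
  shows "lambda_admissible \<xi> l'"
proof -
  have "\<forall>\<^sub>F X in at_top. \<exists>x0 x1 x2. simul \<xi> (C * (X / C)) (C * (X / C) powr - l) x0 x1 x2"
    using filterlim_iff[THEN iffD1, OF filterlim_divide_const_at_top[OF C]] ev by blast
  with eventually_scaled_powr_le[OF C l] show ?thesis
    unfolding lambda_admissible_def
    by eventually_elim (use C simul_mono in fastforce)
qed

lemma omega_admissible_scaled:
  assumes ev: "\<forall>\<^sub>F X in at_top. \<exists>x0 x1 x2. dual \<xi> (C * X) (C * X powr - l) x0 x1 x2"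
    and C: "C > 0" and l: "l' < l"
  shows "omega_admissible \<xi> l'"
proof -
  have "\<forall>\<^sub>F X in at_top. \<exists>x0 x1 x2. dual \<xi> (C * (X / C)) (C * (X / C) powr - l) x0 x1 x2"
    using filterlim_iff[THEN iffD1, OF filterlim_divide_const_at_top[OF C]] ev by blast
  with eventually_scaled_powr_le[OF C l] show ?thesis
    unfolding omega_admissible_def
    by eventually_elim (use C dual_mono in fastforce)
qed

lemma lambda_admissible_mono: "lambda_admissible \<xi> l \<Longrightarrow> l' < l \<Longrightarrow> lambda_admissible \<xi> l'"
  using lambda_admissible_scaled[of \<xi> 1 l l'] unfolding lambda_admissible_def by simp

lemma omega_admissible_mono: "omega_admissible \<xi> l \<Longrightarrow> l' < l \<Longrightarrow> omega_admissible \<xi> l'"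
  using omega_admissible_scaled[of \<xi> 1 l l'] unfolding omega_admissible_def by simp

lemma lambda_admissible_le: "lambda_admissible \<xi> l \<Longrightarrow> ereal l \<le> lambda_hat2 \<xi>"
  unfolding lambda_hat2_eq by (rule Sup_upper) auto

lemma omega_admissible_le: "omega_admissible \<xi> l \<Longrightarrow> ereal l \<le> omega_hat2 \<xi>"
  unfolding omega_hat2_eq by (rule Sup_upper) auto

lemma less_lambda_hat2: "ereal l < lambda_hat2 \<xi> \<Longrightarrow> lambda_admissible \<xi> l"
  unfolding lambda_hat2_eq less_Sup_iff using lambda_admissible_mono by auto

lemma less_omega_hat2: "ereal l < omega_hat2 \<xi> \<Longrightarrow> omega_admissible \<xi> l"
  unfolding omega_hat2_eq less_Sup_iff using omega_admissible_mono by auto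

text \<open>Clearing the denominators of the three coefficients gives an integer form. It is in this
  shape that the hypothesis makes values of linear forms and errors of approximations
  nonzero.\<close>

lemma deg_gt_2_int:
  "deg_gt_2 \<xi> \<longleftrightarrow> (\<forall>z0 z1 z2 :: int. (z0, z1, z2) \<noteq> (0, 0, 0) \<longrightarrow>
      real_of_int z0 + real_of_int z1 * \<xi> + real_of_int z2 * \<xi>\<^sup>2 \<noteq> 0)"
proof
  assume d: "deg_gt_2 \<xi>"
  show "\<forall>z0 z1 z2 :: int. (z0, z1, z2) \<noteq> (0, 0, 0) \<longrightarrow>
      real_of_int z0 + real_of_int z1 * \<xi> + real_of_int z2 * \<xi>\<^sup>2 \<noteq> 0"
  proof (intro allI impI notI)
    fix z0 z1 z2 :: int
    assume z: "(z0, z1, z2) \<noteq> (0, 0, 0)"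
      and 0: "real_of_int z0 + real_of_int z1 * \<xi> + real_of_int z2 * \<xi>\<^sup>2 = 0"
    let ?p = "[:of_int z0, of_int z1, of_int z2:] :: rat poly"
    have "?p \<noteq> 0" using z by auto
    moreover have "degree ?p \<le> 2" by simp
    moreover have "poly (map_poly of_rat ?p) \<xi> = 0"
      using 0 by (simp add: map_poly_pCons power2_eq_square algebra_simps)
    ultimately show False using d unfolding deg_gt_2_def by blast
  qed
next
  assume z: "\<forall>z0 z1 z2 :: int. (z0, z1, z2) \<noteq> (0, 0, 0) \<longrightarrow>
      real_of_int z0 + real_of_int z1 * \<xi> + real_of_int z2 * \<xi>\<^sup>2 \<noteq> 0"
  show "deg_gt_2 \<xi>"
    unfolding deg_gt_2_def
  proof (intro notI, elim exE conjE)
    fix p :: "rat poly"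
    assume p: "p \<noteq> 0" "degree p \<le> 2" "poly (map_poly of_rat p) \<xi> = 0"
    have clear: "\<exists>n d :: int. d \<noteq> 0 \<and> r * of_int d = of_int n" for r :: rat
    proof -
      obtain n d where nd: "quotient_of r = (n, d)" by fastforce
      then show ?thesis
        using quotient_of_denom_pos[OF nd] quotient_of_div[OF nd]
        by (intro exI[of _ n] exI[of _ d]) auto
    qed
    obtain n0 d0 where 0: "d0 \<noteq> 0" "coeff p 0 * of_int d0 = of_int n0" using clear by metis
    obtain n1 d1 where 1: "d1 \<noteq> 0" "coeff p 1 * of_int d1 = of_int n1" using clear by metis
    obtain n2 d2 where 2: "d2 \<noteq> 0" "coeff p 2 * of_int d2 = of_int n2" using clear by metis
    have R: "of_rat (coeff p 0) * real_of_int d0 = of_int n0"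
       "of_rat (coeff p 1) * real_of_int d1 = of_int n1"
       "of_rat (coeff p 2) * real_of_int d2 = of_int n2"
      using 0(2) 1(2) 2(2) by (metis of_rat_mult of_rat_of_int_eq)+
    have deg: "degree (map_poly (of_rat :: rat \<Rightarrow> real) p) \<le> 2"
      using p(2) degree_map_poly[of "of_rat :: rat \<Rightarrow> real" p] by simp
    have "poly (map_poly of_rat p) \<xi> = (\<Sum>i\<le>2. coeff (map_poly of_rat p) i * \<xi> ^ i)"
      unfolding poly_altdef using deg by (intro sum.mono_neutral_left) (auto simp: coeff_eq_0)
    then have "of_rat (coeff p 0) + of_rat (coeff p 1) * \<xi> + of_rat (coeff p 2) * \<xi>\<^sup>2 = 0"
      using p(3) by (simp add: coeff_map_poly numeral_2_eq_2)
    then have "(of_rat (coeff p 0) + of_rat (coeff p 1) * \<xi> + of_rat (coeff p 2) * \<xi>\<^sup>2) * (d0 * d1 * d2) = 0"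
      by simp
    then have "real_of_int (n0 * d1 * d2) + real_of_int (n1 * d0 * d2) * \<xi> + real_of_int (n2 * d0 * d1) * \<xi>\<^sup>2 = 0"
      by (simp add: R[symmetric] algebra_simps)
    then have "(n0 * d1 * d2, n1 * d0 * d2, n2 * d0 * d1) = (0, 0, 0)"
      using z by blast
    then have "n0 = 0" "n1 = 0" "n2 = 0" using 0 1 2 by auto
    then have "coeff p 0 = 0" "coeff p 1 = 0" "coeff p 2 = 0" using 0 1 2 by auto
    moreover have "degree p = 0 \<or> degree p = 1 \<or> degree p = 2" using p(2) by linarith
    ultimately have "lead_coeff p = 0" by metis
    then show False using p(1) by simp
  qed
qed

section \<open>Integer points from the box principle\<close>

text \<open>A box is a residue class modulo \<open>m\<close> together with one of \<open>K\<close>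
  equal subintervals of the range of \<open>v\<close>, so there are fewer boxes than points. In the
  applications the shared residue makes a remaining coordinate an integer, and the shared
  subinterval makes an error small.\<close>

lemma pigeonhole_residue_bucket:
  fixes g :: "'a \<Rightarrow> int" and v :: "'a \<Rightarrow> real" and m K :: int
  assumes "finite S" and m: "m > 0" and K: "K > 0" and V: "V > 0"
    and v: "\<And>s. s \<in> S \<Longrightarrow> lo \<le> v s \<and> v s < lo + V"
    and card: "m * K < int (card S)"
  obtains s s' where "s \<in> S" "s' \<in> S" "s \<noteq> s'" "m dvd g s - g s'" "\<bar>v s - v s'\<bar> * K \<le> V"
proof -
  define f where "f = (\<lambda>s. (g s mod m, \<lfloor>(v s - lo) * K / V\<rfloor>))"
  have sub: "f ` S \<subseteq> {0..<m} \<times> {0..<K}"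
  proof
    fix z assume "z \<in> f ` S"
    then obtain s where s: "s \<in> S" "z = f s" by auto
    have "(v s - lo) * K < V * K" using v[OF s(1)] K by (intro mult_strict_right_mono) auto
    then have "(v s - lo) * K / V < K" using V by (simp add: field_simps)
    moreover have "0 \<le> (v s - lo) * K / V" using v[OF s(1)] K V by auto
    ultimately show "z \<in> {0..<m} \<times> {0..<K}" using m s(2) by (auto simp: f_def floor_less_iff)
  qed
  have "card (f ` S) \<le> card ({0..<m} \<times> {0..<K})" by (rule card_mono[OF _ sub]) simp
  also have "\<dots> = nat (m * K)" using m K by (simp add: card_cartesian_product nat_mult_distrib)
  also have "\<dots> < card S" using card m K by (simp add: nat_less_iff)
  finally have "\<not> inj_on f S" using pigeonhole by blast
  then obtain s s' where s: "s \<in> S" "s' \<in> S" "s \<noteq> s'" "f s = f s'" unfolding inj_on_def by blast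
  have dvd: "m dvd g s - g s'" using s(4) by (auto simp: f_def mod_eq_dvd_iff)
  have "\<lfloor>(v s - lo) * K / V\<rfloor> = \<lfloor>(v s' - lo) * K / V\<rfloor>" using s(4) by (auto simp: f_def)
  then have "\<bar>(v s - lo) * K / V - (v s' - lo) * K / V\<bar> \<le> 1" by linarith
  moreover have "(v s - lo) * K / V - (v s' - lo) * K / V = (v s - v s') * K / V"
    by (simp add: diff_divide_distrib algebra_simps)
  ultimately have "\<bar>(v s - v s') * K / V\<bar> \<le> 1" by simp
  then have "\<bar>v s - v s'\<bar> * K \<le> V" using K V by (simp add: abs_mult pos_divide_le_eq)
  then show ?thesis using that s dvd by blast
qed

lemma le_twice_floor:
  assumes "1 \<le> r"
  shows "r \<le> real_of_int (2 * \<lfloor>r\<rfloor>)"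
proof -
  define z where "z = \<lfloor>r\<rfloor>"
  have "1 \<le> z" using assms unfolding z_def by simp
  moreover have "r < real_of_int z + 1" unfolding z_def by linarith
  ultimately show ?thesis unfolding z_def[symmetric] by linarith
qed

text \<open>Pairs \<open>(y1, y2)\<close> are sorted by \<open>y1 * x1 + y2 * x2\<close> modulo
  \<open>x0\<close>, so that a difference extends to an integer form vanishing at \<open>x\<close>.
  For such a form, \<open>x0\<close> times its value at \<open>\<xi>\<close> involves only the two
  small errors. About \<open>Y\<^sup>2\<close> pairs compete for \<open>\<bar>x0\<bar>\<close>
  residues, which leaves about \<open>Y\<^sup>2 / \<bar>x0\<bar>\<close> subintervals.\<close>

lemma exists_dual_orthogonal:
  fixes x0 x1 x2 :: int and \<xi> L Y :: real
  assumes x0: "x0 \<noteq> 0" "\<bar>real_of_int x0\<bar> \<le> Y\<^sup>2" and Y: "Y \<ge> 1" and L: "L > 0"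
    and x: "\<bar>x0 * \<xi> - x1\<bar> \<le> L" "\<bar>x0 * \<xi>\<^sup>2 - x2\<bar> \<le> L"
  obtains y0 y1 y2 where "dual \<xi> Y (10 * L / Y) y0 y1 y2"
proof -
  define N where "N = \<lfloor>Y\<rfloor>"
  define K where "K = \<lfloor>Y\<^sup>2 / \<bar>x0\<bar>\<rfloor>"
  have N: "1 \<le> N" "N \<le> Y" "Y < N + 1" using Y unfolding N_def by linarith+
  have ratio: "1 \<le> Y\<^sup>2 / real_of_int \<bar>x0\<bar>" using x0 by (simp add: field_simps)
  then have K: "1 \<le> K" "K \<le> Y\<^sup>2 / \<bar>x0\<bar>" "Y\<^sup>2 / \<bar>x0\<bar> \<le> 2 * K" using le_twice_floor unfolding K_def by (simp_all add: le_floor_iff del: of_int_mult of_int_abs)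
  define v where "v = (\<lambda>s :: int \<times> int. fst s * (x0 * \<xi> - x1) + snd s * (x0 * \<xi>\<^sup>2 - x2))"
  let ?S = "{0..N} \<times> {0..N}"
  \<comment> \<open>The values fill a closed interval of length at most \<open>4 * N * L\<close>;
    the factor 5 makes the upper end strict, as half-open subintervals require.\<close>
  have v: "- (2 * N * L) \<le> v s \<and> v s < - (2 * N * L) + 5 * N * L" if "s \<in> ?S" for s
  proof -
    have "\<bar>fst s * (x0 * \<xi> - x1)\<bar> \<le> N * L" "\<bar>snd s * (x0 * \<xi>\<^sup>2 - x2)\<bar> \<le> N * L"
      unfolding abs_mult using that x by (intro mult_mono; auto)+
    moreover have "N * L > 0" using N L by simp
    ultimately show ?thesis unfolding v_def by linarith
  qed
  have "real_of_int (\<bar>x0\<bar> * K) \<le> Y\<^sup>2" using K(2) x0 by (simp add: field_simps)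
  also have "\<dots> < (N + 1)\<^sup>2" unfolding of_int_power using N Y by (intro power_strict_mono) auto
  finally have "\<bar>x0\<bar> * K < (N + 1)\<^sup>2" by (simp only: of_int_less_iff flip: of_int_power)
  then have card: "\<bar>x0\<bar> * K < int (card ?S)"
    using N by (simp add: card_cartesian_product power2_eq_square)
  have pos: "\<bar>x0\<bar> > 0" "K > 0" "5 * N * L > 0" using x0 K N L by auto
  obtain s s' where s: "s \<in> ?S" "s' \<in> ?S" "s \<noteq> s'"
      "\<bar>x0\<bar> dvd (fst s * x1 + snd s * x2) - (fst s' * x1 + snd s' * x2)"
      "\<bar>v s - v s'\<bar> * K \<le> 5 * N * L"
    using pigeonhole_residue_bucket[where g = "\<lambda>s. fst s * x1 + snd s * x2" and v = v, OF _ pos v card]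
    by (metis (no_types, lifting) finite_SigmaI finite_atLeastAtMost_int)
  define y1 where "y1 = fst s - fst s'"
  define y2 where "y2 = snd s - snd s'"
  have "x0 dvd y1 * x1 + y2 * x2" using s(4) unfolding y1_def y2_def by (simp add: algebra_simps)
  then obtain k where k: "y1 * x1 + y2 * x2 = x0 * k" by (elim dvdE)
  have "(y1, y2) \<noteq> (0, 0)" using s(3) unfolding y1_def y2_def by (auto simp: prod_eq_iff)
  moreover have "\<bar>y1\<bar> \<le> N" "\<bar>y2\<bar> \<le> N" using s(1,2) unfolding y1_def y2_def by auto
  then have "\<bar>real_of_int y1\<bar> \<le> Y" "\<bar>real_of_int y2\<bar> \<le> Y" using N(2) by linarith+
  moreover have "\<bar>real_of_int (- k) + y1 * \<xi> + y2 * \<xi>\<^sup>2\<bar> \<le> 10 * L / Y"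
  proof -
    have kr: "real_of_int y1 * x1 + y2 * x2 = x0 * k" using k by (metis of_int_add of_int_mult)
    have "x0 * (real_of_int (- k) + y1 * \<xi> + y2 * \<xi>\<^sup>2) = v s - v s'"
      unfolding v_def y1_def y2_def using kr unfolding y1_def y2_def by (simp add: algebra_simps)
    then have e: "\<bar>real_of_int x0\<bar> * \<bar>real_of_int (- k) + y1 * \<xi> + y2 * \<xi>\<^sup>2\<bar> = \<bar>v s - v s'\<bar>"
      by (metis abs_mult)
    have "\<bar>v s - v s'\<bar> * (Y\<^sup>2 / \<bar>x0\<bar>) \<le> \<bar>v s - v s'\<bar> * (2 * K)" using K by (intro mult_left_mono) auto
    also have "\<dots> \<le> 10 * N * L" using s(5) by (simp add: ac_simps)
    also have "\<dots> \<le> 10 * Y * L" using N L by simp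
    finally have "\<bar>real_of_int (- k) + y1 * \<xi> + y2 * \<xi>\<^sup>2\<bar> * Y\<^sup>2 \<le> 10 * Y * L"
      unfolding e[symmetric] using x0 by simp
    then show ?thesis using Y by (simp add: power2_eq_square field_simps)
  qed
  ultimately show ?thesis using that[of "- k" y1 y2] unfolding dual_def by auto
qed

text \<open>Points and forms exchange their roles: \<open>x1\<close> is a difference of floors, and
  a congruence modulo \<open>y2\<close> makes \<open>x2\<close> an integer for which the form
  vanishes at \<open>x\<close>. The error of \<open>x2\<close> follows from that of
  \<open>x1\<close> because \<open>\<bar>y1\<bar> \<le> \<bar>y2\<bar>\<close>. The reals
  \<open>\<alpha>\<close> and \<open>\<beta>\<close> stay free since \<open>\<xi>\<close> and
  \<open>\<xi>\<^sup>2\<close> may have to trade places.\<close>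

lemma exists_simul_orthogonal_aux:
  fixes y0 y1 y2 :: int and \<alpha> \<beta> X :: real
  assumes y: "y2 \<noteq> 0" "\<bar>y1\<bar> \<le> \<bar>y2\<bar>" "\<bar>real_of_int y2\<bar> \<le> X"
  obtains x0 x1 x2 :: int where "x0 \<noteq> 0" "\<bar>real_of_int x0\<bar> \<le> X" "\<bar>x0 * \<alpha> - x1\<bar> \<le> 2 * \<bar>real_of_int y2\<bar> / X"
    "\<bar>x0 * \<beta> - x2\<bar> \<le> X * \<bar>y0 + y1 * \<alpha> + y2 * \<beta>\<bar> / \<bar>y2\<bar> + 2 * \<bar>real_of_int y2\<bar> / X"
proof -
  define N where "N = \<lfloor>X\<rfloor>"
  define K where "K = \<lfloor>X / \<bar>y2\<bar>\<rfloor>"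
  have X: "X \<ge> 1" using y by linarith
  have N: "1 \<le> N" "N \<le> X" "X < N + 1" using X unfolding N_def by linarith+
  have "1 \<le> X / real_of_int \<bar>y2\<bar>" using y by (simp add: field_simps)
  then have K: "1 \<le> K" "K \<le> X / \<bar>y2\<bar>" "X / \<bar>y2\<bar> \<le> 2 * K" using le_twice_floor unfolding K_def by (simp_all add: le_floor_iff del: of_int_mult of_int_abs)
  define v where "v = (\<lambda>s :: int. s * \<alpha> - \<lfloor>s * \<alpha>\<rfloor>)"
  have v: "0 \<le> v s \<and> v s < 0 + 1" for s unfolding v_def by linarith
  have "real_of_int (\<bar>y2\<bar> * K) \<le> X" using K(2) y by (simp add: field_simps)
  also have "\<dots> < N + 1" using N by simp
  finally have "\<bar>y2\<bar> * K < N + 1" by (simp only: of_int_less_iff)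
  then have card: "\<bar>y2\<bar> * K < int (card {0..N})" using N by simp
  have pos: "\<bar>y2\<bar> > 0" "K > 0" "(1::real) > 0" using y K by auto
  obtain s s' where s: "s \<in> {0..N}" "s' \<in> {0..N}" "s \<noteq> s'"
      "\<bar>y2\<bar> dvd (s * y0 + \<lfloor>s * \<alpha>\<rfloor> * y1) - (s' * y0 + \<lfloor>s' * \<alpha>\<rfloor> * y1)"
      "\<bar>v s - v s'\<bar> * K \<le> 1"
    using pigeonhole_residue_bucket[where g = "\<lambda>s. s * y0 + \<lfloor>s * \<alpha>\<rfloor> * y1" and v = v, OF _ pos v card]
    by (metis (no_types, lifting) finite_atLeastAtMost_int)
  define x0 where "x0 = s - s'"
  define x1 where "x1 = \<lfloor>s * \<alpha>\<rfloor> - \<lfloor>s' * \<alpha>\<rfloor>"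
  have "y2 dvd x0 * y0 + x1 * y1" using s(4) unfolding x0_def x1_def by (simp add: algebra_simps)
  then obtain k where k: "x0 * y0 + x1 * y1 = y2 * k" by (elim dvdE)
  have x0: "x0 \<noteq> 0" "\<bar>real_of_int x0\<bar> \<le> X" using s N(2) unfolding x0_def by auto
  have d: "\<bar>x0 * \<alpha> - x1\<bar> \<le> 2 * \<bar>real_of_int y2\<bar> / X"
  proof -
    have "\<bar>v s - v s'\<bar> * (X / \<bar>y2\<bar>) \<le> \<bar>v s - v s'\<bar> * (2 * K)" using K by (intro mult_left_mono) auto
    also have "\<dots> \<le> 2" using s(5) by simp
    finally have "\<bar>v s - v s'\<bar> \<le> 2 * \<bar>real_of_int y2\<bar> / X" using y X by (simp add: field_simps)
    moreover have "v s - v s' = x0 * \<alpha> - x1" unfolding v_def x0_def x1_def by (simp add: algebra_simps)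
    ultimately show ?thesis by simp
  qed
  have "\<bar>x0 * \<beta> - (- k)\<bar> \<le> X * \<bar>y0 + y1 * \<alpha> + y2 * \<beta>\<bar> / \<bar>y2\<bar> + 2 * \<bar>real_of_int y2\<bar> / X"
  proof -
    have kr: "real_of_int x0 * y0 + x1 * y1 = y2 * k" using k by (metis of_int_add of_int_mult)
    have "y2 * (x0 * \<beta> - (- k)) = x0 * (y0 + y1 * \<alpha> + y2 * \<beta>) - y1 * (x0 * \<alpha> - x1)"
      using kr by (simp add: algebra_simps)
    then have "\<bar>real_of_int y2\<bar> * \<bar>x0 * \<beta> - (- k)\<bar> = \<bar>x0 * (y0 + y1 * \<alpha> + y2 * \<beta>) - y1 * (x0 * \<alpha> - x1)\<bar>"
      by (metis abs_mult)
    also have "\<dots> \<le> \<bar>real_of_int x0\<bar> * \<bar>y0 + y1 * \<alpha> + y2 * \<beta>\<bar> + \<bar>real_of_int y1\<bar> * \<bar>x0 * \<alpha> - x1\<bar>"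
      unfolding abs_mult[symmetric] by (rule abs_triangle_ineq4)
    also have "\<dots> \<le> X * \<bar>y0 + y1 * \<alpha> + y2 * \<beta>\<bar> + \<bar>real_of_int y2\<bar> * (2 * \<bar>real_of_int y2\<bar> / X)"
      using x0 y(2) d by (intro add_mono mult_mono) auto
    finally have "\<bar>x0 * \<beta> - (- k)\<bar> \<le> (X * \<bar>y0 + y1 * \<alpha> + y2 * \<beta>\<bar> + \<bar>real_of_int y2\<bar> * (2 * \<bar>real_of_int y2\<bar> / X)) / \<bar>real_of_int y2\<bar>"
      using y(1) by (simp add: field_simps)
    then show ?thesis using y(1) by (simp add: add_divide_distrib)
  qed
  then show ?thesis using that[of x0 x1 "- k"] x0 d by simp
qed

text \<open>The congruence is taken modulo the larger of the two coefficients, which decides the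
  order of \<open>\<xi>\<close> and \<open>\<xi>\<^sup>2\<close>.\<close>

lemma exists_simul_orthogonal:
  fixes y0 y1 y2 :: int and \<xi> X :: real
  defines "h \<equiv> max \<bar>real_of_int y1\<bar> \<bar>real_of_int y2\<bar>"
  assumes h: "0 < h" "h \<le> X"
  obtains x0 x1 x2 :: int where
    "simul \<xi> X (X * \<bar>y0 + y1 * \<xi> + y2 * \<xi>\<^sup>2\<bar> / h + 2 * h / X) x0 x1 x2"
proof (cases "\<bar>y1\<bar> \<le> \<bar>y2\<bar>")
  case True
  then have e: "h = \<bar>real_of_int y2\<bar>" unfolding h_def by simp
  have y: "y2 \<noteq> 0" "\<bar>real_of_int y2\<bar> \<le> X" using h unfolding e by auto
  obtain x0 x1 x2 :: int where x: "x0 \<noteq> 0" "\<bar>real_of_int x0\<bar> \<le> X" "\<bar>x0 * \<xi> - x1\<bar> \<le> 2 * h / X"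
    "\<bar>x0 * \<xi>\<^sup>2 - x2\<bar> \<le> X * \<bar>y0 + y1 * \<xi> + y2 * \<xi>\<^sup>2\<bar> / h + 2 * h / X"
    using exists_simul_orthogonal_aux[OF y(1) True y(2), of \<xi> "\<xi>\<^sup>2" y0] unfolding e by auto
  have "X * \<bar>y0 + y1 * \<xi> + y2 * \<xi>\<^sup>2\<bar> / h \<ge> 0" using h by auto
  with x that[of x0 x1 x2] show ?thesis unfolding simul_def by auto
next
  case False
  then have e: "h = \<bar>real_of_int y1\<bar>" unfolding h_def by linarith
  have y: "y1 \<noteq> 0" "\<bar>real_of_int y1\<bar> \<le> X" "\<bar>y2\<bar> \<le> \<bar>y1\<bar>" using h False unfolding e by auto
  have c: "real_of_int y0 + y2 * \<xi>\<^sup>2 + y1 * \<xi> = y0 + y1 * \<xi> + y2 * \<xi>\<^sup>2" by simp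
  obtain x0 x1 x2 :: int where x: "x0 \<noteq> 0" "\<bar>real_of_int x0\<bar> \<le> X" "\<bar>x0 * \<xi>\<^sup>2 - x2\<bar> \<le> 2 * h / X"
    "\<bar>x0 * \<xi> - x1\<bar> \<le> X * \<bar>y0 + y1 * \<xi> + y2 * \<xi>\<^sup>2\<bar> / h + 2 * h / X"
    using exists_simul_orthogonal_aux[OF y(1,3,2), of "\<xi>\<^sup>2" \<xi> y0] unfolding e c by auto
  have "X * \<bar>y0 + y1 * \<xi> + y2 * \<xi>\<^sup>2\<bar> / h \<ge> 0" using h by auto
  with x that[of x0 x1 x2] show ?thesis unfolding simul_def by auto
qed

section \<open>Jarnik's identity and Dirichlet's bounds\<close>

text \<open>Among the points for \<open>X = Y powr w\<close> one with least
  \<open>\<bar>x0\<bar>\<close> is taken. If \<open>\<bar>x0\<bar> \<le> Y\<^sup>2\<close>, a form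
  orthogonal to it suffices; otherwise its cross product with an approximation of size at most
  \<open>\<bar>x0\<bar> / 2\<close> does.\<close>

lemma lambda_admissible_imp_omega_admissible:
  fixes \<xi> l w' :: real
  assumes l: "1 / 2 < l" "l < 1" and adm: "lambda_admissible \<xi> l" and w': "w' < 1 / (1 - l)"
  shows "omega_admissible \<xi> w'"
proof (rule omega_admissible_scaled[OF _ _ w'])
  define w where "w = 1 / (1 - l)"
  have w: "w > 2" "w * (1 - l) = 1" using l unfolding w_def by (auto simp: field_simps)
  obtain X0 where X0: "\<And>X. X \<ge> X0 \<Longrightarrow> \<exists>x0 x1 x2. simul \<xi> X (X powr - l) x0 x1 x2"
    using adm unfolding lambda_admissible_def eventually_at_top_linorder by blast
  have "\<exists>y0 y1 y2. dual \<xi> (10 * Y) (10 * Y powr - w) y0 y1 y2" if Y: "Y \<ge> max 2 X0" for Y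
  proof -
    define X where "X = Y powr w"
    \<comment> \<open>By \<open>w * (1 - l) = 1\<close> this is \<open>X powr - l\<close>; thus
      \<open>La / Y\<close> is the wanted bound for the form, and \<open>X * La = Y\<close>.\<close>
    define La where "La = Y powr (1 - w)"
    have Y2: "Y \<ge> 2" "Y \<ge> X0" "Y > 0" using Y by auto
    have "X \<ge> Y powr 1" unfolding X_def using Y2 w by (intro powr_mono) auto
    then have XY: "X \<ge> Y" using Y2 by simp
    have "- (w * l) = 1 - w" using w(2) by (simp add: algebra_simps)
    then have XLa: "X powr - l = La" unfolding X_def La_def powr_powr by simp
    have La: "0 < La" unfolding La_def using Y2 by simp
    have La1: "La < 1" unfolding La_def using Y2 w by (intro powr_less_one) auto
    have LaY: "X * La = Y" "La / Y = Y powr - w" unfolding X_def La_def using Y2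
      by (simp_all add: powr_diff powr_minus field_simps)
    let ?P = "\<lambda>(x0, x1, x2). simul \<xi> X La x0 x1 x2"
    have "\<exists>t. ?P t" using X0[of X] XY Y2 XLa by auto
    then obtain t where "?P t" and "\<And>t'. ?P t' \<Longrightarrow> nat \<bar>fst t\<bar> \<le> nat \<bar>fst t'\<bar>"
      using ex_has_least_nat[of ?P _ "\<lambda>t. nat \<bar>fst t\<bar>"] by blast
    then obtain x0 x1 x2 where x: "simul \<xi> X La x0 x1 x2"
      and min: "\<And>x0' x1' x2'. simul \<xi> X La x0' x1' x2' \<Longrightarrow> \<bar>x0\<bar> \<le> \<bar>x0'\<bar>"
      by (cases t) (fastforce simp: nat_le_iff)
    have xd: "\<bar>real_of_int x0\<bar> \<le> X" "\<bar>x0 * \<xi> - x1\<bar> \<le> La" "\<bar>x0 * \<xi>\<^sup>2 - x2\<bar> \<le> La"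
      using x unfolding simul_def by auto
    have x0: "x0 \<noteq> 0"
    proof
      assume "x0 = 0"
      then have "\<bar>real_of_int x1\<bar> < 1" "\<bar>real_of_int x2\<bar> < 1" using xd La1 by auto
      then show False using x \<open>x0 = 0\<close> unfolding simul_def by auto
    qed
    show ?thesis
    proof (cases "\<bar>real_of_int x0\<bar> \<le> Y\<^sup>2")
      case True
      have "Y \<ge> 1" using Y2 by simp
      from exists_dual_orthogonal[OF x0 True this La xd(2,3)] obtain y0 y1 y2
        where "dual \<xi> Y (10 * La / Y) y0 y1 y2" .
      moreover have "10 * La / Y = 10 * Y powr - w" using LaY by simp
      ultimately show ?thesis using dual_mono[of \<xi> Y _ y0 y1 y2 "10 * Y"] Y2 by fastforce
    next
      case False
      \<comment> \<open>Any size below \<open>\<bar>x0\<bar>\<close> rules out points proportional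
        to the minimal one; half of it keeps \<open>\<bar>x0\<bar> * L'\<close> at most
        \<open>2 * Y\<close>.\<close>
      define X' where "X' = \<bar>real_of_int x0\<bar> / 2"
      define L' where "L' = X' powr - l"
      have "2 * Y \<le> Y\<^sup>2" using Y2 by (simp add: power2_eq_square)
      then have X': "X' \<ge> Y" "X' \<le> X" "(Y / 2)\<^sup>2 \<le> X'" using False xd(1) unfolding X'_def
        by (auto simp: power_divide)
      then have "X' \<ge> X0" "X' > 0" "X' \<ge> 1" using Y2 by auto
      then obtain x0' x1' x2' where x': "simul \<xi> X' L' x0' x1' x2'" using X0 unfolding L'_def by blast
      have x'd: "\<bar>real_of_int x0'\<bar> \<le> X'" "\<bar>x0' * \<xi> - x1'\<bar> \<le> L'" "\<bar>x0' * \<xi>\<^sup>2 - x2'\<bar> \<le> L'"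
        using x' unfolding simul_def by auto
      \<comment> \<open>Here \<open>l > 1 / 2\<close> and the case assumption
        \<open>\<bar>x0\<bar> > Y\<^sup>2\<close> bound the second error.\<close>
      have "L' \<le> X' powr - (1 / 2)" unfolding L'_def using \<open>X' \<ge> 1\<close> l by (intro powr_mono) auto
      also have "\<dots> = 1 / sqrt X'" using \<open>X' > 0\<close> by (simp add: powr_minus powr_half_sqrt field_simps)
      also have "\<dots> \<le> 1 / (Y / 2)"
        using real_le_rsqrt[OF X'(3)] Y2 \<open>X' > 0\<close> by (intro divide_left_mono) auto
      finally have L': "L' \<le> 2 / Y" by simp
      have L'0: "L' > 0" unfolding L'_def using \<open>X' > 0\<close> by simp
      have "\<bar>real_of_int x0\<bar> * L' = 2 * (X' powr 1 * X' powr - l)"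
        unfolding L'_def using \<open>X' > 0\<close> by (simp add: X'_def)
      also have "\<dots> = 2 * X' powr (1 - l)" unfolding powr_add[symmetric] by simp
      also have "\<dots> \<le> 2 * X powr (1 - l)" using X' \<open>X' > 0\<close> l by (intro mult_left_mono powr_mono2) auto
      also have "\<dots> = 2 * Y" unfolding X_def powr_powr w(2) using Y2 by simp
      finally have xL': "\<bar>real_of_int x0\<bar> * L' \<le> 2 * Y" .
      have x'La: "\<bar>real_of_int x0'\<bar> * La \<le> Y"
        unfolding LaY(1)[symmetric] using x'd(1) X'(2) La by (intro mult_right_mono) auto
      define y0 where "y0 = x1 * x2' - x2 * x1'"
      define y1 where "y1 = x2 * x0' - x0 * x2'"
      define y2 where "y2 = x0 * x1' - x1 * x0'"
      \<comment> \<open>Errors of proportional points are proportional to their first coordinates,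
        so \<open>x'\<close> would be a point for \<open>X\<close> with a smaller first
        coordinate.\<close>
      have nz: "(y0, y1, y2) \<noteq> (0, 0, 0)"
      proof
        assume "(y0, y1, y2) = (0, 0, 0)"
        then have par: "real_of_int x0 * x1' = x1 * x0'" "real_of_int x0 * x2' = x2 * x0'"
          unfolding y1_def y2_def by (auto simp flip: of_int_mult simp: algebra_simps)
        have lt: "\<bar>real_of_int x0'\<bar> < \<bar>real_of_int x0\<bar>" using x'd(1) x0 unfolding X'_def by linarith
        have "x0 * (x0' * \<xi> - x1') = x0' * (x0 * \<xi> - x1)" "x0 * (x0' * \<xi>\<^sup>2 - x2') = x0' * (x0 * \<xi>\<^sup>2 - x2)"
          using par by (simp_all add: algebra_simps)
        then have "\<bar>real_of_int x0\<bar> * \<bar>x0' * \<xi> - x1'\<bar> = \<bar>real_of_int x0'\<bar> * \<bar>x0 * \<xi> - x1\<bar>"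
          "\<bar>real_of_int x0\<bar> * \<bar>x0' * \<xi>\<^sup>2 - x2'\<bar> = \<bar>real_of_int x0'\<bar> * \<bar>x0 * \<xi>\<^sup>2 - x2\<bar>"
          by (simp_all flip: abs_mult)
        moreover have "\<bar>real_of_int x0'\<bar> * \<bar>x0 * \<xi> - x1\<bar> \<le> \<bar>real_of_int x0\<bar> * La"
          "\<bar>real_of_int x0'\<bar> * \<bar>x0 * \<xi>\<^sup>2 - x2\<bar> \<le> \<bar>real_of_int x0\<bar> * La"
          using lt xd by (intro mult_mono; auto)+
        ultimately have "\<bar>real_of_int x0\<bar> * \<bar>x0' * \<xi> - x1'\<bar> \<le> \<bar>real_of_int x0\<bar> * La"
          "\<bar>real_of_int x0\<bar> * \<bar>x0' * \<xi>\<^sup>2 - x2'\<bar> \<le> \<bar>real_of_int x0\<bar> * La" by linarith+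
        then have "\<bar>x0' * \<xi> - x1'\<bar> \<le> La" "\<bar>x0' * \<xi>\<^sup>2 - x2'\<bar> \<le> La"
          using x0 by (auto dest: mult_left_le_imp_le)
        then have "simul \<xi> X La x0' x1' x2'" using x' X'(2) unfolding simul_def by auto
        from min[OF this] lt show False by linarith
      qed
      have "\<bar>real_of_int y0 + y1 * \<xi> + y2 * \<xi>\<^sup>2\<bar>
          = \<bar>(x0 * \<xi> - x1) * (x0' * \<xi>\<^sup>2 - x2') - (x0 * \<xi>\<^sup>2 - x2) * (x0' * \<xi> - x1')\<bar>"
        unfolding y0_def y1_def y2_def by (simp add: algebra_simps power2_eq_square)
      also have "\<dots> \<le> \<bar>(x0 * \<xi> - x1) * (x0' * \<xi>\<^sup>2 - x2')\<bar> + \<bar>(x0 * \<xi>\<^sup>2 - x2) * (x0' * \<xi> - x1')\<bar>"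
        by (rule abs_triangle_ineq4)
      also have "\<dots> \<le> La * L' + La * L'"
        unfolding abs_mult using xd x'd La by (intro add_mono mult_mono) auto
      also have "\<dots> \<le> La * (2 / Y) + La * (2 / Y)" using L' La by (intro add_mono mult_left_mono) auto
      also have "\<dots> = 4 * (La / Y)" by simp
      also have "\<dots> \<le> 10 * Y powr - w" unfolding LaY by simp
      finally have yX: "\<bar>real_of_int y0 + y1 * \<xi> + y2 * \<xi>\<^sup>2\<bar> \<le> 10 * Y powr - w" .
      have "\<bar>real_of_int y1\<bar> = \<bar>x0 * (x0' * \<xi>\<^sup>2 - x2') - x0' * (x0 * \<xi>\<^sup>2 - x2)\<bar>"
        unfolding y1_def by (simp add: algebra_simps)
      also have "\<dots> \<le> \<bar>x0 * (x0' * \<xi>\<^sup>2 - x2')\<bar> + \<bar>x0' * (x0 * \<xi>\<^sup>2 - x2)\<bar>" by (rule abs_triangle_ineq4)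
      also have "\<dots> \<le> \<bar>real_of_int x0\<bar> * L' + \<bar>real_of_int x0'\<bar> * La"
        unfolding abs_mult using xd x'd by (intro add_mono mult_left_mono) auto
      finally have y1: "\<bar>real_of_int y1\<bar> \<le> 10 * Y" using xL' x'La Y2 by linarith
      have "\<bar>real_of_int y2\<bar> = \<bar>x0' * (x0 * \<xi> - x1) - x0 * (x0' * \<xi> - x1')\<bar>"
        unfolding y2_def by (simp add: algebra_simps)
      also have "\<dots> \<le> \<bar>x0' * (x0 * \<xi> - x1)\<bar> + \<bar>x0 * (x0' * \<xi> - x1')\<bar>" by (rule abs_triangle_ineq4)
      also have "\<dots> \<le> \<bar>real_of_int x0'\<bar> * La + \<bar>real_of_int x0\<bar> * L'"
        unfolding abs_mult using xd x'd by (intro add_mono mult_left_mono) auto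
      finally have y2: "\<bar>real_of_int y2\<bar> \<le> 10 * Y" using xL' x'La Y2 by linarith
      show ?thesis using nz yX y1 y2 unfolding dual_def by blast
    qed
  qed
  then show "\<forall>\<^sub>F Y in at_top. \<exists>y0 y1 y2. dual \<xi> (10 * Y) (10 * Y powr - (1 / (1 - l))) y0 y1 y2"
    unfolding w_def[symmetric] eventually_at_top_linorder by blast
qed simp

text \<open>The same argument with forms in place of points: the value \<open>m\<close> of a form
  with least coefficients decides between a point at which this form vanishes and the cross product
  with a form of value at most \<open>m / 2\<close>. The degree hypothesis ensures
  \<open>m > 0\<close>, so that the second form exists.\<close>

lemma omega_admissible_imp_lambda_admissible:
  fixes \<xi> w l' :: real
  assumes w: "w > 2" and adm: "omega_admissible \<xi> w" and deg: "deg_gt_2 \<xi>" and l': "l' < 1 - 1 / w"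
  shows "lambda_admissible \<xi> l'"
proof (rule lambda_admissible_scaled[OF _ _ l'])
  define l where "l = 1 - 1 / w"
  obtain Y0 where Y0: "\<And>Y. Y \<ge> Y0 \<Longrightarrow> \<exists>y0 y1 y2. dual \<xi> Y (Y powr - w) y0 y1 y2"
    using adm unfolding omega_admissible_def eventually_at_top_linorder by blast
  have "\<exists>x0 x1 x2. simul \<xi> (10 * X) (10 * X powr - l) x0 x1 x2"
    if X: "X \<ge> max 2 (max 1 Y0 powr w)" for X
  proof -
    define Y where "Y = X powr (1 / w)"
    have X2: "X \<ge> 2" using X by simp
    have "max 1 Y0 = (max 1 Y0 powr w) powr (1 / w)" using w by (simp add: powr_powr)
    also have "\<dots> \<le> Y" unfolding Y_def using X w by (intro powr_mono2) auto
    finally have Y: "Y \<ge> 1" "Y \<ge> Y0" by auto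
    have Yw: "Y powr - w = 1 / X" unfolding Y_def powr_powr using w X2 by (simp add: powr_minus field_simps)
    have "Y \<le> X powr 1" unfolding Y_def using w X2 by (intro powr_mono) auto
    then have YX: "Y \<le> X" using X2 by simp
    have YXl: "Y / X = X powr - l" unfolding Y_def l_def using X2 by (simp add: powr_diff)
    let ?P = "\<lambda>(y0, y1, y2). dual \<xi> Y (1 / X) y0 y1 y2"
    let ?m = "\<lambda>(y0, y1, y2). nat (\<bar>y1\<bar> + \<bar>y2\<bar>)"
    have "\<exists>t. ?P t" using Y0[of Y] Y Yw by auto
    then obtain t where "?P t" and "\<And>t'. ?P t' \<Longrightarrow> ?m t \<le> ?m t'"
      using ex_has_least_nat[of ?P _ ?m] by blast
    then obtain y0 y1 y2 where y: "dual \<xi> Y (1 / X) y0 y1 y2"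
      and min: "\<And>y0' y1' y2'. dual \<xi> Y (1 / X) y0' y1' y2' \<Longrightarrow> \<bar>y1\<bar> + \<bar>y2\<bar> \<le> \<bar>y1'\<bar> + \<bar>y2'\<bar>"
      by (cases t) (fastforce simp: nat_le_iff)
    define h where "h = max \<bar>real_of_int y1\<bar> \<bar>real_of_int y2\<bar>"
    define v where "v = real_of_int y0 + y1 * \<xi> + y2 * \<xi>\<^sup>2"
    define m where "m = \<bar>v\<bar>"
    have yd: "m \<le> 1 / X" "h \<le> Y" using y unfolding dual_def m_def h_def v_def by auto
    have "m \<noteq> 0" using deg y unfolding deg_gt_2_int m_def v_def dual_def by auto
    then have m0: "m > 0" unfolding m_def by simp
    have "1 / X < 1" using X2 by simp
    then have h1: "h \<ge> 1"
    proof (rule_tac ccontr)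
      assume "1 / X < 1" "\<not> 1 \<le> h"
      then have "y1 = 0" "y2 = 0" unfolding h_def by auto
      then have "\<bar>real_of_int y0\<bar> < 1" using yd(1) \<open>1 / X < 1\<close> unfolding m_def v_def by auto
      then show False using y \<open>y1 = 0\<close> \<open>y2 = 0\<close> unfolding dual_def by auto
    qed
    show ?thesis
    \<comment> \<open>This threshold bounds the error \<open>X * m / h\<close> of a point orthogonal
      to the form by \<open>Y / X\<close>, which is \<open>X powr - l\<close>.\<close>
    proof (cases "m \<le> Y * h / X\<^sup>2")
      case True
      have h: "0 < h" "h \<le> X" using h1 yd YX by auto
      obtain x0 x1 x2 where "simul \<xi> X (X * m / h + 2 * h / X) x0 x1 x2"
        using exists_simul_orthogonal[OF h[unfolded h_def], of \<xi> y0] unfolding h_def[symmetric] v_def[symmetric] m_def .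
      moreover have "X * m / h + 2 * h / X \<le> 10 * X powr - l"
      proof -
        have "X * m / h \<le> X * (Y * h / X\<^sup>2) / h" using True h X2 by (intro divide_right_mono mult_left_mono) auto
        also have "\<dots> = Y / X" using h X2 by (simp add: power2_eq_square)
        finally have "X * m / h \<le> Y / X" .
        moreover have "2 * h / X \<le> 2 * Y / X" using yd X2 by (intro divide_right_mono) auto
        moreover have "Y / X > 0" using Y X2 by simp
        ultimately show ?thesis unfolding YXl[symmetric] by simp
      qed
      ultimately show ?thesis using simul_mono[of \<xi> X _ x0 x1 x2 "10 * X"] X2 by fastforce
    next
      case False
      \<comment> \<open>Solves \<open>Y' powr - w = m / 2\<close>. A form proportional to the first
        one with at most half its value has at most half its coefficients, against
        minimality.\<close>
      define Y' where "Y' = (2 / m) powr (1 / w)"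
      have Xm: "X \<le> 2 / m" using yd(1) m0 X2 by (simp add: field_simps)
      then have "Y \<le> Y'" unfolding Y_def Y'_def using w X2 by (intro powr_mono2) auto
      moreover have Y'w: "Y' powr - w = m / 2" unfolding Y'_def powr_powr using w m0 by (simp add: powr_minus)
      ultimately obtain y0' y1' y2' where y': "dual \<xi> Y' (m / 2) y0' y1' y2'" using Y0[of Y'] Y by auto
      define v' where "v' = real_of_int y0' + y1' * \<xi> + y2' * \<xi>\<^sup>2"
      have y'd: "\<bar>v'\<bar> \<le> m / 2" "\<bar>real_of_int y1'\<bar> \<le> Y'" "\<bar>real_of_int y2'\<bar> \<le> Y'"
        using y' unfolding dual_def v'_def by auto
      define x0 where "x0 = y1 * y2' - y2 * y1'"
      define x1 where "x1 = y2 * y0' - y0 * y2'"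
      define x2 where "x2 = y0 * y1' - y1 * y0'"
      have nz: "(x0, x1, x2) \<noteq> (0, 0, 0)"
      proof
        assume "(x0, x1, x2) = (0, 0, 0)"
        then have par: "real_of_int y1 * y2' = y2 * y1'" "real_of_int y2 * y0' = y0 * y2'" "real_of_int y0 * y1' = y1 * y0'"
          unfolding x0_def x1_def x2_def by (auto simp flip: of_int_mult simp: algebra_simps)
        have "y1' * v = y1 * v'" "y2' * v = y2 * v'"
          unfolding v_def v'_def using par by (simp_all add: algebra_simps)
        then have "\<bar>real_of_int y1'\<bar> * m = \<bar>real_of_int y1\<bar> * \<bar>v'\<bar>" "\<bar>real_of_int y2'\<bar> * m = \<bar>real_of_int y2\<bar> * \<bar>v'\<bar>"
          unfolding m_def by (simp_all flip: abs_mult)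
        moreover have "\<bar>real_of_int y1\<bar> * \<bar>v'\<bar> \<le> \<bar>real_of_int y1\<bar> * (m / 2)" "\<bar>real_of_int y2\<bar> * \<bar>v'\<bar> \<le> \<bar>real_of_int y2\<bar> * (m / 2)"
          using y'd by (intro mult_left_mono; simp)+
        ultimately have "\<bar>real_of_int y1'\<bar> * m \<le> (\<bar>real_of_int y1\<bar> / 2) * m" "\<bar>real_of_int y2'\<bar> * m \<le> (\<bar>real_of_int y2\<bar> / 2) * m"
          by simp_all
        then have half: "\<bar>real_of_int y1'\<bar> \<le> \<bar>real_of_int y1\<bar> / 2" "\<bar>real_of_int y2'\<bar> \<le> \<bar>real_of_int y2\<bar> / 2"
          using m0 by (simp_all only: mult_le_cancel_right_pos)
        have "\<bar>real_of_int y1'\<bar> \<le> Y" "\<bar>real_of_int y2'\<bar> \<le> Y" "\<bar>v'\<bar> \<le> 1 / X"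
          using half yd y'd(1) m0 unfolding h_def by linarith+
        then have "dual \<xi> Y (1 / X) y0' y1' y2'" using y' unfolding dual_def v'_def by auto
        from min[OF this] have "\<bar>real_of_int y1\<bar> + \<bar>real_of_int y2\<bar> \<le> \<bar>real_of_int y1'\<bar> + \<bar>real_of_int y2'\<bar>"
          by linarith
        with half h1 show False unfolding h_def by linarith
      qed
      \<comment> \<open>Failure of the threshold and \<open>h \<le> Y\<close> bound
        \<open>2 / m\<close> by the square of \<open>2 * X / h\<close>. This base is at least 1, so
        \<open>w > 2\<close> allows the exponent \<open>w\<close>, and taking roots gives
        \<open>h * Y' \<le> 2 * X\<close>.\<close>
      have "2 / m \<le> 2 * X\<^sup>2 / (Y * h)" using False m0 X2 Y h1 by (simp add: field_simps)
      also have "\<dots> \<le> 4 * X\<^sup>2 / h\<^sup>2"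
      proof -
        have "h\<^sup>2 \<le> 2 * (Y * h)" using yd(2) h1 by (simp add: power2_eq_square)
        then show ?thesis using h1 Y X2 by (simp add: divide_simps power2_eq_square mult_left_mono)
      qed
      also have "\<dots> = (2 * X / h) powr 2" using X2 h1 by (simp add: power_divide power_mult_distrib powr_numeral)
      also have "\<dots> \<le> (2 * X / h) powr w" using w X2 h1 yd YX by (intro powr_mono) (auto simp: field_simps)
      finally have "Y' \<le> ((2 * X / h) powr w) powr (1 / w)"
        unfolding Y'_def using m0 w by (intro powr_mono2) auto
      also have "\<dots> = 2 * X / h" unfolding powr_powr using w X2 h1 by simp
      finally have hY': "h * Y' \<le> 2 * X" using h1 by (simp add: field_simps)
      have "m * Y' = 2 * ((2 / m) powr - 1 * (2 / m) powr (1 / w))"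
        unfolding Y'_def using m0 by (simp add: powr_minus field_simps)
      also have "\<dots> = 2 * (2 / m) powr - l" unfolding powr_add[symmetric] l_def by simp
      also have "\<dots> \<le> 2 * X powr - l"
        using Xm X2 w unfolding l_def by (intro mult_left_mono powr_mono2') auto
      finally have mY': "m * Y' \<le> 2 * X powr - l" .
      have "h * m \<le> Y * (1 / X)" using yd m0 Y by (intro mult_mono) auto
      then have hm: "h * m \<le> X powr - l" using YXl by simp
      have yh: "\<bar>real_of_int y1\<bar> \<le> h" "\<bar>real_of_int y2\<bar> \<le> h" unfolding h_def by auto
      have "\<bar>real_of_int x0\<bar> \<le> \<bar>real_of_int y1 * y2'\<bar> + \<bar>real_of_int y2 * y1'\<bar>"
        unfolding x0_def of_int_diff of_int_mult by (rule abs_triangle_ineq4)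
      also have "\<dots> \<le> h * Y' + h * Y'" unfolding abs_mult using yh y'd h1 by (intro add_mono mult_mono) auto
      finally have x0: "\<bar>real_of_int x0\<bar> \<le> 10 * X" using hY' X2 by linarith
      have bd: "\<bar>real_of_int z * v' - v * z'\<bar> \<le> 10 * X powr - l" if "\<bar>real_of_int z\<bar> \<le> h" "\<bar>real_of_int z'\<bar> \<le> Y'" for z z' :: int
      proof -
        have "\<bar>real_of_int z * v' - v * z'\<bar> \<le> \<bar>real_of_int z * v'\<bar> + \<bar>v * z'\<bar>" by (rule abs_triangle_ineq4)
        also have "\<dots> \<le> h * m + m * Y'"
          unfolding abs_mult m_def[symmetric] using that y'd m0 h1 by (intro add_mono mult_mono) auto
        also have "\<dots> \<le> 10 * X powr - l" using hm mY' powr_ge_zero[of X "- l"] by linarith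
        finally show ?thesis .
      qed
      have "x0 * \<xi> - x1 = - (y2 * v' - v * y2')" "x0 * \<xi>\<^sup>2 - x2 = y1 * v' - v * y1'"
        unfolding x0_def x1_def x2_def v_def v'_def by (simp_all add: algebra_simps power2_eq_square)
      then have "\<bar>x0 * \<xi> - x1\<bar> \<le> 10 * X powr - l" "\<bar>x0 * \<xi>\<^sup>2 - x2\<bar> \<le> 10 * X powr - l"
        using bd[OF yh(2) y'd(3)] bd[OF yh(1) y'd(2)] by (simp_all only: abs_minus_cancel)
      then show ?thesis using nz x0 unfolding simul_def by blast
    qed
  qed
  then show "\<forall>\<^sub>F X in at_top. \<exists>x0 x1 x2. simul \<xi> (10 * X) (10 * X powr - (1 - 1 / w)) x0 x1 x2"
    unfolding l_def[symmetric] eventually_at_top_linorder by blast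
qed simp

section \<open>Dirichlet's lower bounds\<close>

text \<open>Dirichlet's simultaneous theorem with \<open>N\<close> the integer part of
  \<open>sqrt X\<close> gives a denominator at most \<open>N\<^sup>2\<close> and errors below
  \<open>1 / N\<close>. Constants are lost, hence the detour through all exponents below
  \<open>1 / 2\<close>.\<close>

lemma half_le_lambda_hat2: "ereal (1 / 2) \<le> lambda_hat2 \<xi>"
proof (rule ereal_le_real)
  fix z assume "lambda_hat2 \<xi> \<le> ereal z"
  have "lambda_admissible \<xi> l'" if l': "l' < 1 / 2" for l'
  proof (rule lambda_admissible_scaled[OF _ _ l'])
    have "\<exists>x0 x1 x2. simul \<xi> (2 * X) (2 * X powr - (1 / 2)) x0 x1 x2" if X: "X \<ge> 1" for X
    proof -
      define N where "N = nat \<lfloor>sqrt X\<rfloor>"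
      have "1 \<le> sqrt X" using X by simp
      then have N: "N > 0" "N \<le> sqrt X" "sqrt X \<le> 2 * N" unfolding N_def using le_twice_floor[of "sqrt X"] by auto
      define \<theta> where "\<theta> = (\<lambda>i :: nat. if i = 0 then \<xi> else \<xi>\<^sup>2)"
      obtain q p where q: "0 < q" "q \<le> int (N ^ 2)" and p: "\<And>i. i < 2 \<Longrightarrow> \<bar>of_int q * \<theta> i - of_int (p i)\<bar> < 1 / N"
        using Dirichlet_approx_simult[OF N(1), of 2 \<theta>] by blast
      have "real_of_int q \<le> real N ^ 2" using q(2) by (metis of_int_le_iff of_int_of_nat_eq of_nat_power)
      also have "\<dots> \<le> sqrt X ^ 2" using N by (intro power_mono) auto
      finally have q': "\<bar>real_of_int q\<bar> \<le> 2 * X" using X q(1) by simp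
      have "1 / real N \<le> 2 / sqrt X" using N X by (simp add: field_simps)
      also have "\<dots> = 2 * X powr - (1 / 2)" using X by (simp add: powr_minus powr_half_sqrt field_simps)
      finally have "1 / real N \<le> 2 * X powr - (1 / 2)" .
      then have "simul \<xi> (2 * X) (2 * X powr - (1 / 2)) q (p 0) (p 1)"
        using p[of 0] p[of 1] q(1) q' unfolding simul_def \<theta>_def by auto
      then show ?thesis by blast
    qed
    then show "\<forall>\<^sub>F X in at_top. \<exists>x0 x1 x2. simul \<xi> (2 * X) (2 * X powr - (1 / 2)) x0 x1 x2"
      unfolding eventually_at_top_linorder by blast
  qed simp
  then have "l' \<le> z" if "l' < 1 / 2" for l'
    using lambda_admissible_le[of \<xi> l'] that \<open>lambda_hat2 \<xi> \<le> ereal z\<close> by (metis ereal_less_eq(3) order_trans)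
  then show "ereal (1 / 2) \<le> ereal z" unfolding ereal_less_eq by (rule dense_le)
qed

text \<open>The \<open>(N + 1)\<^sup>2\<close> fractional parts of
  \<open>y1 * \<xi> + y2 * \<xi>\<^sup>2\<close> fall into \<open>N\<^sup>2\<close> subintervals;
  modulus 1 makes the residue condition trivial.\<close>

lemma two_le_omega_hat2: "ereal 2 \<le> omega_hat2 \<xi>"
proof (rule ereal_le_real)
  fix z assume "omega_hat2 \<xi> \<le> ereal z"
  have "omega_admissible \<xi> w'" if w': "w' < 2" for w'
  proof (rule omega_admissible_scaled[OF _ _ w'])
    have "\<exists>y0 y1 y2. dual \<xi> (4 * Y) (4 * Y powr - 2) y0 y1 y2" if Y: "Y \<ge> 1" for Y
    proof -
      define N where "N = \<lfloor>Y\<rfloor>"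
      have N: "N \<ge> 1" "N \<le> Y" "Y \<le> 2 * N" unfolding N_def using Y le_twice_floor[of Y] by auto
      define v where "v = (\<lambda>s :: int \<times> int. (real_of_int (fst s) * \<xi> + real_of_int (snd s) * \<xi>\<^sup>2) - \<lfloor>real_of_int (fst s) * \<xi> + real_of_int (snd s) * \<xi>\<^sup>2\<rfloor>)"
      let ?S = "{0..N} \<times> {0..N}"
      have v: "0 \<le> v s \<and> v s < 0 + 1" for s unfolding v_def by linarith
      have card: "1 * N\<^sup>2 < int (card ?S)" using N by (simp add: card_cartesian_product power2_eq_square algebra_simps)
      have pos: "(1::int) > 0" "N\<^sup>2 > 0" "(1::real) > 0" using N by auto
      obtain s s' where s: "s \<in> ?S" "s' \<in> ?S" "s \<noteq> s'" "\<bar>v s - v s'\<bar> * real_of_int (N\<^sup>2) \<le> 1"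
        using pigeonhole_residue_bucket[where g = "\<lambda>_. 0" and v = v, OF _ pos v card]
        by (metis (no_types, lifting) finite_SigmaI finite_atLeastAtMost_int)
      define y1 where "y1 = fst s - fst s'"
      define y2 where "y2 = snd s - snd s'"
      define y0 where "y0 = \<lfloor>real_of_int (fst s') * \<xi> + real_of_int (snd s') * \<xi>\<^sup>2\<rfloor> - \<lfloor>real_of_int (fst s) * \<xi> + real_of_int (snd s) * \<xi>\<^sup>2\<rfloor>"
      have "(y1, y2) \<noteq> (0, 0)" using s(3) unfolding y1_def y2_def by (auto simp: prod_eq_iff)
      moreover have "\<bar>y1\<bar> \<le> N" "\<bar>y2\<bar> \<le> N" using s(1,2) unfolding y1_def y2_def by auto
      then have "\<bar>real_of_int y1\<bar> \<le> 4 * Y" "\<bar>real_of_int y2\<bar> \<le> 4 * Y" using N(2) Y by linarith+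
      moreover have "\<bar>real_of_int y0 + y1 * \<xi> + y2 * \<xi>\<^sup>2\<bar> \<le> 4 * Y powr - 2"
      proof -
        have e: "real_of_int y0 + y1 * \<xi> + y2 * \<xi>\<^sup>2 = v s - v s'"
          unfolding v_def y1_def y2_def y0_def by (simp add: algebra_simps)
        have "Y\<^sup>2 \<le> (2 * N)\<^sup>2" unfolding of_int_power using N Y by (intro power_mono) auto
        then have "\<bar>v s - v s'\<bar> * Y\<^sup>2 \<le> \<bar>v s - v s'\<bar> * (4 * real_of_int (N\<^sup>2))"
          by (intro mult_left_mono) (auto simp: power_mult_distrib)
        then have "\<bar>v s - v s'\<bar> * Y\<^sup>2 \<le> 4" using s(4) by linarith
        then have "\<bar>v s - v s'\<bar> \<le> 4 / Y\<^sup>2" using Y by (simp add: field_simps)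
        then show ?thesis unfolding e using Y by (simp add: powr_minus powr_numeral field_simps)
      qed
      ultimately show ?thesis unfolding dual_def by (intro exI[of _ y0] exI[of _ y1] exI[of _ y2]) auto
    qed
    then show "\<forall>\<^sub>F Y in at_top. \<exists>y0 y1 y2. dual \<xi> (4 * Y) (4 * Y powr - 2) y0 y1 y2"
      unfolding eventually_at_top_linorder by blast
  qed simp
  then have "w' \<le> z" if "w' < 2" for w'
    using omega_admissible_le[of \<xi> w'] that \<open>omega_hat2 \<xi> \<le> ereal z\<close> by (metis ereal_less_eq(3) order_trans)
  then show "ereal 2 \<le> ereal z" unfolding ereal_less_eq by (rule dense_le)
qed

section \<open>The bound of Davenport and Schmidt\<close>

text \<open>For a first coordinate \<open>n\<close> rounding is the best choice of the other two, so
  minimal points can be indexed by natural numbers.\<close>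

definition approx_error :: "real \<Rightarrow> nat \<Rightarrow> real" where
  "approx_error \<xi> n = max \<bar>real n * \<xi> - real_of_int (round (real n * \<xi>))\<bar>
     \<bar>real n * \<xi>\<^sup>2 - real_of_int (round (real n * \<xi>\<^sup>2))\<bar>"

lemma approx_error_pos:
  assumes "deg_gt_2 \<xi>" "n > 0"
  shows "approx_error \<xi> n > 0"
proof -
  have "real_of_int (- round (real n * \<xi>)) + real_of_int (int n) * \<xi> + real_of_int 0 * \<xi>\<^sup>2 \<noteq> 0"
    using assms unfolding deg_gt_2_int by (metis of_nat_0_less_iff Pair_inject less_numeral_extra(3))
  then have "real n * \<xi> - real_of_int (round (real n * \<xi>)) \<noteq> 0" by simp
  then show ?thesis unfolding approx_error_def by (simp add: less_max_iff_disj)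
qed

lemma simul_imp_approx_error:
  assumes "simul \<xi> X B x0 x1 x2" "B < 1"
  obtains n :: nat where "n > 0" "real n \<le> X" "approx_error \<xi> n \<le> B"
proof -
  have x: "(x0, x1, x2) \<noteq> (0, 0, 0)" "\<bar>real_of_int x0\<bar> \<le> X" "\<bar>x0 * \<xi> - x1\<bar> \<le> B" "\<bar>x0 * \<xi>\<^sup>2 - x2\<bar> \<le> B"
    using assms(1) unfolding simul_def by auto
  have x0: "x0 \<noteq> 0"
  proof
    assume "x0 = 0"
    then have "\<bar>real_of_int x1\<bar> < 1" "\<bar>real_of_int x2\<bar> < 1" using x assms by auto
    then show False using x \<open>x0 = 0\<close> by auto
  qed
  define n where "n = nat \<bar>x0\<bar>"
  define s where "s = sgn x0"
  have n: "real n = \<bar>real_of_int x0\<bar>" "real n = s * x0"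
    unfolding n_def s_def by (auto simp: sgn_if)
  have "\<bar>real_of_int s\<bar> = 1" using x0 unfolding s_def by (auto simp: sgn_if)
  have "\<bar>n * \<xi> - (s * x1)\<bar> = \<bar>s * (x0 * \<xi> - x1)\<bar>" "\<bar>n * \<xi>\<^sup>2 - (s * x2)\<bar> = \<bar>s * (x0 * \<xi>\<^sup>2 - x2)\<bar>"
    unfolding n(2) by (simp_all add: algebra_simps)
  then have "\<bar>n * \<xi> - real_of_int (s * x1)\<bar> \<le> B" "\<bar>n * \<xi>\<^sup>2 - real_of_int (s * x2)\<bar> \<le> B"
    using x \<open>\<bar>real_of_int s\<bar> = 1\<close> by (simp_all add: abs_mult)
  then have "approx_error \<xi> n \<le> B"
    unfolding approx_error_def
    by (meson max.boundedI order_trans round_diff_minimal)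
  moreover have "n > 0" using x0 unfolding n_def by simp
  ultimately show ?thesis using that x(2) n(1) by auto
qed

text \<open>Minimal points are the record holders of \<open>approx_error\<close>. Every number below
  the record following \<open>r i\<close> has error at least that of \<open>r i\<close>, so
  admissibility just below the next record bounds the error of \<open>r i\<close>.\<close>

lemma minimal_points:
  fixes \<xi> l :: real
  assumes deg: "deg_gt_2 \<xi>" and adm: "lambda_admissible \<xi> l" and l: "0 < l" "l \<le> 1"
  obtains x0 x1 x2 :: "nat \<Rightarrow> int" and L :: "nat \<Rightarrow> real" where
    "strict_mono x0" "\<And>i. x0 i > 0"
    "\<And>i. L i = max \<bar>real_of_int (x0 i) * \<xi> - real_of_int (x1 i)\<bar> \<bar>real_of_int (x0 i) * \<xi>\<^sup>2 - real_of_int (x2 i)\<bar>"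
    "\<And>i. L (Suc i) < L i" "\<And>i. L i > 0" "\<And>i. L i \<le> 2 * real_of_int (x0 (Suc i)) powr - l"
proof -
  let ?e = "approx_error \<xi>"
  define R where "R = {n. n > 0 \<and> (\<forall>m. 0 < m \<and> m < n \<longrightarrow> ?e n < ?e m)}"
  have best: "\<exists>r\<in>R. r \<le> N \<and> (\<forall>m. 0 < m \<and> m \<le> N \<longrightarrow> ?e r \<le> ?e m)" if "N > 0" for N
  proof -
    define M where "M = Min (?e ` {1..N})"
    have fin: "finite (?e ` {1..N})" "?e ` {1..N} \<noteq> {}" using that by auto
    have "\<exists>r. 0 < r \<and> r \<le> N \<and> ?e r = M"
    proof -
      obtain r where "r \<in> {1..N}" "M = ?e r" using Min_in[OF fin] unfolding M_def by blast
      then show ?thesis by (intro exI[of _ r]) auto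
    qed
    \<comment> \<open>The least minimiser is a record, since all smaller numbers have strictly
      larger error.\<close>
    define r where "r = (LEAST r. 0 < r \<and> r \<le> N \<and> ?e r = M)"
    have r: "0 < r \<and> r \<le> N \<and> ?e r = M" unfolding r_def using \<open>\<exists>r. _ r\<close> by (rule LeastI_ex)
    have M: "M \<le> ?e m" if "0 < m" "m \<le> N" for m unfolding M_def using that fin by (intro Min_le) auto
    have "?e r < ?e m" if "0 < m" "m < r" for m
    proof -
      have "?e m \<noteq> M" using not_less_Least[of m "\<lambda>r. 0 < r \<and> r \<le> N \<and> ?e r = M"] that r unfolding r_def by auto
      moreover have "M \<le> ?e m" using M that r by auto
      ultimately show ?thesis using r by auto
    qed
    then show ?thesis using r M unfolding R_def by blast
  qed
  obtain X0 where X0: "\<And>X. X \<ge> X0 \<Longrightarrow> \<exists>x0 x1 x2. simul \<xi> X (X powr - l) x0 x1 x2"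
    using adm unfolding lambda_admissible_def eventually_at_top_linorder by blast
  have small: "\<exists>n>0. real n \<le> X \<and> ?e n \<le> X powr - l" if X: "X \<ge> max 2 X0" for X
  proof -
    have "X powr - l < 1" using X l by (intro powr_less_one) auto
    moreover obtain x0 x1 x2 where "simul \<xi> X (X powr - l) x0 x1 x2" using X0[of X] X by auto
    ultimately obtain n :: nat where "n > 0" "real n \<le> X" "?e n \<le> X powr - l"
      using simul_imp_approx_error by metis
    then show ?thesis by blast
  qed
  \<comment> \<open>Finitely many records would keep the error away from 0, while admissibility
    makes it arbitrarily small.\<close>
  have inf: "infinite R"
    unfolding infinite_nat_iff_unbounded
  proof
    fix N
    define M where "M = Min (?e ` {1..Suc N})"
    have M: "M \<le> ?e m" if "0 < m" "m \<le> Suc N" for m unfolding M_def using that by (intro Min_le) auto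
    have "M \<in> ?e ` {1..Suc N}" unfolding M_def by (intro Min_in) auto
    then have "M > 0" using approx_error_pos[OF deg] by auto
    have "((\<lambda>X::real. X powr - l) \<longlongrightarrow> 0) at_top"
      using l by (intro tendsto_neg_powr filterlim_ident) auto
    then have "\<forall>\<^sub>F X in at_top. X powr - l < M" using \<open>M > 0\<close> by (rule order_tendstoD(2))
    then obtain X1 where X1: "\<And>X. X \<ge> X1 \<Longrightarrow> X powr - l < M" unfolding eventually_at_top_linorder by blast
    define X where "X = max X1 (max 2 X0)"
    have "X \<ge> X1" "X \<ge> max 2 X0" unfolding X_def by simp_all
    then have "X powr - l < M" using X1 by blast
    then obtain n where n: "n > 0" "?e n < M" using small[OF \<open>X \<ge> max 2 X0\<close>] by auto
    obtain r where r: "r \<in> R" "?e r \<le> ?e n" using best[OF n(1)] n(1) by blast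
    then have "\<not> r \<le> N" using M[of r] n(2) unfolding R_def by auto
    then show "\<exists>r>N. r \<in> R" using r(1) by (intro exI[of _ r]) simp
  qed
  \<comment> \<open>Dropping the first \<open>k\<close> records makes \<open>r (Suc i) - 1\<close>
    large enough for \<open>small\<close>.\<close>
  define k where "k = nat \<lceil>max 2 X0\<rceil> + 2"
  define r where "r = (\<lambda>i. enumerate R (i + k))"
  have mono: "strict_mono r"
    unfolding r_def using strict_mono_enumerate[OF inf] by (auto simp: strict_mono_def)
  have rR: "r i \<in> R" for i unfolding r_def by (rule enumerate_in_set[OF inf])
  have dec: "?e (r (Suc i)) < ?e (r i)" for i
    using rR[of "Suc i"] rR[of i] strict_monoD[OF mono, of i "Suc i"] unfolding R_def by auto
  have bound: "?e (r i) \<le> 2 * real (r (Suc i)) powr - l" for i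
  proof -
    define s where "s = r (Suc i)"
    have "s \<ge> Suc i + k" unfolding s_def r_def by (rule le_enumerate[OF inf])
    then have "real s \<ge> k + 1" by simp
    moreover have "real k \<ge> max 2 X0 + 2" unfolding k_def by linarith
    ultimately have s: "real s - 1 \<ge> max 2 X0" "real s \<ge> 2" by linarith+
    obtain n where n: "n > 0" "real n \<le> real s - 1" "?e n \<le> (real s - 1) powr - l" using small[OF s(1)] by blast
    have "s \<ge> 2" using s(2) by simp
    moreover from this have "n \<le> s - 1" using n(2) by linarith
    ultimately obtain r' where r': "r' \<in> R" "r' \<le> s - 1" "?e r' \<le> ?e n"
      using best[of "s - 1"] n(1) by fastforce
    obtain j where j: "r' = enumerate R j" using enumerate_Ex[OF inf r'(1)] by metis
    have "r' < s" using r'(2) \<open>s \<ge> 2\<close> by linarith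
    then have "enumerate R j < enumerate R (Suc i + k)" unfolding j s_def r_def by simp
    then have "j < Suc i + k" by (simp add: enumerate_mono_iff[OF inf])
    then have "r' \<le> r i" unfolding j r_def using enumerate_mono_le_iff[OF inf] by simp
    then have "?e (r i) \<le> ?e r'"
      using rR[of i] r'(1) unfolding R_def by (cases "r' = r i") (auto intro: less_imp_le)
    also have "\<dots> \<le> (real s - 1) powr - l" using r' n by linarith
    \<comment> \<open>The factor 2 of the claim comes from \<open>s - 1 \<ge> s / 2\<close> and
      \<open>l \<le> 1\<close>.\<close>
    also have "\<dots> \<le> (real s / 2) powr - l" using s l by (intro powr_mono2') auto
    also have "\<dots> = 2 powr l * real s powr - l" using s by (simp add: powr_divide powr_minus field_simps)
    also have "\<dots> \<le> 2 powr 1 * real s powr - l" using l by (intro mult_right_mono powr_mono) auto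
    finally show ?thesis unfolding s_def by simp
  qed
  show ?thesis
  proof (rule that[of "\<lambda>i. int (r i)" "\<lambda>i. ?e (r i)" "\<lambda>i. round (real (r i) * \<xi>)" "\<lambda>i. round (real (r i) * \<xi>\<^sup>2)"])
    show "strict_mono (\<lambda>i. int (r i))" using mono by (auto simp: strict_mono_def)
    show "\<And>i. 0 < int (r i)" using rR unfolding R_def by auto
    show "\<And>i. 0 < ?e (r i)" using approx_error_pos[OF deg] rR unfolding R_def by auto
  qed (use dec bound in \<open>auto simp: approx_error_def\<close>)
qed

lemma golden_facts: "golden > 1" "golden < 2" "golden\<^sup>2 = golden + 1" "1 / golden = golden - 1"
proof -
  have s: "sqrt 5 * sqrt 5 = 5" "sqrt 5 > 1" "sqrt 5 < 3"
    by (simp, simp, rule real_less_lsqrt) auto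
  show "golden > 1" "golden < 2" using s unfolding golden_def by auto
  show "golden\<^sup>2 = golden + 1" unfolding golden_def power2_eq_square using s(1) by (simp add: field_simps)
  then show "1 / golden = golden - 1" using \<open>golden > 1\<close> by (simp add: field_simps power2_eq_square)
qed

text \<open>A form vanishing on two independent vectors vanishes on every vector in their plane. Two
  coordinates of the cross product of \<open>a\<close> and \<open>b\<close> suffice, because in the
  application one of these is known to be nonzero.\<close>

lemma cross_product_step:
  fixes y0 y1 y2 a0 a1 a2 b0 b1 b2 c0 c1 c2 :: int
  assumes "y0 * a0 + y1 * a1 + y2 * a2 = 0" "y0 * b0 + y1 * b1 + y2 * b2 = 0"
    and "c0 * (a1 * b2 - a2 * b1) + c1 * (a2 * b0 - a0 * b2) + c2 * (a0 * b1 - a1 * b0) = 0"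
  shows "(a0 * b1 - a1 * b0) * (y0 * c0 + y1 * c1 + y2 * c2) = 0"
    and "(a2 * b0 - a0 * b2) * (y0 * c0 + y1 * c1 + y2 * c2) = 0"
proof -
  have "(a0 * b1 - a1 * b0) * (y0 * c0 + y1 * c1 + y2 * c2) =
      y2 * (c0 * (a1 * b2 - a2 * b1) + c1 * (a2 * b0 - a0 * b2) + c2 * (a0 * b1 - a1 * b0)) +
      (c1 * a0 - c0 * a1) * (y0 * b0 + y1 * b1 + y2 * b2) + (c0 * b1 - c1 * b0) * (y0 * a0 + y1 * a1 + y2 * a2)"
    by (simp add: algebra_simps)
  then show "(a0 * b1 - a1 * b0) * (y0 * c0 + y1 * c1 + y2 * c2) = 0" unfolding assms by simp
  have "(a2 * b0 - a0 * b2) * (y0 * c0 + y1 * c1 + y2 * c2) =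
      y1 * (c0 * (a1 * b2 - a2 * b1) + c1 * (a2 * b0 - a0 * b2) + c2 * (a0 * b1 - a1 * b0)) +
      (c0 * a2 - c2 * a0) * (y0 * b0 + y1 * b1 + y2 * b2) + (c2 * b0 - c0 * b2) * (y0 * a0 + y1 * a1 + y2 * a2)"
    by (simp add: algebra_simps)
  then show "(a2 * b0 - a0 * b2) * (y0 * c0 + y1 * c1 + y2 * c2) = 0" unfolding assms by simp
qed

text \<open>For minimal points with first coordinates \<open>X i\<close> and an exponent
  \<open>\<mu>\<close> above \<open>1 / golden\<close>, the integer
  \<open>x0 * x2 - x1\<^sup>2\<close> bounds \<open>X (i + 2) powr \<mu>\<close> by a constant times
  \<open>X (i + 1)\<close>, and a nonzero determinant bounds \<open>X (i + 1) powr \<mu>\<close> by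
  a constant times \<open>X (i + 2) powr (1 - \<mu>)\<close>. Together they force
  \<open>\<mu>\<^sup>2 + \<mu> \<le> 1\<close>.\<close>

lemma lambda_admissible_le_inverse_golden:
  fixes \<xi> l :: real
  assumes deg: "deg_gt_2 \<xi>" and adm: "lambda_admissible \<xi> l"
  shows "l \<le> 1 / golden"
proof (rule ccontr)
  assume "\<not> l \<le> 1 / golden"
  moreover have "1 / golden < 1" using golden_facts(1) by simp
  ultimately have "1 / golden < min l 1" by linarith
  then obtain \<mu> where "1 / golden < \<mu>" "\<mu> < min l 1" using dense by blast
  then have \<mu>: "1 / golden < \<mu>" "\<mu> < l" "\<mu> < 1" by simp_all
  have "1 / 2 < 1 / golden" using golden_facts(1,2) by (simp add: field_simps)
  then have \<mu>half: "\<mu> > 1 / 2" using \<mu>(1) by linarith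
  have "(1 / golden)\<^sup>2 < \<mu>\<^sup>2" using \<mu>(1) golden_facts(1) by (intro power_strict_mono) auto
  moreover have "(1 / golden)\<^sup>2 = 1 - 1 / golden"
    unfolding golden_facts(4) using golden_facts(3) by (simp add: power2_eq_square algebra_simps)
  ultimately have \<mu>sq: "\<mu>\<^sup>2 > 1 - \<mu>" using \<mu>(1) by linarith
  have adm: "lambda_admissible \<xi> \<mu>" using lambda_admissible_mono adm \<mu>(2) by blast
  have \<mu>01: "0 < \<mu>" "\<mu> \<le> 1" using \<mu>half \<mu>(3) by simp_all
  obtain x0 x1 x2 :: "nat \<Rightarrow> int" and L :: "nat \<Rightarrow> real" where
    mono: "strict_mono x0" and x0pos: "\<And>i. x0 i > 0"
    and L: "\<And>i. L i = max \<bar>real_of_int (x0 i) * \<xi> - real_of_int (x1 i)\<bar> \<bar>real_of_int (x0 i) * \<xi>\<^sup>2 - real_of_int (x2 i)\<bar>"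
    and Ldec: "\<And>i. L (Suc i) < L i" and Lpos: "\<And>i. L i > 0"
    and Lbd: "\<And>i. L i \<le> 2 * real_of_int (x0 (Suc i)) powr - \<mu>"
    by (rule minimal_points[OF deg adm \<mu>01]) (rule that)
  define X where "X = (\<lambda>i. real_of_int (x0 i))"
  define d1 where "d1 = (\<lambda>i. real_of_int (x0 i) * \<xi> - real_of_int (x1 i))"
  define d2 where "d2 = (\<lambda>i. real_of_int (x0 i) * \<xi>\<^sup>2 - real_of_int (x2 i))"
  have d: "\<bar>d1 i\<bar> \<le> L i" "\<bar>d2 i\<bar> \<le> L i" for i unfolding L d1_def d2_def by auto
  have Lmax: "L i = max \<bar>d1 i\<bar> \<bar>d2 i\<bar>" for i unfolding L d1_def d2_def ..
  have x12: "real_of_int (x1 i) = X i * \<xi> - d1 i" "real_of_int (x2 i) = X i * \<xi>\<^sup>2 - d2 i" for i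
    unfolding X_def d1_def d2_def by simp_all
  have Xpos: "X i \<ge> 1" for i using x0pos[of i] unfolding X_def by linarith
  have Xabs: "\<bar>X i\<bar> = X i" for i using Xpos[of i] by simp
  have Xr: "real_of_int (x0 i) = X i" for i unfolding X_def ..
  have Xmono: "X i < X (Suc i)" for i unfolding X_def using mono by (simp add: strict_mono_def)
  have Lbd': "L i \<le> 2 * X (Suc i) powr - \<mu>" for i unfolding X_def by (rule Lbd)
  have Xi: "X i \<ge> real i" for i
  proof (induction i)
    case 0 show ?case using Xpos[of 0] by simp
  next
    case (Suc i)
    have "x0 i + 1 \<le> x0 (Suc i)" using mono by (simp add: strict_mono_def zless_add1_eq int_one_le_iff_zero_less add1_zle_eq)
    then have "X i + 1 \<le> X (Suc i)" unfolding X_def by linarith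
    then show ?case using Suc by simp
  qed
  have L2: "L i \<le> 2" for i
  proof -
    have "X (Suc i) powr - \<mu> \<le> X (Suc i) powr 0" using Xpos \<mu>half by (intro powr_mono) auto
    then show ?thesis using Lbd'[of i] Xpos[of "Suc i"] by simp
  qed
  \<comment> \<open>Bounds \<open>\<bar>x1 i\<bar> / X i\<close>; the 2 is the bound for the
    errors.\<close>
  define c where "c = \<bar>\<xi>\<bar> + 2"
  have c: "c \<ge> 2" unfolding c_def by simp
  have x1c: "\<bar>real_of_int (x1 i)\<bar> \<le> c * X i" for i
  proof -
    have "\<bar>real_of_int (x1 i)\<bar> \<le> \<bar>X i * \<xi>\<bar> + \<bar>d1 i\<bar>" unfolding x12 by (rule abs_triangle_ineq4)
    also have "\<dots> \<le> X i * \<bar>\<xi>\<bar> + 2 * X i" using d(1)[of i] L2[of i] Xpos[of i] by (simp add: abs_mult)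
    finally show ?thesis unfolding c_def by (simp add: algebra_simps)
  qed
  \<comment> \<open>Proportional points have errors in the ratio of their first coordinates, but
    along minimal points the error falls while the first coordinate grows.\<close>
  have nonpar: "x0 (Suc i) * x1 i \<noteq> x1 (Suc i) * x0 i \<or> x0 (Suc i) * x2 i \<noteq> x2 (Suc i) * x0 i" for i
  proof (rule ccontr)
    assume "\<not> ?thesis"
    then have e: "X (Suc i) * x1 i = x1 (Suc i) * X i" "X (Suc i) * x2 i = x2 (Suc i) * X i"
      unfolding X_def by (metis of_int_mult)+
    have "X (Suc i) * d1 i = X i * d1 (Suc i)" "X (Suc i) * d2 i = X i * d2 (Suc i)"
      using e unfolding x12 by (simp_all add: algebra_simps)
    then have "\<bar>X (Suc i) * d1 i\<bar> = \<bar>X i * d1 (Suc i)\<bar>" "\<bar>X (Suc i) * d2 i\<bar> = \<bar>X i * d2 (Suc i)\<bar>" by simp_all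
    then have "X (Suc i) * \<bar>d1 i\<bar> = X i * \<bar>d1 (Suc i)\<bar>" "X (Suc i) * \<bar>d2 i\<bar> = X i * \<bar>d2 (Suc i)\<bar>"
      unfolding abs_mult using Xabs by simp_all
    then have "X (Suc i) * L i = X i * L (Suc i)"
      unfolding Lmax using Xpos[of i] Xpos[of "Suc i"] by (simp add: max_mult_distrib_left)
    moreover have "X i * L (Suc i) < X (Suc i) * L i"
      using Xmono[of i] Ldec[of i] Xpos[of i] Xpos[of "Suc i"] Lpos[of "Suc i"] by (intro mult_strict_mono) auto
    ultimately show False by simp
  qed
  have lim1: "\<forall>\<^sub>F x in at_top. 4 * c * (x powr (1 / 2 - \<mu>)) < 1"
  proof -
    have "((\<lambda>x::real. 4 * c * (x powr (1 / 2 - \<mu>))) \<longlongrightarrow> 4 * c * 0) at_top"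
      using \<mu>half by (intro tendsto_intros tendsto_neg_powr filterlim_ident) auto
    then show ?thesis by (intro order_tendstoD(2)) auto
  qed
  obtain B1 where B1: "\<And>x. x \<ge> B1 \<Longrightarrow> 4 * c * (x powr (1 / 2 - \<mu>)) < 1"
    using lim1 unfolding eventually_at_top_linorder by blast
  \<comment> \<open>Otherwise the point is a multiple of
    \<open>(a\<^sup>2, a * b, b\<^sup>2)\<close> with \<open>a\<close> at most the square root of
    its first coordinate. The previous point is so close to this direction that the integers
    \<open>a * x1 i - b * x0 i\<close> and \<open>a * x2 i - b * x1 i\<close> have modulus below 1,
    which makes it proportional as well.\<close>
  have det2: "x0 (Suc i) * x2 (Suc i) \<noteq> (x1 (Suc i))\<^sup>2" if i: "X (Suc i) \<ge> B1" for i
  proof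
    assume sq: "x0 (Suc i) * x2 (Suc i) = (x1 (Suc i))\<^sup>2"
    define g where "g = gcd (x0 (Suc i)) (x1 (Suc i))"
    have g: "g > 0" unfolding g_def using x0pos[of "Suc i"] by simp
    obtain a b where ab: "x0 (Suc i) = a * g" "x1 (Suc i) = b * g" "coprime a b"
      using gcd_coprime_exists[of "x0 (Suc i)" "x1 (Suc i)"] g unfolding g_def by auto
    have a: "a > 0" using x0pos[of "Suc i"] g unfolding ab(1) by (simp add: zero_less_mult_iff)
    have "g * (a * x2 (Suc i)) = g * (g * b\<^sup>2)" using sq unfolding ab power2_eq_square by (simp add: algebra_simps)
    then have ax2: "a * x2 (Suc i) = g * b\<^sup>2" using g by simp
    then have "a dvd g * b\<^sup>2" by (metis dvd_triv_left)
    then have "a dvd g" using ab(3) by (simp add: coprime_dvd_mult_left_iff coprime_power_right_iff)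
    then have "a \<le> g" using g by (rule zdvd_imp_le)
    then have "a * a \<le> a * g" using a by simp
    then have "real_of_int (a * a) \<le> X (Suc i)" unfolding X_def ab(1) of_int_le_iff .
    then have a_le: "real_of_int a \<le> sqrt (X (Suc i))"
      using a by (intro real_le_rsqrt) (simp add: power2_eq_square)
    have aL: "4 * c * (a * X (Suc i) powr - \<mu>) < 1"
    proof -
      have "a * X (Suc i) powr - \<mu> \<le> sqrt (X (Suc i)) * X (Suc i) powr - \<mu>"
        using a_le by (intro mult_right_mono) auto
      also have "\<dots> = X (Suc i) powr (1 / 2 - \<mu>)"
        using Xpos[of "Suc i"] by (simp add: powr_half_sqrt[symmetric] flip: powr_add)
      finally have "4 * c * (a * X (Suc i) powr - \<mu>) \<le> 4 * c * X (Suc i) powr (1 / 2 - \<mu>)"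
        using c by (intro mult_left_mono) auto
      then show ?thesis using B1[OF i] by linarith
    qed
    have aLi: "2 * c * (a * L i) < 1"
    proof -
      have "2 * c * (a * L i) \<le> 2 * c * (a * (2 * X (Suc i) powr - \<mu>))"
        using Lbd'[of i] a c by (intro mult_left_mono) auto
      then show ?thesis using aL by simp
    qed
    have gap: "X i * \<bar>a * \<xi> - b\<bar> \<le> a * L i"
    proof -
      have "g * (a * \<xi> - b) = d1 (Suc i)" unfolding d1_def ab by (simp add: algebra_simps)
      then have "\<bar>g * (a * \<xi> - b)\<bar> = \<bar>d1 (Suc i)\<bar>" by simp
      then have "g * (X i * \<bar>a * \<xi> - b\<bar>) = X i * \<bar>d1 (Suc i)\<bar>"
        using g by (simp add: abs_mult mult.left_commute)
      also have "\<dots> \<le> X (Suc i) * L i"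
        using Xmono[of i] Xpos[of i] Ldec[of i] d(1)[of "Suc i"] by (intro mult_mono) auto
      also have "\<dots> = g * (a * L i)" unfolding X_def ab by simp
      finally show ?thesis using g by simp
    qed
    have "\<bar>real_of_int (a * x1 i - b * x0 i)\<bar> = \<bar>X i * (a * \<xi> - b) - a * d1 i\<bar>"
      by (simp add: x12 algebra_simps Xr)
    also have "\<dots> \<le> X i * \<bar>a * \<xi> - b\<bar> + a * \<bar>d1 i\<bar>"
      using abs_triangle_ineq4[of "X i * (a * \<xi> - b)" "a * d1 i"] Xpos[of i] a by (simp add: abs_mult)
    also have "\<dots> \<le> a * L i + a * L i" using gap d(1)[of i] a by (intro add_mono mult_left_mono) auto
    also have "\<dots> \<le> 2 * c * (a * L i)" using c a Lpos[of i] by simp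
    also have "\<dots> < 1" by (rule aLi)
    finally have e1: "a * x1 i = b * x0 i" by linarith
    have "\<bar>real_of_int (a * x2 i - b * x1 i)\<bar> = \<bar>x1 i * (a * \<xi> - b) + a * (\<xi> * d1 i - d2 i)\<bar>"
      by (simp add: x12 algebra_simps power2_eq_square)
    also have "\<dots> \<le> \<bar>real_of_int (x1 i)\<bar> * \<bar>a * \<xi> - b\<bar> + a * (\<bar>\<xi>\<bar> * \<bar>d1 i\<bar> + \<bar>d2 i\<bar>)"
    proof -
      have "\<bar>x1 i * (a * \<xi> - b) + a * (\<xi> * d1 i - d2 i)\<bar> \<le> \<bar>real_of_int (x1 i)\<bar> * \<bar>a * \<xi> - b\<bar> + a * \<bar>\<xi> * d1 i - d2 i\<bar>"
        using abs_triangle_ineq[of "x1 i * (a * \<xi> - b)" "a * (\<xi> * d1 i - d2 i)"] a by (simp add: abs_mult)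
      moreover have "a * \<bar>\<xi> * d1 i - d2 i\<bar> \<le> a * (\<bar>\<xi>\<bar> * \<bar>d1 i\<bar> + \<bar>d2 i\<bar>)"
        using a abs_triangle_ineq4[of "\<xi> * d1 i" "d2 i"] by (intro mult_left_mono) (auto simp: abs_mult)
      ultimately show ?thesis by linarith
    qed
    also have "\<dots> \<le> c * X i * \<bar>a * \<xi> - b\<bar> + a * (\<bar>\<xi>\<bar> * L i + L i)"
      using x1c[of i] d[of i] a by (intro add_mono mult_right_mono mult_left_mono) auto
    also have "\<dots> \<le> c * (a * L i) + c * (a * L i)"
    proof (intro add_mono)
      show "c * X i * \<bar>a * \<xi> - b\<bar> \<le> c * (a * L i)" using gap c by (simp add: mult.assoc)
      have "(\<bar>\<xi>\<bar> + 1) * (a * L i) \<le> c * (a * L i)"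
        unfolding c_def using a Lpos[of i] by (intro mult_right_mono) auto
      then show "a * (\<bar>\<xi>\<bar> * L i + L i) \<le> c * (a * L i)" by (simp add: algebra_simps)
    qed
    also have "\<dots> = 2 * c * (a * L i)" by simp
    also have "\<dots> < 1" by (rule aLi)
    finally have e2: "a * x2 i = b * x1 i" by linarith
    have "x0 (Suc i) * x1 i = g * (a * x1 i)" unfolding ab(1) by simp
    also have "\<dots> = x1 (Suc i) * x0 i" unfolding e1 ab(2) by simp
    finally have "x0 (Suc i) * x1 i = x1 (Suc i) * x0 i" .
    moreover have "a * (x0 (Suc i) * x2 i) = a * (x2 (Suc i) * x0 i)"
    proof -
      have "a * (x0 (Suc i) * x2 i) = g * a * (a * x2 i)" unfolding ab(1) by simp
      also have "\<dots> = g * b * (a * x1 i)" unfolding e2 by simp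
      also have "\<dots> = (g * b\<^sup>2) * x0 i" unfolding e1 by (simp add: power2_eq_square)
      finally show ?thesis unfolding ax2[symmetric] by simp
    qed
    then have "x0 (Suc i) * x2 i = x2 (Suc i) * x0 i" using a by simp
    ultimately show False using nonpar[of i] by blast
  qed
  \<comment> \<open>Writing \<open>x1\<close> and \<open>x2\<close> through their errors cancels the
    main terms of the nonzero integer and leaves size times error.\<close>
  have ineqD: "X (Suc (Suc i)) powr \<mu> \<le> 6 * c * X (Suc i)" if i: "X (Suc i) \<ge> B1" for i
  proof -
    let ?j = "Suc i"
    have "real_of_int \<bar>x0 ?j * x2 ?j - (x1 ?j)\<^sup>2\<bar> \<ge> 1" using det2[OF i] by linarith
    also have "real_of_int \<bar>x0 ?j * x2 ?j - (x1 ?j)\<^sup>2\<bar> = \<bar>d1 ?j * (X ?j * \<xi> + x1 ?j) - X ?j * d2 ?j\<bar>"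
      by (simp add: x12 Xr algebra_simps power2_eq_square)
    also have "\<dots> \<le> \<bar>d1 ?j\<bar> * \<bar>X ?j * \<xi> + x1 ?j\<bar> + X ?j * \<bar>d2 ?j\<bar>"
      using abs_triangle_ineq4[of "d1 ?j * (X ?j * \<xi> + x1 ?j)" "X ?j * d2 ?j"] Xpos[of ?j] by (simp add: abs_mult)
    also have "\<dots> \<le> L ?j * (c * X ?j + c * X ?j) + c * X ?j * L ?j"
    proof (intro add_mono mult_mono)
      have "\<bar>X ?j * \<xi> + x1 ?j\<bar> \<le> X ?j * \<bar>\<xi>\<bar> + \<bar>real_of_int (x1 ?j)\<bar>"
        using abs_triangle_ineq[of "X ?j * \<xi>" "x1 ?j"] Xpos[of ?j] by (simp add: abs_mult)
      moreover have "X ?j * \<bar>\<xi>\<bar> \<le> c * X ?j" using Xpos[of ?j] unfolding c_def by (simp add: algebra_simps)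
      ultimately show "\<bar>X ?j * \<xi> + x1 ?j\<bar> \<le> c * X ?j + c * X ?j" using x1c[of ?j] by linarith
    qed (use d[of ?j] c Xpos[of ?j] Lpos[of ?j] in auto)
    also have "\<dots> = 3 * c * X ?j * L ?j" by (simp add: algebra_simps)
    also have "\<dots> \<le> 3 * c * X ?j * (2 * X (Suc ?j) powr - \<mu>)"
      using Lbd'[of ?j] c Xpos[of ?j] by (intro mult_left_mono) auto
    finally have "1 \<le> 6 * c * X ?j * X (Suc ?j) powr - \<mu>" by simp
    then show ?thesis using Xpos[of "Suc ?j"] by (simp add: powr_minus field_simps)
  qed
  define D where "D = (\<lambda>i. x0 (i + 2) * (x1 i * x2 (i + 1) - x2 i * x1 (i + 1))
      + x1 (i + 2) * (x2 i * x0 (i + 1) - x0 i * x2 (i + 1)) + x2 (i + 2) * (x0 i * x1 (i + 1) - x1 i * x0 (i + 1)))"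
  have ineqE: "X (i + 1) powr \<mu> \<le> 24 * X (i + 2) powr (1 - \<mu>)" if i: "D i \<noteq> 0" for i
  proof -
    have LL: "L (i + 2) < L (i + 1)" "L (i + 1) < L i" "X i < X (i + 1)" "X (i + 1) < X (i + 2)"
      using Ldec[of i] Ldec[of "Suc i"] Xmono[of i] Xmono[of "Suc i"] by simp_all
    have "1 \<le> \<bar>real_of_int (D i)\<bar>" using i by linarith
    \<comment> \<open>\<open>D i\<close> is the determinant of three consecutive points. Column
      operations turn its second and third columns into errors, so each term holds one first
      coordinate and two errors.\<close>
    also have "real_of_int (D i) = X (i + 2) * (d1 i * d2 (i + 1) - d2 i * d1 (i + 1))
        + (X (i + 1) * (d1 (i + 2) * d2 i - d2 (i + 2) * d1 i) + X i * (d1 (i + 1) * d2 (i + 2) - d2 (i + 1) * d1 (i + 2)))"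
      unfolding D_def by (simp add: x12 Xr algebra_simps power2_eq_square)
    also have "\<bar>\<dots>\<bar> \<le> 6 * (X (i + 2) * L i * L (i + 1))"
    proof -
      have minor: "\<bar>Z * (d1 j * d2 k - d2 j * d1 k)\<bar> \<le> 2 * (X (i + 2) * L i * L (i + 1))"
        if "0 \<le> Z" "Z \<le> X (i + 2)" "L j * L k \<le> L i * L (i + 1)" for Z j k
      proof -
        have "\<bar>d1 j * d2 k - d2 j * d1 k\<bar> \<le> \<bar>d1 j\<bar> * \<bar>d2 k\<bar> + \<bar>d2 j\<bar> * \<bar>d1 k\<bar>"
          using abs_triangle_ineq4[of "d1 j * d2 k" "d2 j * d1 k"] by (simp add: abs_mult)
        also have "\<dots> \<le> L j * L k + L j * L k"
          using d Lpos by (intro add_mono mult_mono) (auto intro: less_imp_le)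
        also have "\<dots> \<le> 2 * (L i * L (i + 1))" using that by simp
        finally have "\<bar>Z * (d1 j * d2 k - d2 j * d1 k)\<bar> \<le> X (i + 2) * (2 * (L i * L (i + 1)))"
          unfolding abs_mult using that by (intro mult_mono) auto
        then show ?thesis by (simp add: mult_ac)
      qed
      have "L (i + 2) * L i \<le> L i * L (i + 1)" "L (i + 1) * L (i + 2) \<le> L i * L (i + 1)"
        using LL Lpos[of i] Lpos[of "i + 1"] Lpos[of "i + 2"] by (simp_all add: mult.commute)
      then have t: "\<bar>X (i + 2) * (d1 i * d2 (i + 1) - d2 i * d1 (i + 1))\<bar> \<le> 2 * (X (i + 2) * L i * L (i + 1))"
        "\<bar>X (i + 1) * (d1 (i + 2) * d2 i - d2 (i + 2) * d1 i)\<bar> \<le> 2 * (X (i + 2) * L i * L (i + 1))"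
        "\<bar>X i * (d1 (i + 1) * d2 (i + 2) - d2 (i + 1) * d1 (i + 2))\<bar> \<le> 2 * (X (i + 2) * L i * L (i + 1))"
        using LL Xpos[of i] by (intro minor; simp)+
      then show ?thesis by linarith
    qed
    also have "\<dots> \<le> 6 * (X (i + 2) * (2 * X (i + 1) powr - \<mu>) * (2 * X (i + 2) powr - \<mu>))"
      using Lbd'[of i] Lbd'[of "Suc i"] Lpos[of "Suc i"] Xpos[of "i + 2"] by (intro mult_left_mono mult_mono) (auto intro: less_imp_le)
    also have "\<dots> = 24 * (X (i + 2) powr 1 * X (i + 2) powr - \<mu>) * X (i + 1) powr - \<mu>"
      using Xpos[of "i + 2"] by simp
    also have "\<dots> = 24 * X (i + 2) powr (1 - \<mu>) * X (i + 1) powr - \<mu>"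
      unfolding powr_add[symmetric] by simp
    finally show ?thesis using Xpos[of "i + 1"] by (simp add: powr_minus field_simps)
  qed
  \<comment> \<open>Otherwise all points from index \<open>N\<close> on lie in one rational plane.
    \<open>X i\<close> times the value at \<open>\<xi>\<close> of the form of this plane stays
    bounded while \<open>X i\<close> grows, so that value is 0.\<close>
  have inf: "\<exists>i\<ge>N. D i \<noteq> 0" for N
  proof (rule ccontr)
    assume "\<not> ?thesis"
    then have D0: "D i = 0" if "i \<ge> N" for i using that by auto
    define y0 where "y0 = x1 N * x2 (N + 1) - x2 N * x1 (N + 1)"
    define y1 where "y1 = x2 N * x0 (N + 1) - x0 N * x2 (N + 1)"
    define y2 where "y2 = x0 N * x1 (N + 1) - x1 N * x0 (N + 1)"
    have ynz: "(y0, y1, y2) \<noteq> (0, 0, 0)" using nonpar[of N] unfolding y1_def y2_def by (auto simp: mult.commute)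
    let ?f = "\<lambda>i. y0 * x0 i + y1 * x1 i + y2 * x2 i"
    have "?f i = 0 \<and> ?f (Suc i) = 0" if "i \<ge> N" for i
      using that
    proof (induction i rule: dec_induct)
      case base
      show ?case unfolding y0_def y1_def y2_def by (simp add: algebra_simps)
    next
      case (step i)
      have "x0 i * x1 (Suc i) - x1 i * x0 (Suc i) \<noteq> 0 \<or> x2 i * x0 (Suc i) - x0 i * x2 (Suc i) \<noteq> 0"
        using nonpar[of i] by (auto simp: mult.commute)
      moreover have "(x0 i * x1 (Suc i) - x1 i * x0 (Suc i)) * ?f (Suc (Suc i)) = 0"
        "(x2 i * x0 (Suc i) - x0 i * x2 (Suc i)) * ?f (Suc (Suc i)) = 0"
        using cross_product_step[OF conjunct1[OF step.IH] conjunct2[OF step.IH], of "x0 (Suc (Suc i))" "x1 (Suc (Suc i))" "x2 (Suc (Suc i))"]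
          D0[OF step.hyps(1)] unfolding D_def by simp_all
      ultimately show ?case using step.IH by auto
    qed
    then have f0: "?f i = 0" if "i \<ge> N" for i using that by blast
    define v where "v = real_of_int y0 + y1 * \<xi> + y2 * \<xi>\<^sup>2"
    define M where "M = 2 * (\<bar>real_of_int y1\<bar> + \<bar>real_of_int y2\<bar>)"
    have "X i * \<bar>v\<bar> \<le> M" if "i \<ge> N" for i
    proof -
      have "real_of_int (?f i) = 0" using f0[OF that] by simp
      then have "X i * v = y1 * d1 i + y2 * d2 i"
        unfolding v_def by (simp add: x12 Xr algebra_simps)
      then have "\<bar>X i * v\<bar> = \<bar>y1 * d1 i + y2 * d2 i\<bar>" by simp
      then have "X i * \<bar>v\<bar> = \<bar>y1 * d1 i + y2 * d2 i\<bar>" unfolding abs_mult Xabs .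
      also have "\<dots> \<le> \<bar>real_of_int y1\<bar> * \<bar>d1 i\<bar> + \<bar>real_of_int y2\<bar> * \<bar>d2 i\<bar>"
        using abs_triangle_ineq[of "y1 * d1 i" "y2 * d2 i"] by (simp add: abs_mult)
      also have "\<dots> \<le> \<bar>real_of_int y1\<bar> * 2 + \<bar>real_of_int y2\<bar> * 2"
        using d[of i] L2[of i] by (intro add_mono mult_left_mono) auto
      finally show ?thesis unfolding M_def by simp
    qed
    then have vb: "real i * \<bar>v\<bar> \<le> M" if "i \<ge> N" for i
      using that Xi[of i] by (meson abs_ge_zero mult_right_mono order_trans)
    have "v \<noteq> 0" using deg ynz unfolding deg_gt_2_int v_def by blast
    then obtain n where n: "real n > M / \<bar>v\<bar>" using reals_Archimedean2 by blast
    have "M / \<bar>v\<bar> < real (max n N)" using n by simp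
    then have "M < real (max n N) * \<bar>v\<bar>" using \<open>v \<noteq> 0\<close> by (simp add: field_simps)
    then show False using vb[of "max n N"] by simp
  qed
  define K where "K = 24 * (6 * c) powr ((1 - \<mu>) / \<mu>)"
  \<comment> \<open>Equivalent to \<open>\<mu>\<^sup>2 > 1 - \<mu>\<close>. The two estimates bound
    \<open>Z powr \<mu>\<close> by \<open>K * Z powr ((1 - \<mu>) / \<mu>)\<close>, which then fails
    for large \<open>Z\<close>.\<close>
  have expo: "(1 - \<mu>) / \<mu> - \<mu> < 0" using \<mu>sq \<mu>half by (simp add: field_simps power2_eq_square)
  have lim2: "\<forall>\<^sub>F x in at_top. K * (x powr ((1 - \<mu>) / \<mu> - \<mu>)) < 1"
  proof -
    have "((\<lambda>x::real. K * (x powr ((1 - \<mu>) / \<mu> - \<mu>))) \<longlongrightarrow> K * 0) at_top"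
      using expo by (intro tendsto_intros tendsto_neg_powr filterlim_ident) auto
    then show ?thesis by (intro order_tendstoD(2)) auto
  qed
  obtain B2 where B2: "\<And>x. x \<ge> B2 \<Longrightarrow> K * (x powr ((1 - \<mu>) / \<mu> - \<mu>)) < 1"
    using lim2 unfolding eventually_at_top_linorder by blast
  obtain i where i: "i \<ge> nat \<lceil>max B1 B2\<rceil>" "D i \<noteq> 0" using inf by blast
  have "real (Suc i) \<ge> max B1 B2" using i(1) by linarith
  then have big: "X (Suc i) \<ge> B1" "X (Suc i) \<ge> B2" using Xi[of "Suc i"] by auto
  define Z where "Z = X (Suc i)"
  have Z: "Z \<ge> 1" unfolding Z_def by (rule Xpos)
  have "X (Suc (Suc i)) = (X (Suc (Suc i)) powr \<mu>) powr (1 / \<mu>)"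
    using Xpos[of "Suc (Suc i)"] \<mu>half by (simp add: powr_powr)
  also have "\<dots> \<le> (6 * c * Z) powr (1 / \<mu>)"
    using ineqD[OF big(1)] \<mu>half unfolding Z_def by (intro powr_mono2) auto
  finally have "X (Suc (Suc i)) powr (1 - \<mu>) \<le> ((6 * c * Z) powr (1 / \<mu>)) powr (1 - \<mu>)"
    using \<mu>(3) Xpos[of "Suc (Suc i)"] by (intro powr_mono2) auto
  also have "\<dots> = (6 * c) powr ((1 - \<mu>) / \<mu>) * Z powr ((1 - \<mu>) / \<mu>)"
    using c Z by (simp add: powr_powr powr_mult)
  finally have "24 * X (Suc (Suc i)) powr (1 - \<mu>) \<le> K * Z powr ((1 - \<mu>) / \<mu>)" unfolding K_def by simp
  with ineqE[OF i(2)] have "Z powr \<mu> \<le> K * Z powr ((1 - \<mu>) / \<mu>)" unfolding Z_def by simp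
  then have "Z powr \<mu> * Z powr - \<mu> \<le> K * Z powr ((1 - \<mu>) / \<mu>) * Z powr - \<mu>" by (intro mult_right_mono) auto
  also have "K * Z powr ((1 - \<mu>) / \<mu>) * Z powr - \<mu> = K * Z powr ((1 - \<mu>) / \<mu> - \<mu>)"
    by (simp flip: powr_add)
  also have "\<dots> < 1" using B2[OF big(2)] unfolding Z_def .
  finally show False using Z by (simp flip: powr_add)
qed

section \<open>Fibonacci words in symmetric matrices\<close>

text \<open>With this bound \<open>2 + 6 * (golden - 1) \<le> 6\<close>, which closes the induction
  for word lengths.\<close>

lemma golden_less: "golden < 5 / 3"
proof -
  have "sqrt 5 < 7 / 3" by (rule real_less_lsqrt) (auto simp: power2_eq_square)
  then show ?thesis unfolding golden_def by simp
qed

lemma mat2_mult_nth: "(A ** B) $ i $ j = A $ i $ 1 * B $ 1 $ j + A $ i $ 2 * B $ 2 $ j"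
  for A B :: "int^2^2"
  by (simp add: matrix_matrix_mult_def sum_2)

definition symmetric_mat :: "int^2^2 \<Rightarrow> bool" where
  "symmetric_mat N \<longleftrightarrow> transpose N = N"

lemma symmetric_mat_iff: "symmetric_mat N \<longleftrightarrow> N $ 2 $ 1 = N $ 1 $ 2"
  unfolding symmetric_mat_def vec_eq_iff forall_2 transpose_def by auto

text \<open>This condition survives products. It makes the top left entry a norm that is
  multiplicative up to a factor 2, and it keeps the slopes between 0 and 1.\<close>

definition dominated :: "int^2^2 \<Rightarrow> bool" where
  "dominated N \<longleftrightarrow> 0 < N $ 2 $ 2 \<and> N $ 2 $ 2 \<le> N $ 1 $ 2 \<and> N $ 1 $ 2 \<le> N $ 1 $ 1 \<and>
     N $ 2 $ 2 \<le> N $ 2 $ 1 \<and> N $ 2 $ 1 \<le> N $ 1 $ 1"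

lemma dominated_mult:
  assumes "dominated A" "dominated B"
  shows "dominated (A ** B)"
  using assms unfolding dominated_def mat2_mult_nth
  by (intro conjI add_mono mult_mono add_pos_pos mult_pos_pos) auto

text \<open>Records what is needed of a product of \<open>m\<close> letters. The 2 in the upper
  bound pays for the factor lost in each product, so that the growth bounds multiply
  exactly.\<close>

definition word :: "int \<Rightarrow> int \<Rightarrow> nat \<Rightarrow> int^2^2 \<Rightarrow> bool" where
  "word a t m N \<longleftrightarrow> dominated N \<and> det N = a ^ m \<and>
     a dvd N $ 1 $ 1 - 1 \<and> a dvd N $ 1 $ 2 \<and> a dvd N $ 2 $ 1 \<and> a dvd N $ 2 $ 2 \<and>
     (a * t\<^sup>2) ^ m \<le> N $ 1 $ 1 \<and> 2 * N $ 1 $ 1 \<le> (10 * a * t\<^sup>2) ^ m"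

lemma mult_top_left:
  assumes "dominated A" "dominated B"
  shows "A $ 1 $ 1 * B $ 1 $ 1 \<le> (A ** B) $ 1 $ 1" "(A ** B) $ 1 $ 1 \<le> 2 * (A $ 1 $ 1 * B $ 1 $ 1)"
proof -
  have "0 \<le> A $ 1 $ 2 * B $ 2 $ 1" "A $ 1 $ 2 * B $ 2 $ 1 \<le> A $ 1 $ 1 * B $ 1 $ 1"
    using assms unfolding dominated_def by (auto intro!: mult_mono)
  then show "A $ 1 $ 1 * B $ 1 $ 1 \<le> (A ** B) $ 1 $ 1" "(A ** B) $ 1 $ 1 \<le> 2 * (A $ 1 $ 1 * B $ 1 $ 1)"
    unfolding mat2_mult_nth by auto
qed

lemma word_mult:
  assumes A: "word a t m A" and B: "word a t n B" and a: "a \<ge> 0"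
  shows "word a t (m + n) (A ** B)"
proof -
  have dom: "dominated A" "dominated B" using A B unfolding word_def by auto
  have pos: "0 < A $ 1 $ 1" "0 < B $ 1 $ 1" using dom unfolding dominated_def by auto
  have "(A ** B) $ 1 $ 1 - 1 = (A $ 1 $ 1 - 1) * B $ 1 $ 1 + (B $ 1 $ 1 - 1) + A $ 1 $ 2 * B $ 2 $ 1"
    by (simp add: mat2_mult_nth algebra_simps)
  moreover have "a dvd (A $ 1 $ 1 - 1) * B $ 1 $ 1 + (B $ 1 $ 1 - 1) + A $ 1 $ 2 * B $ 2 $ 1"
    using A B unfolding word_def by (intro dvd_add dvd_mult2) auto
  ultimately have 1: "a dvd (A ** B) $ 1 $ 1 - 1" by (simp only:)
  have 2: "a dvd (A ** B) $ 1 $ 2" "a dvd (A ** B) $ 2 $ 1" "a dvd (A ** B) $ 2 $ 2"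
    using A B unfolding word_def mat2_mult_nth by auto
  have "(a * t\<^sup>2) ^ (m + n) \<le> A $ 1 $ 1 * B $ 1 $ 1"
    unfolding power_add using A B a pos unfolding word_def by (intro mult_mono) auto
  then have 3: "(a * t\<^sup>2) ^ (m + n) \<le> (A ** B) $ 1 $ 1" using mult_top_left[OF dom] by linarith
  have "(2 * A $ 1 $ 1) * (2 * B $ 1 $ 1) \<le> (10 * a * t\<^sup>2) ^ (m + n)"
    unfolding power_add using A B a pos unfolding word_def by (intro mult_mono) auto
  then have 4: "2 * (A ** B) $ 1 $ 1 \<le> (10 * a * t\<^sup>2) ^ (m + n)" using mult_top_left[OF dom] by linarith
  show ?thesis using dominated_mult[OF dom] 1 2 3 4 A B unfolding word_def
    by (simp add: det_mul power_add)
qed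

text \<open>\<open>a\<close> times the rank one matrix of \<open>(t, 1)\<close> with itself, plus
  the matrix unit: hence determinant \<open>a\<close> and the required residue modulo
  \<open>a\<close>.\<close>

definition letter :: "int \<Rightarrow> int \<Rightarrow> int^2^2" where
  "letter a t = vector [vector [a * t\<^sup>2 + 1, a * t], vector [a * t, a]]"

lemma letter_nth [simp]:
  "letter a t $ 1 $ 1 = a * t\<^sup>2 + 1" "letter a t $ 1 $ 2 = a * t"
  "letter a t $ 2 $ 1 = a * t" "letter a t $ 2 $ 2 = a"
  unfolding letter_def by simp_all

text \<open>Both letters get growth bounds in the common base \<open>a * t\<^sup>2\<close>. Since
  \<open>t + 1 \<le> 2 * t\<close>, the 10 covers
  \<open>2 * (4 * a * t\<^sup>2 + 1)\<close>.\<close>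

lemma word_letter:
  assumes a: "a \<ge> 1" and t: "t \<ge> 1" and s: "t \<le> s" "s \<le> t + 1"
  shows "word a t 1 (letter a s)"
proof -
  have s1: "s \<ge> 1" using t s by simp
  have "t\<^sup>2 \<le> s\<^sup>2" using t s by (intro power_mono) auto
  have "s\<^sup>2 \<le> (2 * t)\<^sup>2" using t s by (intro power_mono) auto
  then have s2: "s\<^sup>2 \<le> 4 * t\<^sup>2" by (simp add: power_mult_distrib)
  have "1 \<le> t\<^sup>2" using t by (simp add: one_le_power)
  then have "1 * 1 \<le> a * t\<^sup>2" using a by (intro mult_mono) auto
  moreover have "a * s\<^sup>2 \<le> a * (4 * t\<^sup>2)" using s2 a by (intro mult_left_mono) auto
  ultimately have 1: "2 * (a * s\<^sup>2 + 1) \<le> 10 * a * t\<^sup>2" by (simp add: algebra_simps)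
  have 2: "a * t\<^sup>2 \<le> a * s\<^sup>2" using \<open>t\<^sup>2 \<le> s\<^sup>2\<close> a by (intro mult_left_mono) auto
  have "s \<le> s\<^sup>2" using s1 by (simp add: power2_eq_square)
  then have 3: "a * s \<le> a * s\<^sup>2" using a by (intro mult_left_mono) auto
  have 4: "a * 1 \<le> a * s" using s1 a by (intro mult_left_mono) auto
  have 5: "det (letter a s) = a" by (simp add: det_2 algebra_simps power2_eq_square)
  show ?thesis unfolding word_def dominated_def letter_nth power_one_right
    by (intro conjI) (use 1 2 3 4 5 a in \<open>linarith | simp\<close>)+
qed

text \<open>For symmetric \<open>N\<close> this is the linear form \<open>tr (W J N)\<close> with \<open>J\<close> the rotation by a right angle;
  evaluated at the matrix with rows \<open>(1, \<xi>)\<close> and \<open>(\<xi>, \<xi>\<^sup>2)\<close> it vanishes when \<open>\<xi>\<close> is fixed by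
  the Moebius map of \<open>W\<close>.\<close>

definition fixed_form :: "int^2^2 \<Rightarrow> int^2^2 \<Rightarrow> int" where
  "fixed_form W N = - W $ 1 $ 2 * N $ 1 $ 1 + (W $ 1 $ 1 - W $ 2 $ 2) * N $ 1 $ 2 + W $ 2 $ 1 * N $ 2 $ 2"

text \<open>As \<open>W J W\<^sup>T\<close> is \<open>det W\<close> times \<open>J\<close>, the
  trace of \<open>W J W\<^sup>T T\<close> is \<open>det W\<close> times that of \<open>J T\<close>,
  which is the antisymmetric part of \<open>T\<close>.\<close>

lemma fixed_form_transpose_mult:
  assumes "symmetric_mat (transpose W ** T)"
  shows "fixed_form W (transpose W ** T) = det W * (T $ 2 $ 1 - T $ 1 $ 2)"
proof -
  have e: "(transpose W ** T) $ 2 $ 1 = (transpose W ** T) $ 1 $ 2" using assms unfolding symmetric_mat_iff .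
  have "fixed_form W (transpose W ** T) = - W $ 1 $ 2 * (transpose W ** T) $ 1 $ 1 + W $ 1 $ 1 * (transpose W ** T) $ 2 $ 1
      - W $ 2 $ 2 * (transpose W ** T) $ 1 $ 2 + W $ 2 $ 1 * (transpose W ** T) $ 2 $ 2"
    unfolding fixed_form_def e by (simp add: algebra_simps)
  then show ?thesis by (simp add: mat2_mult_nth det_2 algebra_simps transpose_def)
qed

text \<open>Antisymmetric 2 by 2 matrices are multiples of the rotation \<open>J\<close>, and
  \<open>S J S\<close> is \<open>det S\<close> times \<open>J\<close>.\<close>

lemma antisymmetric_part_congruence:
  assumes "symmetric_mat S"
  shows "(S ** M ** S) $ 2 $ 1 - (S ** M ** S) $ 1 $ 2 = det S * (M $ 2 $ 1 - M $ 1 $ 2)"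
  using assms unfolding symmetric_mat_iff by (simp add: mat2_mult_nth det_2 algebra_simps)

text \<open>The cross product of \<open>y\<close> and \<open>z\<close> is proportional to the
  entries \<open>(p, q, r)\<close> of \<open>S\<close>. Since
  \<open>p * r - q\<^sup>2 = a ^ m\<close> and \<open>p\<close> is prime to \<open>a\<close>, its
  first coordinate is a multiple of \<open>p\<close>; being smaller than \<open>p\<close>, it is 0,
  and the others follow.\<close>

lemma orthogonal_symmetric_cross_product:
  fixes y0 y1 y2 z0 z1 z2 :: int
  assumes S: "symmetric_mat S" and det: "det S = a ^ m" and S1: "a dvd S $ 1 $ 1 - 1" "S $ 1 $ 1 > 0"
    and y: "y0 * S $ 1 $ 1 + y1 * S $ 1 $ 2 + y2 * S $ 2 $ 2 = 0"
    and z: "z0 * S $ 1 $ 1 + z1 * S $ 1 $ 2 + z2 * S $ 2 $ 2 = 0"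
    and small: "\<bar>y1 * z2 - y2 * z1\<bar> < S $ 1 $ 1"
  shows "y1 * z2 = y2 * z1" "y2 * z0 = y0 * z2" "y0 * z1 = y1 * z0"
proof -
  define p q r where "p = S $ 1 $ 1" and "q = S $ 1 $ 2" and "r = S $ 2 $ 2"
  define v0 v1 v2 where "v0 = y1 * z2 - y2 * z1" and "v1 = y2 * z0 - y0 * z2" and "v2 = y0 * z1 - y1 * z0"
  have 0: "y0 * p + y1 * q + y2 * r = 0" "z0 * p + z1 * q + z2 * r = 0" using y z unfolding p_def q_def r_def by auto
  have "v0 * q - v1 * p = y0 * p * z2 + y1 * q * z2 - z0 * p * y2 - z1 * q * y2"
    unfolding v0_def v1_def by (simp add: algebra_simps)
  also have "\<dots> = z2 * (y0 * p + y1 * q + y2 * r) - y2 * (z0 * p + z1 * q + z2 * r)" by (simp add: algebra_simps)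
  finally have v1: "v1 * p = v0 * q" unfolding 0 by simp
  have "v0 * r - v2 * p = y1 * (z0 * p + z1 * q + z2 * r) - z1 * (y0 * p + y1 * q + y2 * r)"
    unfolding v0_def v2_def by (simp add: algebra_simps)
  then have v2: "v2 * p = v0 * r" unfolding 0 by simp
  have "p * r - q * q = a ^ m" using det S unfolding det_2 symmetric_mat_iff p_def q_def r_def by simp
  then have "v0 * a ^ m = v0 * r * p - v0 * q * q" by (simp add: algebra_simps flip: \<open>p * r - q * q = a ^ m\<close>)
  also have "\<dots> = p * (v0 * r - v1 * q)" unfolding v1[symmetric] by (simp add: algebra_simps)
  finally have "p dvd v0 * a ^ m" by simp
  moreover have "coprime p (a ^ m)"
  proof -
    have "coprime p a"
    proof (rule coprimeI)
      fix c assume "c dvd p" "c dvd a"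
      then have "c dvd p - (p - 1)" using S1(1) unfolding p_def by (meson dvd_diff dvd_trans)
      then show "is_unit c" by simp
    qed
    then show ?thesis by simp
  qed
  ultimately have "p dvd v0" using coprime_dvd_mult_left_iff by blast
  then have "v0 = 0" using small S1(2) zdvd_imp_le[of p "\<bar>v0\<bar>"] unfolding v0_def p_def by fastforce
  then have "v1 = 0" "v2 = 0" using v1 v2 S1(2) unfolding p_def by auto
  with \<open>v0 = 0\<close> show "y1 * z2 = y2 * z1" "y2 * z0 = y0 * z2" "y0 * z1 = y1 * z0"
    unfolding v0_def v1_def v2_def by auto
qed

text \<open>Lengths of the palindromic prefixes; the 2 counts the letters of the link between two
  prefixes.\<close>

fun len :: "nat \<Rightarrow> nat" where
  "len 0 = 1"
| "len (Suc 0) = 3"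
| "len (Suc (Suc k)) = len (Suc k) + len k + 2"

lemma len_ge: "len k \<ge> Suc k"
  by (induction k rule: len.induct) auto

text \<open>The recursion sends the deviation to 2 minus \<open>golden - 1\<close> times itself, and
  \<open>golden - 1 < 1\<close> keeps it bounded.\<close>

lemma len_golden: "\<bar>real (len (Suc k)) - golden * len k\<bar> \<le> 6"
proof (induction k)
  case 0
  show ?case using golden_facts by simp
next
  case (Suc k)
  have "golden * (golden * real (len k)) = golden * len k + len k"
    unfolding mult.assoc[symmetric] power2_eq_square[symmetric] golden_facts(3) by (simp add: algebra_simps)
  then have "real (len (Suc (Suc k))) - golden * len (Suc k) = 2 - (golden - 1) * (real (len (Suc k)) - golden * len k)"
    by (simp add: algebra_simps)
  also have "\<bar>\<dots>\<bar> \<le> 2 + (golden - 1) * \<bar>real (len (Suc k)) - golden * len k\<bar>"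
    using abs_triangle_ineq4[of 2 "(golden - 1) * (real (len (Suc k)) - golden * len k)"] golden_facts(1)
    by (simp add: abs_mult)
  also have "\<dots> \<le> 2 + (golden - 1) * 6" using Suc golden_facts(1) by (intro add_left_mono mult_left_mono) auto
  also have "\<dots> \<le> 6" using golden_less by simp
  finally show ?case .
qed

section \<open>Palindromic prefixes of the Fibonacci word\<close>

locale fibonacci_matrices =
  fixes a t :: int
  assumes a: "a \<ge> 2" and t: "t \<ge> 1"
begin

definition link :: "nat \<Rightarrow> int^2^2" where
  "link k = (if even k then letter a t ** letter a (t + 1) else letter a (t + 1) ** letter a t)"

fun approx :: "nat \<Rightarrow> int^2^2" where
  "approx 0 = letter a t"
| "approx (Suc 0) = letter a t ** (letter a (t + 1) ** letter a t)"
| "approx (Suc (Suc k)) = approx (Suc k) ** (link k ** approx k)"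

text \<open>The suffix leading from \<open>approx (Suc k)\<close> to
  \<open>approx (Suc (Suc k))\<close>; its fixed-point form is the form that nearly vanishes at the
  limit.\<close>

definition tail :: "nat \<Rightarrow> int^2^2" where
  "tail k = link k ** approx k"

lemma approx_Suc_Suc: "approx (Suc (Suc k)) = approx (Suc k) ** tail k"
  unfolding tail_def by simp

lemma word_letters: "word a t 1 (letter a t)" "word a t 1 (letter a (t + 1))"
  using a t word_letter[of a t t] word_letter[of a t "t + 1"] by auto

lemma word_link: "word a t 2 (link k)"
  unfolding link_def using word_mult[of a t 1 _ 1] word_letters a by (auto simp: numeral_2_eq_2)

lemma word_approx: "word a t (len k) (approx k)"
proof (induction k rule: approx.induct)
  case 1
  then show ?case using word_letters by simp
next
  case 2
  have "word a t (1 + (1 + 1)) (approx (Suc 0))"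
    unfolding approx.simps using a by (intro word_mult word_letters) auto
  then show ?case by (simp add: numeral_3_eq_3)
next
  case (3 k)
  have "word a t (len (Suc k) + (2 + len k)) (approx (Suc (Suc k)))"
    unfolding approx.simps using a 3 by (intro word_mult word_link) auto
  then show ?case by (simp add: add.commute add.left_commute)
qed

lemma word_tail: "word a t (len k + 2) (tail k)"
  unfolding tail_def using word_mult[OF word_link word_approx, of k k] a by (simp add: add.commute)

lemma transpose_letter: "transpose (letter a s) = letter a s"
  unfolding symmetric_mat_def[symmetric] symmetric_mat_iff by simp

lemma link_Suc: "link (Suc k) = transpose (link k)"
  unfolding link_def by (simp add: matrix_transpose_mul transpose_letter)

text \<open>The prefix of index \<open>k + 3\<close> is the palindrome
  \<open>approx (Suc k)\<close>, link, \<open>approx k\<close>, transposed link,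
  \<open>approx (Suc k)\<close>. Its symmetry thus rests on prefixes two and three steps back,
  whence the window of three.\<close>

lemma symmetric_approx_aux:
  "transpose (approx k) = approx k \<and> transpose (approx (Suc k)) = approx (Suc k) \<and>
   transpose (approx (Suc (Suc k))) = approx (Suc (Suc k))"
proof (induction k)
  case 0
  show ?case by (simp add: link_def matrix_transpose_mul transpose_letter matrix_mul_assoc)
next
  case (Suc k)
  have "approx (Suc (Suc (Suc k))) = (approx (Suc k) ** (link k ** approx k)) ** (transpose (link k) ** approx (Suc k))"
    by (simp add: link_Suc)
  then have "transpose (approx (Suc (Suc (Suc k)))) = approx (Suc (Suc (Suc k)))"
    using Suc by (simp add: matrix_transpose_mul matrix_mul_assoc transpose_transpose del: approx.simps)
  then show ?case using Suc by blast
qed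

lemma transpose_approx: "transpose (approx k) = approx k"
  using symmetric_approx_aux by blast

lemma symmetric_approx: "symmetric_mat (approx k)"
  unfolding symmetric_mat_def by (rule transpose_approx)

lemma approx_Suc_Suc': "approx (Suc (Suc k)) = transpose (tail k) ** approx (Suc k)"
  using transpose_approx[of "Suc (Suc k)"] unfolding approx_Suc_Suc by (simp add: matrix_transpose_mul transpose_approx)

lemma approx_Suc_Suc_Suc:
  "approx (Suc (Suc (Suc k))) = transpose (tail k) ** (approx (Suc k) ** link (Suc k) ** approx (Suc k))"
  unfolding approx.simps(3)[of "Suc k"] approx_Suc_Suc'[of k] by (simp add: matrix_mul_assoc)

text \<open>Nonzero because the letters do not commute: transposing their product reverses its
  order. Up to sign all links share this value, so it is a constant in the estimates.\<close>

definition asymmetry :: int where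
  "asymmetry = (letter a t ** letter a (t + 1)) $ 1 $ 2 - (letter a t ** letter a (t + 1)) $ 2 $ 1"

lemma asymmetry_nz: "asymmetry \<noteq> 0"
proof -
  have "asymmetry = - (a * (a * t * (t + 1) + (a - 1)))"
    unfolding asymmetry_def mat2_mult_nth letter_nth by (simp add: algebra_simps power2_eq_square)
  moreover have "a * (a * t * (t + 1) + (a - 1)) > 0"
    using a t by (intro mult_pos_pos add_pos_pos) auto
  ultimately show ?thesis by linarith
qed

lemma link_asymmetry: "\<bar>link k $ 2 $ 1 - link k $ 1 $ 2\<bar> = \<bar>asymmetry\<bar>"
proof -
  have "letter a (t + 1) ** letter a t = transpose (letter a t ** letter a (t + 1))"
    by (simp add: matrix_transpose_mul transpose_letter)
  then show ?thesis unfolding link_def asymmetry_def by (simp add: transpose_def abs_minus_commute)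
qed

text \<open>The prefix is the transposed tail times a symmetric matrix, which has no antisymmetric
  part.\<close>

lemma tail_form_approx_Suc_Suc: "fixed_form (tail k) (approx (Suc (Suc k))) = 0"
proof -
  have "fixed_form (tail k) (transpose (tail k) ** approx (Suc k))
      = det (tail k) * (approx (Suc k) $ 2 $ 1 - approx (Suc k) $ 1 $ 2)"
    by (rule fixed_form_transpose_mult) (metis approx_Suc_Suc' symmetric_approx)
  then show ?thesis unfolding approx_Suc_Suc'[symmetric] using symmetric_approx[of "Suc k"]
    unfolding symmetric_mat_iff by simp
qed

text \<open>One step later the factor after the transposed tail is a link enclosed by two copies of
  \<open>approx (Suc k)\<close>, whose antisymmetric part stems from the link. The exponents
  \<open>len k + 2\<close> and \<open>len (Suc k)\<close> of the two determinants add up to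
  \<open>len (Suc (Suc k))\<close>.\<close>

lemma tail_form_approx_Suc_Suc_Suc:
  "\<bar>fixed_form (tail k) (approx (Suc (Suc (Suc k))))\<bar> = a ^ len (Suc (Suc k)) * \<bar>asymmetry\<bar>"
proof -
  define T where "T = approx (Suc k) ** link (Suc k) ** approx (Suc k)"
  have "fixed_form (tail k) (transpose (tail k) ** T) = det (tail k) * (T $ 2 $ 1 - T $ 1 $ 2)"
    by (rule fixed_form_transpose_mult) (metis approx_Suc_Suc_Suc symmetric_approx T_def)
  also have "transpose (tail k) ** T = approx (Suc (Suc (Suc k)))"
    unfolding T_def approx_Suc_Suc_Suc ..
  also have "T $ 2 $ 1 - T $ 1 $ 2 = det (approx (Suc k)) * (link (Suc k) $ 2 $ 1 - link (Suc k) $ 1 $ 2)"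
    unfolding T_def by (rule antisymmetric_part_congruence[OF symmetric_approx])
  finally have "\<bar>fixed_form (tail k) (approx (Suc (Suc (Suc k))))\<bar>
      = \<bar>det (tail k)\<bar> * (\<bar>det (approx (Suc k))\<bar> * \<bar>asymmetry\<bar>)"
    by (simp add: abs_mult link_asymmetry)
  moreover have "det (tail k) = a ^ (len k + 2)" "det (approx (Suc k)) = a ^ len (Suc k)"
    using word_tail word_approx unfolding word_def by auto
  ultimately show ?thesis using a by (simp add: power_add mult_ac)
qed

end

section \<open>Convergence of the matrices to a real number\<close>

text \<open>\<open>x\<close> lies between the slopes \<open>q / p\<close> and \<open>r / q\<close>,
  whose difference is \<open>d / (p * q)\<close>; \<open>c\<close> converts \<open>q\<close> into
  \<open>p\<close>.\<close>

lemma symmetric_approximation_error: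
  fixes p q r x d c :: real
  assumes q: "0 < q" and le: "r \<le> q" "q \<le> p" and det: "p * r - q\<^sup>2 = d" and "0 \<le> d"
    and x: "q / p \<le> x" "x \<le> r / q" and c: "p \<le> c * q" "1 \<le> c"
  shows "\<bar>p * x - q\<bar> \<le> c * d / p" "\<bar>p * x\<^sup>2 - r\<bar> \<le> c * d / p"
proof -
  have p: "0 < p" using q le by simp
  have 1: "0 \<le> p * x - q" using x(1) p by (simp add: field_simps)
  have "d / q \<le> c * d / p"
    using mult_right_mono[OF c(1) \<open>0 \<le> d\<close>] p q by (simp add: field_simps)
  moreover have "p * x - q \<le> d / q"
  proof -
    have "q * x \<le> r" using x(2) q by (simp add: field_simps)
    then have "p * (q * x) \<le> p * r" using p by simp
    then have "(p * x - q) * q \<le> d" unfolding det[symmetric] by (simp add: algebra_simps power2_eq_square)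
    then show ?thesis using q by (simp add: pos_le_divide_eq)
  qed
  ultimately have 2: "p * x - q \<le> c * d / p" by simp
  with 1 show "\<bar>p * x - q\<bar> \<le> c * d / p" by simp
  have x1: "0 \<le> x" "x \<le> 1"
  proof -
    have "0 \<le> q / p" "r / q \<le> 1" using p q le by simp_all
    then show "0 \<le> x" "x \<le> 1" using x by linarith+
  qed
  have 3: "q * x - r \<le> 0" using x(2) q by (simp add: field_simps)
  have "q * (q / p) \<le> q * x" using x(1) q by (intro mult_left_mono) auto
  moreover have "q * (q / p) - r = - (d / p)" unfolding det[symmetric] using p by (simp add: field_simps power2_eq_square)
  moreover have "1 * d / p \<le> c * d / p" using c(2) \<open>0 \<le> d\<close> p by (intro divide_right_mono mult_right_mono) auto
  ultimately have 4: "- (c * d / p) \<le> q * x - r" by simp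
  have "p * x\<^sup>2 - r = x * (p * x - q) + (q * x - r)" by (simp add: algebra_simps power2_eq_square)
  moreover have "0 \<le> x * (p * x - q)" using x1 1 by simp
  moreover have "x * (p * x - q) \<le> 1 * (c * d / p)" using x1 1 2 by (intro mult_mono) auto
  ultimately show "\<bar>p * x\<^sup>2 - r\<bar> \<le> c * d / p" using 3 4 by linarith
qed

text \<open>Multiplication by \<open>N\<close> moves both slopes inwards: the cross differences are
  off-diagonal entries of \<open>N\<close> times \<open>det S\<close>.\<close>

lemma symmetric_mult_slopes:
  fixes S N :: "int^2^2"
  assumes S: "symmetric_mat S" and SN: "symmetric_mat (S ** N)" and N: "dominated N" and det: "det S \<ge> 0"
  shows "S $ 1 $ 2 * (S ** N) $ 1 $ 1 \<le> (S ** N) $ 1 $ 2 * S $ 1 $ 1"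
    and "(S ** N) $ 2 $ 2 * S $ 1 $ 2 \<le> S $ 2 $ 2 * (S ** N) $ 1 $ 2"
proof -
  have N0: "0 \<le> N $ 2 $ 1" "0 \<le> N $ 1 $ 2" using N unfolding dominated_def by auto
  have e: "(S ** N) $ 2 $ 1 = (S ** N) $ 1 $ 2" using SN unfolding symmetric_mat_iff .
  have "(S ** N) $ 2 $ 1 * S $ 1 $ 1 - S $ 1 $ 2 * (S ** N) $ 1 $ 1 = N $ 2 $ 1 * det S"
    using S unfolding symmetric_mat_iff by (simp add: mat2_mult_nth det_2 algebra_simps)
  then show "S $ 1 $ 2 * (S ** N) $ 1 $ 1 \<le> (S ** N) $ 1 $ 2 * S $ 1 $ 1"
    using mult_nonneg_nonneg[OF N0(1) det] unfolding e by linarith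
  have "S $ 2 $ 2 * (S ** N) $ 1 $ 2 - (S ** N) $ 2 $ 2 * S $ 1 $ 2 = N $ 1 $ 2 * det S"
    using S unfolding symmetric_mat_iff by (simp add: mat2_mult_nth det_2 algebra_simps)
  then show "(S ** N) $ 2 $ 2 * S $ 1 $ 2 \<le> S $ 2 $ 2 * (S ** N) $ 1 $ 2"
    using mult_nonneg_nonneg[OF N0(2) det] by linarith
qed

lemma linear_form_approximation:
  fixes p q r x e y0 y1 y2 :: real
  assumes "\<bar>p * x - q\<bar> \<le> e" "\<bar>p * x\<^sup>2 - r\<bar> \<le> e"
  shows "\<bar>p * (y0 + y1 * x + y2 * x\<^sup>2) - (y0 * p + y1 * q + y2 * r)\<bar> \<le> (\<bar>y1\<bar> + \<bar>y2\<bar>) * e"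
proof -
  have "p * (y0 + y1 * x + y2 * x\<^sup>2) - (y0 * p + y1 * q + y2 * r) = y1 * (p * x - q) + y2 * (p * x\<^sup>2 - r)"
    by (simp add: algebra_simps)
  also have "\<bar>\<dots>\<bar> \<le> \<bar>y1\<bar> * \<bar>p * x - q\<bar> + \<bar>y2\<bar> * \<bar>p * x\<^sup>2 - r\<bar>"
    unfolding abs_mult[symmetric] by (rule abs_triangle_ineq)
  also have "\<dots> \<le> \<bar>y1\<bar> * e + \<bar>y2\<bar> * e" using assms by (intro add_mono mult_left_mono) auto
  finally show ?thesis by (simp add: algebra_simps)
qed

text \<open>The triple product of \<open>n\<close> with the cross product of \<open>y\<close> and
  \<open>z\<close> is \<open>(n . z) y - (n . y) z\<close>; it vanishes for parallel
  \<open>y\<close> and \<open>z\<close>.\<close>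

lemma parallel_pairing:
  fixes y0 y1 y2 z0 z1 z2 n0 n1 n2 :: int
  assumes "y1 * z2 = y2 * z1" "y2 * z0 = y0 * z2" "y0 * z1 = y1 * z0"
  shows "(z0 * n0 + z1 * n1 + z2 * n2) * y0 = (y0 * n0 + y1 * n1 + y2 * n2) * z0"
    and "(z0 * n0 + z1 * n1 + z2 * n2) * y1 = (y0 * n0 + y1 * n1 + y2 * n2) * z1"
    and "(z0 * n0 + z1 * n1 + z2 * n2) * y2 = (y0 * n0 + y1 * n1 + y2 * n2) * z2"
proof -
  have "(z0 * n0 + z1 * n1 + z2 * n2) * y0 - (y0 * n0 + y1 * n1 + y2 * n2) * z0
      = n1 * (y0 * z1 - y1 * z0) - n2 * (y2 * z0 - y0 * z2)" by (simp add: algebra_simps)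
  then show "(z0 * n0 + z1 * n1 + z2 * n2) * y0 = (y0 * n0 + y1 * n1 + y2 * n2) * z0" using assms by simp
  have "(z0 * n0 + z1 * n1 + z2 * n2) * y1 - (y0 * n0 + y1 * n1 + y2 * n2) * z1
      = n2 * (y1 * z2 - y2 * z1) - n0 * (y0 * z1 - y1 * z0)" by (simp add: algebra_simps)
  then show "(z0 * n0 + z1 * n1 + z2 * n2) * y1 = (y0 * n0 + y1 * n1 + y2 * n2) * z1" using assms by simp
  have "(z0 * n0 + z1 * n1 + z2 * n2) * y2 - (y0 * n0 + y1 * n1 + y2 * n2) * z2
      = n0 * (y2 * z0 - y0 * z2) - n1 * (y1 * z2 - y2 * z1)" by (simp add: algebra_simps)
  then show "(z0 * n0 + z1 * n1 + z2 * n2) * y2 = (y0 * n0 + y1 * n1 + y2 * n2) * z2" using assms by simp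
qed

context fibonacci_matrices
begin

definition P :: "nat \<Rightarrow> real" where "P k = real_of_int (approx k $ 1 $ 1)"
definition Q :: "nat \<Rightarrow> real" where "Q k = real_of_int (approx k $ 1 $ 2)"
definition R :: "nat \<Rightarrow> real" where "R k = real_of_int (approx k $ 2 $ 2)"
definition U :: "nat \<Rightarrow> real" where "U k = real_of_int (tail k $ 1 $ 1)"
text \<open>Determinant over top left entry, times the constant of
  \<open>P k \<le> 2 * t * Q k\<close>.\<close>

definition err :: "nat \<Rightarrow> real" where "err k = 2 * t * real_of_int a ^ len k / P k"

lemma approx_dominated: "dominated (approx k)" and tail_dominated: "dominated (tail k)"
  using word_approx word_tail unfolding word_def by auto

lemma PQR: "0 < R k" "R k \<le> Q k" "Q k \<le> P k" "0 < Q k" "0 < P k"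
  using approx_dominated[of k] unfolding dominated_def P_def Q_def R_def by auto

lemma det_PQR: "P k * R k - (Q k)\<^sup>2 = real_of_int a ^ len k"
proof -
  have "det (approx k) = a ^ len k" using word_approx unfolding word_def by auto
  then have "approx k $ 1 $ 1 * approx k $ 2 $ 2 - (approx k $ 1 $ 2)\<^sup>2 = a ^ len k"
    using symmetric_approx[of k] unfolding det_2 symmetric_mat_iff by (simp add: power2_eq_square)
  then show ?thesis unfolding P_def Q_def R_def by (metis of_int_diff of_int_mult of_int_power)
qed

lemma slopes_step: "Q k / P k \<le> Q (Suc k) / P (Suc k)" "R (Suc k) / Q (Suc k) \<le> R k / Q k"
proof -
  obtain N where N: "dominated N" "approx (Suc k) = approx k ** N"
  proof (cases k)
    case 0
    have "dominated (letter a (t + 1) ** letter a t)"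
      using word_letters unfolding word_def by (intro dominated_mult) auto
    then show ?thesis using that 0 by simp
  next
    case (Suc j)
    then show ?thesis using that tail_dominated approx_Suc_Suc by blast
  qed
  have d: "det (approx k) \<ge> 0" using word_approx[of k] a unfolding word_def by auto
  have "symmetric_mat (approx k ** N)" using symmetric_approx[of "Suc k"] unfolding N(2) .
  note s = symmetric_mult_slopes[OF symmetric_approx this N(1) d, folded N(2)]
  have "Q k * P (Suc k) \<le> Q (Suc k) * P k" "R (Suc k) * Q k \<le> R k * Q (Suc k)"
    unfolding P_def Q_def R_def using s by (simp_all only: of_int_le_iff flip: of_int_mult)
  then show "Q k / P k \<le> Q (Suc k) / P (Suc k)" "R (Suc k) / Q (Suc k) \<le> R k / Q k"
    using PQR[of k] PQR[of "Suc k"] by (simp_all add: field_simps)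
qed

lemma slopes_mono: "incseq (\<lambda>k. Q k / P k)" "decseq (\<lambda>k. R k / Q k)"
  using slopes_step by (auto intro: incseq_SucI decseq_SucI)

lemma slopes_le: "Q i / P i \<le> R j / Q j"
proof -
  have "Q k * Q k \<le> R k * P k" for k
    proof -
      have "0 \<le> real_of_int a ^ len k" using a by simp
      then show ?thesis unfolding det_PQR[symmetric] by (simp add: power2_eq_square mult.commute)
    qed
  then have *: "Q k / P k \<le> R k / Q k" for k using PQR[of k] by (simp add: field_simps)
  have "Q i / P i \<le> Q (max i j) / P (max i j)" using slopes_mono(1) by (simp add: incseq_def)
  also have "\<dots> \<le> R (max i j) / Q (max i j)" by (rule *)
  also have "\<dots> \<le> R j / Q j" using slopes_mono(2) by (simp add: decseq_def)
  finally show ?thesis .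
qed

text \<open>The slope intervals are nested, so the supremum of their lower ends lies in each of
  them.\<close>

definition xi :: real where "xi = (SUP k. Q k / P k)"

lemma xi_bounds: "Q k / P k \<le> xi" "xi \<le> R k / Q k"
proof -
  have "bdd_above (range (\<lambda>k. Q k / P k))" using slopes_le[of _ 0] by (auto intro!: bdd_aboveI2)
  then show "Q k / P k \<le> xi" unfolding xi_def by (intro cSUP_upper) auto
  show "xi \<le> R k / Q k" unfolding xi_def using slopes_le by (intro cSUP_least) auto
qed

text \<open>\<open>Q k / P k\<close> increases with \<open>k\<close>, so the constant of a single
  letter serves for all prefixes.\<close>

lemma P_le_Q: "P k \<le> 2 * t * Q k"
proof -
  have "1 * 1 \<le> a * t\<^sup>2" using a t by (intro mult_mono) (auto simp: one_le_power)
  then have "approx 0 $ 1 $ 1 \<le> 2 * t * approx 0 $ 1 $ 2" by (simp add: power2_eq_square algebra_simps)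
  then have "P 0 \<le> real_of_int (2 * t * approx 0 $ 1 $ 2)" unfolding P_def of_int_le_iff .
  then have "P 0 \<le> 2 * t * Q 0" unfolding Q_def by simp
  then have "1 / (2 * t) \<le> Q 0 / P 0" using PQR[of 0] t by (simp add: field_simps)
  also have "\<dots> \<le> Q k / P k" using slopes_mono(1) by (simp add: incseq_def)
  finally show ?thesis using PQR[of k] t by (simp add: field_simps)
qed

lemma xi_approximation: "\<bar>P k * xi - Q k\<bar> \<le> err k" "\<bar>P k * xi\<^sup>2 - R k\<bar> \<le> err k"
  unfolding err_def
  using symmetric_approximation_error[OF PQR(4)[of k] PQR(2)[of k] PQR(3)[of k] det_PQR[of k] _ xi_bounds(1)[of k] xi_bounds(2)[of k] P_le_Q[of k]]
    a t by simp_all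

lemma err_pos: "err k > 0"
  unfolding err_def using PQR[of k] a t by simp

lemma P_Suc_Suc: "P (Suc k) * U k \<le> P (Suc (Suc k))"
  unfolding P_def U_def approx_Suc_Suc of_int_mult[symmetric] of_int_le_iff
  by (rule mult_top_left[OF approx_dominated tail_dominated])

lemma P_growth: "(real_of_int (a * t\<^sup>2)) ^ len k \<le> P k" "P k \<le> (real_of_int (10 * a * t\<^sup>2)) ^ len k"
  and U_growth: "(real_of_int (a * t\<^sup>2)) ^ (len k + 2) \<le> U k" "U k \<le> (real_of_int (10 * a * t\<^sup>2)) ^ (len k + 2)"
proof -
  have *: "(real_of_int (a * t\<^sup>2)) ^ m \<le> real_of_int (N $ 1 $ 1) \<and> real_of_int (N $ 1 $ 1) \<le> (real_of_int (10 * a * t\<^sup>2)) ^ m"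
    if "word a t m N" for m N
  proof -
    have "N $ 1 $ 1 > 0" "(a * t\<^sup>2) ^ m \<le> N $ 1 $ 1" "2 * N $ 1 $ 1 \<le> (10 * a * t\<^sup>2) ^ m"
      using that unfolding word_def dominated_def by auto
    then show ?thesis unfolding of_int_power[symmetric] of_int_le_iff by linarith
  qed
  show "(real_of_int (a * t\<^sup>2)) ^ len k \<le> P k" "P k \<le> (real_of_int (10 * a * t\<^sup>2)) ^ len k"
    unfolding P_def using *[OF word_approx] by auto
  show "(real_of_int (a * t\<^sup>2)) ^ (len k + 2) \<le> U k" "U k \<le> (real_of_int (10 * a * t\<^sup>2)) ^ (len k + 2)"
    unfolding U_def using *[OF word_tail] by auto
qed

section \<open>The fixed-point forms at the limit\<close>

definition z0 :: "nat \<Rightarrow> int" where "z0 k = - tail k $ 1 $ 2"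
definition z1 :: "nat \<Rightarrow> int" where "z1 k = tail k $ 1 $ 1 - tail k $ 2 $ 2"
definition z2 :: "nat \<Rightarrow> int" where "z2 k = tail k $ 2 $ 1"
definition zform :: "nat \<Rightarrow> real" where "zform k = z0 k + z1 k * xi + z2 k * xi\<^sup>2"

lemma fixed_form_tail: "fixed_form (tail k) N = z0 k * N $ 1 $ 1 + z1 k * N $ 1 $ 2 + z2 k * N $ 2 $ 2"
  unfolding fixed_form_def z0_def z1_def z2_def ..

lemma z_bounds: "\<bar>z1 k\<bar> \<le> tail k $ 1 $ 1" "\<bar>z2 k\<bar> \<le> tail k $ 1 $ 1" "z2 k > 0"
  using tail_dominated[of k] unfolding dominated_def z1_def z2_def by auto

lemma zform_approximation:
  "\<bar>P j * zform k - fixed_form (tail k) (approx j)\<bar> \<le> 2 * U k * err j"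
proof -
  have "\<bar>P j * zform k - (z0 k * P j + z1 k * Q j + z2 k * R j)\<bar> \<le> (\<bar>real_of_int (z1 k)\<bar> + \<bar>real_of_int (z2 k)\<bar>) * err j"
    unfolding zform_def by (rule linear_form_approximation[OF xi_approximation])
  also have "\<dots> \<le> (2 * U k) * err j"
    using z_bounds[of k] err_pos[of j] unfolding U_def by (intro mult_right_mono) linarith+
  finally show ?thesis unfolding fixed_form_tail P_def Q_def R_def by simp
qed

text \<open>The form vanishes at \<open>approx (Suc (Suc k))\<close>, so its value at
  \<open>xi\<close> is pure approximation error;
  \<open>P (Suc k) * U k \<le> P (Suc (Suc k))\<close> then eliminates \<open>U k\<close>.\<close>

lemma abs_zform_le: "\<bar>zform k\<bar> \<le> 4 * t * a ^ len (Suc (Suc k)) / (P (Suc (Suc k)) * P (Suc k))"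
proof -
  let ?j = "Suc (Suc k)"
  have pos: "P ?j > 0" "P (Suc k) > 0" by (rule PQR)+
  have "\<bar>P ?j * zform k\<bar> \<le> 2 * U k * err ?j"
    using zform_approximation[of ?j k] unfolding tail_form_approx_Suc_Suc by simp
  then have "P ?j * \<bar>zform k\<bar> \<le> 2 * U k * err ?j" using pos by (simp add: abs_mult)
  then have "P (Suc k) * (P ?j * \<bar>zform k\<bar>) \<le> P (Suc k) * (2 * U k * err ?j)" using pos by simp
  also have "\<dots> = (P (Suc k) * U k) * (2 * err ?j)" by simp
  also have "\<dots> \<le> P ?j * (2 * err ?j)" using P_Suc_Suc err_pos[of ?j] by (intro mult_right_mono) auto
  also have "\<dots> = 4 * t * a ^ len ?j" unfolding err_def using pos by simp
  finally show ?thesis using pos by (simp add: field_simps)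
qed

text \<open>At \<open>approx (Suc (Suc (Suc k)))\<close> the form takes a nonzero integer value
  divisible by \<open>a ^ len (Suc (Suc k))\<close>. For \<open>P (Suc k) \<ge> 8 * t\<close> the
  approximation error is at most half of this power.\<close>

lemma abs_zform_ge:
  assumes "P (Suc k) \<ge> 8 * t"
  shows "\<bar>zform k\<bar> \<ge> a ^ len (Suc (Suc k)) / (2 * P (Suc (Suc (Suc k))))"
proof -
  let ?j = "Suc (Suc (Suc k))"
  let ?d = "real_of_int a ^ len (Suc (Suc k))"
  have pos: "P ?j > 0" "P (Suc k) > 0" by (rule PQR)+
  have U: "U k > 0" "U (Suc k) > 0" using tail_dominated unfolding U_def dominated_def
    by (metis (no_types) of_int_0_less_iff order_less_le_trans)+
  have a1: "real_of_int a \<ge> 1" using a by simp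
  have "1 \<le> \<bar>asymmetry\<bar>" using asymmetry_nz by linarith
  then have "a ^ len (Suc (Suc k)) * 1 \<le> a ^ len (Suc (Suc k)) * \<bar>asymmetry\<bar>" using a by (intro mult_left_mono) auto
  then have "a ^ len (Suc (Suc k)) \<le> \<bar>fixed_form (tail k) (approx ?j)\<bar>" unfolding tail_form_approx_Suc_Suc_Suc by simp
  then have 1: "?d \<le> \<bar>real_of_int (fixed_form (tail k) (approx ?j))\<bar>"
    by (metis of_int_abs of_int_le_iff of_int_power)
  have "a * 1 \<le> a * t\<^sup>2" using a t by (intro mult_left_mono) (auto simp: one_le_power)
  then have "real_of_int a \<le> real_of_int (a * t\<^sup>2)" unfolding of_int_le_iff by simp
  then have "real_of_int a ^ (len (Suc k) + 2) \<le> (real_of_int (a * t\<^sup>2)) ^ (len (Suc k) + 2)"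
    using a by (intro power_mono) auto
  then have aU: "real_of_int a ^ (len (Suc k) + 2) \<le> U (Suc k)" using U_growth(1)[of "Suc k"] by linarith
  have "P (Suc k) * U k * U (Suc k) \<le> P (Suc (Suc k)) * U (Suc k)"
    using P_Suc_Suc[of k] U by (intro mult_right_mono) auto
  also have "\<dots> \<le> P ?j" by (rule P_Suc_Suc)
  finally have Pj: "P (Suc k) * U k * U (Suc k) \<le> P ?j" .
  have "real_of_int a ^ len ?j = ?d * real_of_int a ^ (len (Suc k) + 2)" by (simp add: power_add)
  also have "\<dots> \<le> ?d * U (Suc k)" using aU a1 by (intro mult_left_mono) auto
  finally have aj: "real_of_int a ^ len ?j \<le> ?d * U (Suc k)" .
  have "2 * U k * err ?j = 4 * t * U k * real_of_int a ^ len ?j / P ?j" unfolding err_def by simp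
  also have "\<dots> \<le> 4 * t * U k * (?d * U (Suc k)) / P ?j"
    using aj U t pos by (intro divide_right_mono mult_left_mono) auto
  also have "\<dots> \<le> 4 * t * U k * (?d * U (Suc k)) / (P (Suc k) * U k * U (Suc k))"
    using Pj U t pos a1 by (intro divide_left_mono) auto
  also have "\<dots> = 4 * t * ?d / P (Suc k)" using U by simp
  also have "\<dots> \<le> ?d / 2"
  proof -
    have "8 * t * ?d \<le> P (Suc k) * ?d" using assms a1 by (intro mult_right_mono) auto
    then show ?thesis using pos by (simp add: field_simps)
  qed
  finally have 2: "2 * U k * err ?j \<le> ?d / 2" .
  have "\<bar>P ?j * zform k\<bar> \<ge> ?d / 2" using zform_approximation[of ?j k] 1 2 by linarith
  then have "P ?j * \<bar>zform k\<bar> \<ge> ?d / 2" using pos by (simp add: abs_mult)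
  then show ?thesis using pos by (simp add: field_simps)
qed

text \<open>The form \<open>y\<close> has an integer value of modulus below 1 at
  \<open>approx (Suc (Suc k))\<close>, so it vanishes there like the fixed-point form. The bound
  \<open>P (Suc k) / 3\<close> leaves their cross product too short to be nonzero, so they are
  parallel. Their values at the next prefix show that \<open>asymmetry\<close> times
  \<open>y\<close> is a nonzero integer multiple of the fixed-point form.\<close>

lemma abs_form_ge:
  fixes y0 y1 y2 :: int
  assumes nz: "(y0, y1, y2) \<noteq> (0, 0, 0)"
    and Y: "\<bar>real_of_int y1\<bar> \<le> P (Suc k) / 3" "\<bar>real_of_int y2\<bar> \<le> P (Suc k) / 3"
    and small: "P (Suc (Suc k)) * \<bar>y0 + y1 * xi + y2 * xi\<^sup>2\<bar> + 2 * (P (Suc k) / 3) * err (Suc (Suc k)) < 1"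
  shows "\<bar>zform k\<bar> \<le> \<bar>asymmetry\<bar> * \<bar>y0 + y1 * xi + y2 * xi\<^sup>2\<bar>"
proof -
  let ?j = "Suc (Suc k)"
  define S where "S = approx ?j"
  define N where "N = approx (Suc ?j)"
  define v where "v = y0 + y1 * xi + y2 * xi\<^sup>2"
  have "\<bar>P ?j * v - (y0 * P ?j + y1 * Q ?j + y2 * R ?j)\<bar> \<le> (\<bar>real_of_int y1\<bar> + \<bar>real_of_int y2\<bar>) * err ?j"
    unfolding v_def by (rule linear_form_approximation[OF xi_approximation])
  also have "\<dots> \<le> 2 * (P (Suc k) / 3) * err ?j" using Y err_pos[of ?j] by (intro mult_right_mono) auto
  finally have "\<bar>y0 * P ?j + y1 * Q ?j + y2 * R ?j\<bar> \<le> \<bar>P ?j * v\<bar> + 2 * (P (Suc k) / 3) * err ?j" by linarith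
  also have "\<dots> < 1" using small PQR(5)[of ?j] unfolding v_def by (simp add: abs_mult)
  finally have "\<bar>real_of_int (y0 * S $ 1 $ 1 + y1 * S $ 1 $ 2 + y2 * S $ 2 $ 2)\<bar> < 1"
    unfolding P_def Q_def R_def S_def by simp
  then have yS: "y0 * S $ 1 $ 1 + y1 * S $ 1 $ 2 + y2 * S $ 2 $ 2 = 0" by linarith
  have zS: "z0 k * S $ 1 $ 1 + z1 k * S $ 1 $ 2 + z2 k * S $ 2 $ 2 = 0"
    using tail_form_approx_Suc_Suc[of k] unfolding fixed_form_tail S_def .
  have S: "symmetric_mat S" "det S = a ^ len ?j" "a dvd S $ 1 $ 1 - 1" "S $ 1 $ 1 > 0"
    using symmetric_approx word_approx[of ?j] unfolding S_def word_def dominated_def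
    by (auto simp del: approx.simps len.simps)
  have U0: "U k > 0" using tail_dominated[of k] unfolding U_def dominated_def by auto
  have "\<bar>real_of_int (y1 * z2 k - y2 * z1 k)\<bar> \<le> \<bar>real_of_int y1 * z2 k\<bar> + \<bar>real_of_int y2 * z1 k\<bar>"
    using abs_triangle_ineq4[of "real_of_int y1 * z2 k" "real_of_int y2 * z1 k"] by simp
  also have "\<dots> \<le> P (Suc k) / 3 * U k + P (Suc k) / 3 * U k"
    unfolding abs_mult using Y z_bounds[of k] PQR(5)[of "Suc k"] unfolding U_def by (intro add_mono mult_mono) auto
  also have "\<dots> < P (Suc k) * U k" using PQR(5)[of "Suc k"] U0 by simp
  also have "\<dots> \<le> S $ 1 $ 1" using P_Suc_Suc[of k] unfolding P_def S_def by simp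
  finally have sm: "\<bar>y1 * z2 k - y2 * z1 k\<bar> < S $ 1 $ 1" by (simp only: of_int_less_iff flip: of_int_abs)
  note par = orthogonal_symmetric_cross_product[OF S yS zS sm]
  define F where "F = z0 k * N $ 1 $ 1 + z1 k * N $ 1 $ 2 + z2 k * N $ 2 $ 2"
  define G where "G = y0 * N $ 1 $ 1 + y1 * N $ 1 $ 2 + y2 * N $ 2 $ 2"
  have F: "\<bar>F\<bar> = a ^ len ?j * \<bar>asymmetry\<bar>"
    using tail_form_approx_Suc_Suc_Suc[of k] unfolding fixed_form_tail F_def N_def .
  have FG: "F * y0 = G * z0 k" "F * y1 = G * z1 k" "F * y2 = G * z2 k"
    unfolding F_def G_def by (rule parallel_pairing[OF par])+
  \<comment> \<open>\<open>z1 k\<close> is congruent to 1 modulo \<open>a\<close>; this near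
    primitivity moves the power of \<open>a\<close> from \<open>F\<close> to
    \<open>G\<close>.\<close>
  have "coprime (z1 k) a"
  proof (rule coprimeI)
    fix c assume c: "c dvd z1 k" "c dvd a"
    have "a dvd tail k $ 1 $ 1 - 1" "a dvd tail k $ 2 $ 2" using word_tail[of k] unfolding word_def by auto
    then have "c dvd tail k $ 1 $ 1 - 1 - tail k $ 2 $ 2" using c(2) by (meson dvd_diff dvd_trans)
    then have "c dvd z1 k - (tail k $ 1 $ 1 - 1 - tail k $ 2 $ 2)" using c(1) by (rule dvd_diff[rotated])
    then show "is_unit c" unfolding z1_def by simp
  qed
  moreover have "a ^ len ?j dvd F" using F by (metis dvd_abs_iff dvd_triv_left)
  then have "a ^ len ?j dvd G * z1 k" unfolding FG(2)[symmetric] by simp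
  ultimately have "a ^ len ?j dvd G" by (simp add: coprime_dvd_mult_left_iff coprime_commute)
  then obtain g where g: "G = a ^ len ?j * g" by (elim dvdE)
  have F0: "F \<noteq> 0" using F asymmetry_nz a by auto
  have "g \<noteq> 0" using FG F0 nz unfolding g by auto
  then have g1: "1 \<le> \<bar>real_of_int g\<bar>" by linarith
  have "real_of_int F * y0 = G * z0 k" "real_of_int F * y1 = G * z1 k" "real_of_int F * y2 = G * z2 k"
    using FG by (metis of_int_mult)+
  then have "F * v = G * zform k" unfolding v_def zform_def by (simp add: distrib_left mult.assoc[symmetric])
  then have "\<bar>real_of_int F\<bar> * \<bar>v\<bar> = \<bar>real_of_int G\<bar> * \<bar>zform k\<bar>" by (simp flip: abs_mult)
  moreover have "\<bar>real_of_int F\<bar> = a ^ len ?j * \<bar>asymmetry\<bar>" using F by (metis of_int_abs)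
  moreover have "\<bar>real_of_int G\<bar> = a ^ len ?j * \<bar>real_of_int g\<bar>" unfolding g using a by (simp add: abs_mult)
  ultimately have "real_of_int (a ^ len ?j) * (\<bar>asymmetry\<bar> * \<bar>v\<bar>) = real_of_int (a ^ len ?j) * (\<bar>real_of_int g\<bar> * \<bar>zform k\<bar>)"
    by (simp add: mult.assoc)
  then have "\<bar>asymmetry\<bar> * \<bar>v\<bar> = \<bar>real_of_int g\<bar> * \<bar>zform k\<bar>" using a by simp
  moreover have "1 * \<bar>zform k\<bar> \<le> \<bar>real_of_int g\<bar> * \<bar>zform k\<bar>" using g1 by (intro mult_right_mono) auto
  ultimately show ?thesis unfolding v_def by simp
qed

end

section \<open>Exponents of the constructed numbers\<close>

lemma len_Suc_Suc_bounds:
  "golden * len (Suc k) - 6 \<le> len (Suc (Suc k))" "len (Suc (Suc k)) \<le> golden * len (Suc k) + 6"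
  using len_golden[of "Suc k"] by linarith+

lemma eventually_exp_len_less:
  fixes c \<eta> \<epsilon> :: real
  assumes "\<eta> > 0" "\<epsilon> > 0"
  shows "\<forall>\<^sub>F k in sequentially. exp (c - \<eta> * len (Suc k)) < \<epsilon>"
proof -
  obtain K where K: "real K > (c - ln \<epsilon>) / \<eta>" using reals_Archimedean2 by blast
  have "exp (c - \<eta> * len (Suc k)) < \<epsilon>" if "k \<ge> K" for k
  proof -
    have "real K \<le> len (Suc k)" using len_ge[of "Suc k"] that by linarith
    then have "\<eta> * K \<le> \<eta> * len (Suc k)" using assms by (intro mult_left_mono) auto
    moreover have "c - ln \<epsilon> < \<eta> * K" using K assms by (simp add: field_simps)
    ultimately have "c - \<eta> * len (Suc k) < ln \<epsilon>" by linarith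
    then show ?thesis using assms(2) by (metis exp_less_mono exp_ln)
  qed
  then show ?thesis unfolding eventually_sequentially by blast
qed

context fibonacci_matrices
begin

text \<open>Per letter of the word, the determinant grows by \<open>exp la\<close>, and the top left entry by a
  factor between \<open>exp ka\<close> and \<open>exp kb\<close>; thus \<open>la / ka\<close> is the parameter \<open>\<delta>\<close>.\<close>

definition la :: real where "la = ln (real_of_int a)"
definition ka :: real where "ka = ln (real_of_int (a * t\<^sup>2))"
definition kb :: real where "kb = ln (real_of_int (10 * a * t\<^sup>2))"

lemma log_bounds: "0 < la" "la \<le> ka" "0 < ka" "ka < kb" "kb = ln 10 + ka"
proof -
  have "a * 1 \<le> a * t\<^sup>2" using a t by (intro mult_left_mono) (auto simp: one_le_power)
  then have le: "real_of_int a \<le> real_of_int (a * t\<^sup>2)" unfolding of_int_le_iff by simp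
  have a2: "real_of_int a \<ge> 2" using a by simp
  show "0 < la" unfolding la_def using a2 by simp
  show "la \<le> ka" unfolding la_def ka_def using le a2 by (intro ln_mono) auto
  then show "0 < ka" using \<open>0 < la\<close> by simp
  have "real_of_int (10 * a * t\<^sup>2) = 10 * real_of_int (a * t\<^sup>2)" by simp
  moreover have "real_of_int (a * t\<^sup>2) > 0" using le a2 by linarith
  ultimately show "kb = ln 10 + ka" unfolding kb_def ka_def by (metis ln_mult_pos zero_less_numeral)
  then show "ka < kb" by simp
qed

lemma power_eq_exp:
  "real_of_int a ^ n = exp (la * n)" "real_of_int (a * t\<^sup>2) ^ n = exp (ka * n)"
  "real_of_int (10 * a * t\<^sup>2) ^ n = exp (kb * n)"
proof -
  have pos: "real_of_int a > 0" "real_of_int (a * t\<^sup>2) > 0" "real_of_int (10 * a * t\<^sup>2) > 0"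
    using a t by simp_all
  have *: "x ^ n = exp (ln x * n)" if "x > 0" for x :: real
    using that by (metis exp_ln exp_of_nat2_mult)
  show "real_of_int a ^ n = exp (la * n)" unfolding la_def by (rule *[OF pos(1)])
  show "real_of_int (a * t\<^sup>2) ^ n = exp (ka * n)" unfolding ka_def by (rule *[OF pos(2)])
  show "real_of_int (10 * a * t\<^sup>2) ^ n = exp (kb * n)" unfolding kb_def by (rule *[OF pos(3)])
qed

lemma P_exp: "exp (ka * len k) \<le> P k" "P k \<le> exp (kb * len k)"
  and U_exp: "exp (ka * (real (len k) + 2)) \<le> U k" "U k \<le> exp (kb * (real (len k) + 2))"
  using P_growth[of k] U_growth[of k] unfolding power_eq_exp by (simp_all add: add.commute)

lemma base_ge_2: "2 \<le> real_of_int (a * t\<^sup>2)"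
proof -
  have "a * 1 \<le> a * t\<^sup>2" using a t by (intro mult_left_mono) (auto simp: one_le_power)
  then have "2 \<le> a * t\<^sup>2" using a by linarith
  then have "real_of_int 2 \<le> real_of_int (a * t\<^sup>2)" unfolding of_int_le_iff .
  then show ?thesis by simp
qed

lemma power_base_ge: "real n \<le> real_of_int (a * t\<^sup>2) ^ n"
proof -
  have "2 ^ n \<le> real_of_int (a * t\<^sup>2) ^ n" using base_ge_2 by (intro power_mono) auto
  moreover have "real n < 2 ^ n" by (rule of_nat_less_two_power)
  ultimately show ?thesis by linarith
qed

lemma P_ge: "real k \<le> P k"
  using P_growth(1)[of k] power_base_ge[of "len k"] len_ge[of k] by linarith

lemma U_ge: "real k \<le> U k"
  using U_growth(1)[of k] power_base_ge[of "len k + 2"] len_ge[of k] by linarith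

text \<open>For \<open>Y\<close> between \<open>U k\<close> and \<open>U (Suc k)\<close> the form of
  index \<open>k\<close> serves. Its value is at most about
  \<open>exp ((la - ka) * m - ka * n)\<close> with \<open>m\<close> close to
  \<open>golden * n\<close>, that is \<open>golden * la - golden\<^sup>2 * ka\<close> per unit of
  \<open>n\<close>, while \<open>Y\<close> is at most about \<open>exp (kb * n)\<close>.\<close>

lemma omega_admissible_xi:
  assumes u: "0 \<le> u" "u * kb \<le> golden\<^sup>2 * ka - golden * la" and u': "u' < u"
  shows "omega_admissible xi u'"
proof -
  \<comment> \<open>Absorbs the factor \<open>4 * t\<close>, the deviation of \<open>m\<close> from
    \<open>golden * n\<close> by at most 6, and the two extra letters of a tail.\<close>
  define c where "c = ln (4 * t) + 6 * la + 6 * ka + 2 * u * kb"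
  define C where "C = max 1 (exp c)"
  have C: "C \<ge> 1" "C > 0" "exp c \<le> C" unfolding C_def by auto
  have "\<exists>y0 y1 y2. dual xi (C * Y) (C * Y powr - u) y0 y1 y2" if Y: "Y \<ge> max 1 (U 0)" for Y
  proof -
    obtain K :: nat where "Y < real K" using reals_Archimedean2 by blast
    also have "\<dots> \<le> U (Suc K)" using U_ge[of "Suc K"] by simp
    finally have "\<exists>k. Y < U (Suc k)" by blast
    \<comment> \<open>Minimality gives \<open>U k \<le> Y\<close>; for \<open>k = 0\<close> this is
      the assumption on \<open>Y\<close>.\<close>
    define k where "k = (LEAST k. Y < U (Suc k))"
    have k: "Y < U (Suc k)" unfolding k_def using \<open>\<exists>k. _ k\<close> by (rule LeastI_ex)
    have Uk: "U k \<le> Y"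
    proof (cases k)
      case 0
      then show ?thesis using Y by simp
    next
      case (Suc j)
      then have "\<not> Y < U (Suc j)" unfolding k_def by (intro not_less_Least) simp
      then show ?thesis using Suc by simp
    qed
    define n where "n = real (len (Suc k))"
    define m where "m = real (len (Suc (Suc k)))"
    have m: "golden * n - 6 \<le> m" using len_Suc_Suc_bounds(1)[of k] unfolding n_def m_def .
    have n0: "n \<ge> 0" unfolding n_def by simp
    have "\<bar>zform k\<bar> \<le> 4 * t * exp (la * m) / (P (Suc (Suc k)) * P (Suc k))"
      using abs_zform_le[of k] power_eq_exp(1)[of "len (Suc (Suc k))"] unfolding m_def by simp
    also have "\<dots> \<le> 4 * t * exp (la * m) / (exp (ka * m) * exp (ka * n))"
      using P_exp(1)[of "Suc (Suc k)"] P_exp(1)[of "Suc k"] PQR(5)[of "Suc k"] less_imp_le[OF PQR(5)[of "Suc (Suc k)"]] t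
      unfolding m_def n_def by (intro divide_left_mono mult_mono mult_pos_pos PQR(5)) auto
    also have "\<dots> = exp (ln (4 * t) + la * m - (ka * m + ka * n))"
      using t by (simp add: exp_add exp_diff)
    also have "\<dots> \<le> exp (c + - u * (kb * (n + 2)))"
    proof -
      have "(ka - la) * (golden * n - 6) \<le> (ka - la) * m" using m log_bounds by (intro mult_left_mono) auto
      moreover have "u * kb * n \<le> (golden\<^sup>2 * ka - golden * la) * n" using u(2) n0 by (rule mult_right_mono)
      moreover have "golden\<^sup>2 * ka * n = golden * ka * n + ka * n" unfolding golden_facts(3) by (simp add: algebra_simps)
      ultimately show ?thesis using log_bounds unfolding c_def by (simp add: algebra_simps)
    qed
    also have "\<dots> = exp c * exp (kb * (n + 2)) powr - u" by (simp add: powr_def flip: exp_add)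
    also have "\<dots> \<le> C * Y powr - u"
    proof (intro mult_mono)
      have "Y \<le> exp (kb * (n + 2))" using k U_exp(2)[of "Suc k"] unfolding n_def by linarith
      then show "exp (kb * (n + 2)) powr - u \<le> Y powr - u" using Y u(1) by (intro powr_mono2') auto
    qed (use C in auto)
    finally have zf: "\<bar>zform k\<bar> \<le> C * Y powr - u" .
    have "1 * Y \<le> C * Y" using C Y by (intro mult_right_mono) auto
    then have UY: "U k \<le> C * Y" using Uk by simp
    have "\<bar>real_of_int (z1 k)\<bar> \<le> U k" "\<bar>real_of_int (z2 k)\<bar> \<le> U k"
      using z_bounds[of k] unfolding U_def by linarith+
    then have "dual xi (C * Y) (C * Y powr - u) (z0 k) (z1 k) (z2 k)"
      using zf UY z_bounds(3)[of k] unfolding dual_def zform_def by auto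
    then show ?thesis by blast
  qed
  then have "\<forall>\<^sub>F Y in at_top. \<exists>y0 y1 y2. dual xi (C * Y) (C * Y powr - u) y0 y1 y2"
    unfolding eventually_at_top_linorder by blast
  then show ?thesis using C(2) u' by (rule omega_admissible_scaled)
qed

text \<open>The quantity is at most about \<open>exp (la * m - ka * (m - n))\<close> with
  \<open>m\<close> close to \<open>golden * n\<close>. It decays if
  \<open>la * golden < ka * (golden - 1)\<close>, which is the hypothesis after multiplication by
  \<open>golden\<close>.\<close>

lemma eventually_err_small:
  assumes gap: "la * golden\<^sup>2 < ka"
  shows "\<forall>\<^sub>F k in sequentially. 2 * (P (Suc k) / 3) * err (Suc (Suc k)) < 1 / 2"
proof -
  define \<eta> where "\<eta> = ka * (golden - 1) - la * golden"
  have g: "(golden - 1) * golden = 1" using golden_facts(3) by (simp add: power2_eq_square algebra_simps)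
  have "golden * \<eta> = ka * ((golden - 1) * golden) - la * golden\<^sup>2" unfolding \<eta>_def by (simp add: power2_eq_square algebra_simps)
  then have "golden * \<eta> > 0" using gap unfolding g by simp
  then have \<eta>: "\<eta> > 0" using golden_facts(1) by (simp add: zero_less_mult_iff)
  have half: "(1 / 2 :: real) > 0" by simp
  show ?thesis
  proof (rule eventually_mono[OF eventually_exp_len_less[OF \<eta> half, of "ln (4 * t) + 6 * ka"]])
    fix k
    assume small: "exp (ln (4 * t) + 6 * ka - \<eta> * len (Suc k)) < 1 / 2"
    define n where "n = real (len (Suc k))"
    define m where "m = real (len (Suc (Suc k)))"
    have m: "golden * n - 6 \<le> m" using len_Suc_Suc_bounds(1)[of k] unfolding n_def m_def .
    have mn: "real (len k) + 2 = m - n" unfolding m_def n_def by simp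
    have pos: "P (Suc (Suc k)) > 0" "P (Suc k) > 0" by (rule PQR)+
    have U: "exp (ka * (m - n)) \<le> U k" using U_exp(1)[of k] unfolding mn .
    have "2 * (P (Suc k) / 3) * err (Suc (Suc k)) = P (Suc k) * (4 / 3 * t * exp (la * m)) / P (Suc (Suc k))"
      unfolding err_def power_eq_exp m_def by simp
    also have "\<dots> \<le> P (Suc k) * (4 / 3 * t * exp (la * m)) / (P (Suc k) * U k)"
      using P_Suc_Suc[of k] pos t order_less_le_trans[OF exp_gt_zero U]
      by (intro divide_left_mono) auto
    also have "\<dots> = (4 / 3 * t * exp (la * m)) / U k" using pos by simp
    also have "\<dots> \<le> (4 * t * exp (la * m)) / exp (ka * (m - n))"
      using U t by (intro frac_le) auto
    also have "\<dots> = exp (ln (4 * t) + la * m - ka * (m - n))" using t by (simp add: exp_add exp_diff)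
    also have "\<dots> \<le> exp (ln (4 * t) + 6 * ka - \<eta> * n)"
    proof -
      have "(ka - la) * (golden * n - 6) \<le> (ka - la) * m" using m log_bounds by (intro mult_left_mono) auto
      then show ?thesis using log_bounds unfolding \<eta>_def by (simp add: algebra_simps)
    qed
    also have "\<dots> < 1 / 2" using small unfolding n_def .
    finally show "2 * (P (Suc k) / 3) * err (Suc (Suc k)) < 1 / 2" .
  qed
qed

lemma eventually_P_ge: "\<forall>\<^sub>F k in sequentially. B \<le> P (Suc k) / 3"
proof -
  obtain K :: nat where K: "real K \<ge> 3 * B" using real_arch_simple by blast
  have "B \<le> P (Suc k) / 3" if "k \<ge> K" for k using P_ge[of "Suc k"] that K by simp
  then show ?thesis unfolding eventually_sequentially by blast
qed

text \<open>A form vanishing at \<open>xi\<close> would satisfy the conditions of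
  \<open>abs_form_ge\<close> for all large \<open>k\<close> and force \<open>zform k = 0\<close>,
  against \<open>abs_zform_ge\<close>.\<close>

lemma deg_gt_2_xi:
  assumes gap: "la * golden\<^sup>2 < ka"
  shows "deg_gt_2 xi"
  unfolding deg_gt_2_int
proof (intro allI impI notI)
  fix y0 y1 y2 :: int
  assume nz: "(y0, y1, y2) \<noteq> (0, 0, 0)" and 0: "real_of_int y0 + real_of_int y1 * xi + real_of_int y2 * xi\<^sup>2 = 0"
  have "\<forall>\<^sub>F k in sequentially. False"
    using eventually_err_small[OF gap] eventually_P_ge[of "\<bar>real_of_int y1\<bar>"] eventually_P_ge[of "\<bar>real_of_int y2\<bar>"]
      eventually_P_ge[of "8 * t / 3"]
  proof eventually_elim
    case (elim k)
    have "\<bar>zform k\<bar> \<le> \<bar>asymmetry\<bar> * \<bar>y0 + y1 * xi + y2 * xi\<^sup>2\<bar>"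
      using elim by (intro abs_form_ge[OF nz]) (auto simp: 0)
    then have "\<bar>zform k\<bar> \<le> 0" unfolding 0 by simp
    moreover have "0 < real_of_int (a ^ len (Suc (Suc k))) / (2 * P (Suc (Suc (Suc k))))"
      using PQR(5)[of "Suc (Suc (Suc k))"] a by simp
    moreover have "\<bar>zform k\<bar> \<ge> real_of_int (a ^ len (Suc (Suc k))) / (2 * P (Suc (Suc (Suc k))))"
      using abs_zform_ge[of k] elim by simp
    ultimately show False by linarith
  qed
  then show False by simp
qed

text \<open>At \<open>Y = P (Suc k) / 3\<close> the form given by admissibility falls under
  \<open>abs_form_ge\<close>, so \<open>\<bar>zform k\<bar>\<close> is at most a constant times
  \<open>Y powr - w\<close>. The lower bound \<open>exp (la * m - kb * (m + n + 2)) / 2\<close> with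
  \<open>m\<close> close to \<open>golden * n\<close> then limits \<open>w\<close>.\<close>

lemma omega_admissible_xi_le:
  assumes gap: "la * golden\<^sup>2 < ka" and adm: "omega_admissible xi w"
  shows "w * ka \<le> golden\<^sup>2 * kb - golden * la"
proof (rule ccontr)
  assume "\<not> ?thesis"
  then have w: "golden\<^sup>2 * kb - golden * la < w * ka" by simp
  have "la * golden \<le> la * golden\<^sup>2"
    using golden_facts(1) log_bounds(1) by (intro mult_left_mono) (auto simp: power2_eq_square)
  then have lak: "golden * la < kb" using gap log_bounds(4) by (simp add: mult.commute)
  have gkb: "golden\<^sup>2 * kb = golden * kb + kb" unfolding golden_facts(3) by (simp add: algebra_simps)
  have "golden * kb > 0" using golden_facts(1) log_bounds(3,4) by (intro mult_pos_pos) linarith+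
  then have "w * ka > 0" using w lak gkb by linarith
  then have w0: "w > 0" using log_bounds(3) by (simp add: zero_less_mult_iff)
  obtain Y0 where Y0: "\<And>Y. Y \<ge> Y0 \<Longrightarrow> \<exists>y0 y1 y2. dual xi Y (Y powr - w) y0 y1 y2"
    using adm unfolding omega_admissible_def eventually_at_top_linorder by blast
  define \<mu> where "\<mu> = \<bar>real_of_int asymmetry\<bar>"
  have \<mu>: "\<mu> > 0" unfolding \<mu>_def using asymmetry_nz by simp
  \<comment> \<open>Decay rate of \<open>P (Suc (Suc k)) * v\<close>, positive by the assumed size
    of \<open>w\<close> and \<open>golden * la < kb\<close>. The rate \<open>\<eta>2\<close> is the
    assumed excess over the claimed bound.\<close>
  define \<eta>1 where "\<eta>1 = w * ka - kb * golden"
  define c1 where "c1 = 6 * kb + w * ln 3"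
  define \<eta>2 where "\<eta>2 = w * ka - (golden\<^sup>2 * kb - golden * la)"
  define c2 where "c2 = ln (2 * \<mu>) + w * ln 3 + 6 * (kb - la) + 2 * kb"
  have \<eta>1: "\<eta>1 > 0" unfolding \<eta>1_def using w lak gkb by (simp add: mult.commute)
  have \<eta>2: "\<eta>2 > 0" unfolding \<eta>2_def using w by simp
  have "\<forall>\<^sub>F k in sequentially. False"
    using eventually_err_small[OF gap] eventually_P_ge[of "max Y0 1"] eventually_P_ge[of "8 * t / 3"]
      eventually_exp_len_less[OF \<eta>1, of "1 / 2" c1, simplified] eventually_exp_len_less[OF \<eta>2, of 1 c2, simplified]
  proof eventually_elim
    case (elim k)
    define Y where "Y = P (Suc k) / 3"
    define n where "n = real (len (Suc k))"
    define m where "m = real (len (Suc (Suc k)))"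
    have m: "m \<le> golden * n + 6" using len_Suc_Suc_bounds(2)[of k] unfolding n_def m_def .
    have e: "exp (c1 - \<eta>1 * n) < 1 / 2" "exp (c2 - \<eta>2 * n) < 1" using elim(4,5) unfolding n_def by simp_all
    have Y: "Y \<ge> Y0" "Y \<ge> 1" using elim(2) unfolding Y_def by auto
    obtain y0 y1 y2 where y: "dual xi Y (Y powr - w) y0 y1 y2" using Y0[OF Y(1)] by blast
    define v where "v = \<bar>y0 + y1 * xi + y2 * xi\<^sup>2\<bar>"
    have yd: "(y0, y1, y2) \<noteq> (0, 0, 0)" "v \<le> Y powr - w" "\<bar>real_of_int y1\<bar> \<le> Y" "\<bar>real_of_int y2\<bar> \<le> Y"
      using y unfolding dual_def v_def by auto
    have "exp (ka * n - ln 3) \<le> Y" using P_exp(1)[of "Suc k"] unfolding n_def Y_def by (simp add: exp_diff)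
    then have "Y powr - w \<le> exp (ka * n - ln 3) powr - w" using w0 by (intro powr_mono2') auto
    then have Yw: "Y powr - w \<le> exp (w * ln 3 - w * ka * n)" by (simp add: powr_def algebra_simps)
    have "P (Suc (Suc k)) * v \<le> exp (kb * m) * exp (w * ln 3 - w * ka * n)"
      using P_exp(2)[of "Suc (Suc k)"] yd(2) Yw PQR(5)[of "Suc (Suc k)"] unfolding m_def v_def
      by (intro mult_mono) auto
    also have "\<dots> = exp (kb * m + (w * ln 3 - w * ka * n))" by (simp add: exp_add)
    also have "\<dots> \<le> exp (c1 - \<eta>1 * n)"
    proof -
      have "kb * m \<le> kb * (golden * n + 6)" using m log_bounds by (intro mult_left_mono) auto
      then show ?thesis unfolding c1_def \<eta>1_def by (simp add: algebra_simps)
    qed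
    finally have "P (Suc (Suc k)) * v < 1 / 2" using e(1) by linarith
    then have "\<bar>zform k\<bar> \<le> \<mu> * v"
      unfolding v_def \<mu>_def of_int_abs[symmetric]
      using yd elim(1) by (intro abs_form_ge) (auto simp: Y_def)
    also have "\<dots> \<le> \<mu> * exp (w * ln 3 - w * ka * n)" using \<mu> yd(2) Yw by (intro mult_left_mono) auto
    also have "\<dots> = exp (ln (2 * \<mu>) + (w * ln 3 - w * ka * n)) / 2" using \<mu> by (simp add: exp_add)
    also have "\<dots> < exp (la * m - kb * (m + n + 2)) / 2"
    proof -
      have "(kb - la) * m \<le> (kb - la) * (golden * n + 6)"
        by (intro mult_left_mono) (use m log_bounds in linarith)+
      moreover have "golden\<^sup>2 * kb * n = golden * kb * n + kb * n" unfolding gkb by (simp add: algebra_simps)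
      moreover have "c2 - \<eta>2 * n < 0" using e(2) by simp
      ultimately have "ln (2 * \<mu>) + (w * ln 3 - w * ka * n) < la * m - kb * (m + n + 2)"
        unfolding c2_def \<eta>2_def by (simp add: algebra_simps)
      then show ?thesis by simp
    qed
    also have "\<dots> = exp (la * m) / (2 * exp (kb * (m + n + 2)))" by (simp add: exp_diff)
    also have "\<dots> \<le> exp (la * m) / (2 * P (Suc (Suc (Suc k))))"
    proof -
      have "real (len (Suc (Suc (Suc k)))) = m + n + 2" unfolding m_def n_def by simp
      then have "P (Suc (Suc (Suc k))) \<le> exp (kb * (m + n + 2))" using P_exp(2)[of "Suc (Suc (Suc k))"] by (simp only:)
      then show ?thesis using PQR(5)[of "Suc (Suc (Suc k))"] by (intro divide_left_mono) auto
    qed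
    also have "exp (la * m) = a ^ len (Suc (Suc k))" unfolding m_def power_eq_exp[symmetric] by simp
    also have "real_of_int (a ^ len (Suc (Suc k))) / (2 * P (Suc (Suc (Suc k)))) \<le> \<bar>zform k\<bar>"
      using abs_zform_ge[of k] elim(3) by simp
    finally show False by simp
  qed
  then show False by simp
qed

end

section \<open>Choice of the parameters\<close>

text \<open>For rational \<open>\<delta> = m / n\<close> powers of 2 make \<open>la / ka\<close>
  equal to \<open>\<delta>\<close> exactly, and a large \<open>N\<close> makes
  \<open>kb - ka = ln 10\<close> negligible against \<open>ka\<close>. The exponent is then close to
  \<open>golden\<^sup>2 - golden * \<delta>\<close>, hence to \<open>w\<close>.\<close>

lemma exists_omega_hat2_near:
  fixes w \<epsilon> :: real
  assumes w: "2 < w" "w < golden\<^sup>2" and \<epsilon>: "\<epsilon> > 0"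
  obtains \<xi> where "deg_gt_2 \<xi>" "ereal (w - \<epsilon>) \<le> omega_hat2 \<xi>" "omega_hat2 \<xi> \<le> ereal (w + \<epsilon>)"
proof -
  have g: "golden > 1" "golden\<^sup>2 = golden + 1" "golden < 2" using golden_facts by auto
  have g3: "golden\<^sup>2 < 3" using g by simp
  define D where "D = (golden\<^sup>2 - w) / golden"
  have D: "D > 0" "golden * D = golden\<^sup>2 - w" unfolding D_def using w g by auto
  \<comment> \<open>As \<open>golden < 2\<close>, the tolerance \<open>\<epsilon> / 4\<close> in
    \<open>\<delta>\<close> costs at most \<open>\<epsilon> / 2\<close> in the exponent; the other
    half is kept for \<open>ln 10\<close>.\<close>
  have "max 0 (D - \<epsilon> / 4) < D" using D \<epsilon> by simp
  then obtain \<delta> where "\<delta> \<in> \<rat>" and \<delta>: "max 0 (D - \<epsilon> / 4) < \<delta>" "\<delta> < D" using Rats_dense_in_real by blast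
  have \<delta>0: "0 < \<delta>" using \<delta> by simp
  obtain m n :: nat where n: "n \<noteq> 0" and mn: "\<bar>\<delta>\<bar> = real m / real n" using Rats_abs_nat_div_natE[OF \<open>\<delta> \<in> \<rat>\<close>] by metis
  have \<delta>mn: "\<delta> = real m / real n" using mn \<delta>0 by simp
  \<comment> \<open>By \<open>w > 2\<close> one has \<open>D < 1 / golden\<^sup>2\<close>, since
    \<open>golden\<^sup>2 - 2 = golden - 1 = 1 / golden\<close>.\<close>
  have gap1: "golden\<^sup>2 * \<delta> < 1"
  proof -
    have "golden\<^sup>2 * \<delta> < golden\<^sup>2 * D" using \<delta>(2) g by simp
    also have "\<dots> = golden * (golden\<^sup>2 - w)" unfolding D(2)[symmetric] by (simp add: power2_eq_square)
    also have "\<dots> < golden * (golden - 1)" using w(1) g by simp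
    also have "\<dots> = 1" using g(2) by (simp add: power2_eq_square algebra_simps)
    finally show ?thesis .
  qed
  have "1 * \<delta> \<le> golden\<^sup>2 * \<delta>" using g \<delta>0 by (intro mult_right_mono) auto
  then have "\<delta> < 1" using gap1 by simp
  then have lt: "m < n" using n unfolding \<delta>mn by (simp add: field_simps)
  have m0: "m > 0" using \<delta>0 n unfolding \<delta>mn by (simp add: zero_less_divide_iff)
  define u where "u = golden\<^sup>2 - golden * \<delta>"
  have "golden * \<delta> < golden * D" "golden * (D - \<epsilon> / 4) < golden * \<delta>" using \<delta> g by simp_all
  moreover have "golden * (\<epsilon> / 4) \<le> 2 * (\<epsilon> / 4)" using g \<epsilon> by (intro mult_right_mono) auto
  ultimately have u: "w \<le> u" "u \<le> w + \<epsilon> / 2" "0 \<le> u"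
    unfolding u_def right_diff_distrib D(2) using w by linarith+
  \<comment> \<open>With \<open>ka \<ge> N\<close> this yields
    \<open>6 * ln 10 \<le> \<epsilon> * ka\<close>, so half of \<open>\<epsilon> * ka\<close> covers
    \<open>3 * ln 10\<close>.\<close>
  obtain N :: nat where N: "real N \<ge> max 1 (6 * ln 10 / \<epsilon>)" using real_arch_simple by blast
  define a :: int where "a = 4 ^ (m * N)"
  define t :: int where "t = 2 ^ ((n - m) * N)"
  have N1: "N \<ge> 1" using N by simp
  have a2: "a \<ge> 2"
  proof -
    have "(4::int) ^ 1 \<le> 4 ^ (m * N)" using m0 N1 by (intro power_increasing) auto
    then show ?thesis unfolding a_def by simp
  qed
  have t1: "t \<ge> 1" unfolding t_def by simp
  interpret fibonacci_matrices a t using a2 t1 by unfold_locales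
  have "t\<^sup>2 = 4 ^ ((n - m) * N)" unfolding t_def by (simp add: power2_eq_square flip: power_mult_distrib)
  then have "a * t\<^sup>2 = 4 ^ (m * N + (n - m) * N)" unfolding a_def by (simp add: power_add)
  also have "m * N + (n - m) * N = n * N" using lt by (simp flip: add_mult_distrib)
  finally have at2: "a * t\<^sup>2 = 4 ^ (n * N)" .
  have la: "la = real m * N * ln 4" unfolding la_def by (simp add: a_def ln_realpow)
  have ka: "ka = real n * N * ln 4" unfolding ka_def at2 by (simp add: ln_realpow)
  have lak: "la = \<delta> * ka" unfolding la ka \<delta>mn using n by simp
  have "ln 4 \<ge> (1::real)"
  proof -
    have "exp 1 \<le> (4::real)" using exp_le by simp
    then show ?thesis by (simp add: ln_ge_iff)
  qed
  moreover have "1 * real N \<le> real n * real N" using n by (intro mult_right_mono) auto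
  ultimately have "real N * 1 \<le> (real n * N) * ln 4" by (intro mult_mono) auto
  then have kaN: "ka \<ge> N" unfolding ka by simp
  have k\<epsilon>: "6 * ln 10 \<le> \<epsilon> * ka"
  proof -
    have "6 * ln 10 / \<epsilon> \<le> ka" using kaN N by simp
    then show ?thesis using \<epsilon> by (simp add: field_simps)
  qed
  note lb = log_bounds
  have gap: "la * golden\<^sup>2 < ka"
  proof -
    have "la * golden\<^sup>2 = (golden\<^sup>2 * \<delta>) * ka" unfolding lak by simp
    also have "\<dots> < 1 * ka" using gap1 lb(3) by (intro mult_strict_right_mono) auto
    finally show ?thesis by simp
  qed
  have uk: "golden\<^sup>2 * ka - golden * la = u * ka" unfolding u_def lak by (simp add: algebra_simps)
  have ln10: "ln 10 > (0::real)" by simp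
  have lower: "ereal (w - \<epsilon>) \<le> omega_hat2 xi"
  \<comment> \<open>The construction is applied to nonnegative exponents; otherwise Dirichlet's
    bound is enough.\<close>
  proof (cases "w - \<epsilon> \<le> 0")
    case True
    have "ereal (w - \<epsilon>) \<le> ereal 2" using True by simp
    then show ?thesis using two_le_omega_hat2 order_trans by blast
  next
    case False
    have "omega_admissible xi (w - \<epsilon>)"
    proof (rule omega_admissible_xi)
      have "(w - \<epsilon> / 2) * kb \<le> u * ka"
      proof -
        have "(w - \<epsilon> / 2) * ln 10 \<le> 3 * ln 10" using w g3 \<epsilon> ln10 by (intro mult_right_mono) auto
        moreover have "w * ka \<le> u * ka" using u(1) lb(3) by simp
        ultimately show ?thesis unfolding lb(5) using k\<epsilon> by (simp add: algebra_simps)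
      qed
      then show "(w - \<epsilon> / 2) * kb \<le> golden\<^sup>2 * ka - golden * la" unfolding uk .
    qed (use False \<epsilon> in auto)
    then show ?thesis by (rule omega_admissible_le)
  qed
  have upper: "omega_hat2 xi \<le> ereal (w + \<epsilon>)"
    unfolding omega_hat2_eq
  proof (rule Sup_least, clarify)
    fix w'
    assume "omega_admissible xi w'"
    from omega_admissible_xi_le[OF gap this] have "w' * ka \<le> u * ka + golden\<^sup>2 * ln 10"
      unfolding uk[symmetric] lb(5) by (simp add: algebra_simps)
    also have "\<dots> \<le> (w + \<epsilon> / 2) * ka + 3 * ln 10"
      using u(2) g3 ln10 lb(3) by (intro add_mono mult_right_mono) auto
    also have "\<dots> \<le> (w + \<epsilon>) * ka" using k\<epsilon> by (simp add: algebra_simps)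
    finally show "ereal w' \<le> ereal (w + \<epsilon>)" using lb(3) by simp
  qed
  show ?thesis by (rule that[OF deg_gt_2_xi[OF gap] lower upper])
qed

section \<open>The spectrum\<close>

text \<open>The bounds of Dirichlet and of Davenport and Schmidt make both exponents finite, and the
  two transfers, applied strictly below the suprema, give the identity. The transfers start strictly
  above \<open>2\<close> and \<open>1 / 2\<close>, so these end values are settled by Dirichlet's
  bounds.\<close>

lemma exponents_in_curveC:
  assumes deg: "deg_gt_2 \<xi>"
  shows "\<exists>l w. lambda_hat2 \<xi> = ereal l \<and> omega_hat2 \<xi> = ereal w \<and> (l, w) \<in> curveC"
proof -
  note g = golden_facts
  have "lambda_hat2 \<xi> \<le> ereal (1 / golden)"
    unfolding lambda_hat2_eq using lambda_admissible_le_inverse_golden[OF deg] by (intro Sup_least) auto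
  with half_le_lambda_hat2[of \<xi>] obtain l where l: "lambda_hat2 \<xi> = ereal l" "1 / 2 \<le> l" "l \<le> 1 / golden"
    by (cases "lambda_hat2 \<xi>") auto
  \<comment> \<open>The transfer yields \<open>1 - 1 / w \<le> 1 / golden\<close>, and
    \<open>golden\<^sup>2 * (2 - golden) = 1\<close> solves this for \<open>w\<close>.\<close>
  have "w \<le> golden\<^sup>2" if adm: "omega_admissible \<xi> w" for w
  proof (cases "w \<le> 2")
    case True
    then show ?thesis using g by simp
  next
    case False
    then have "l' \<le> 1 / golden" if "l' < 1 - 1 / w" for l'
      using omega_admissible_imp_lambda_admissible[OF _ adm deg that] lambda_admissible_le_inverse_golden[OF deg] by simp
    then have "1 - 1 / w \<le> 1 / golden" by (rule dense_le)
    then have "2 - golden \<le> 1 / w" unfolding g(4) by simp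
    then have "(2 - golden) * w \<le> 1" using False by (simp add: field_simps)
    then have "golden\<^sup>2 * ((2 - golden) * w) \<le> golden\<^sup>2 * 1" by (intro mult_left_mono) auto
    moreover have "golden\<^sup>2 * (2 - golden) = 1"
    proof -
      have "(golden + 1) * (2 - golden) = 2 + golden - golden\<^sup>2" by (simp add: algebra_simps power2_eq_square)
      then show ?thesis unfolding g(3) by simp
    qed
    ultimately show ?thesis by (simp flip: mult.assoc)
  qed
  then have "omega_hat2 \<xi> \<le> ereal (golden\<^sup>2)" unfolding omega_hat2_eq by (intro Sup_least) auto
  with two_le_omega_hat2[of \<xi>] obtain w where w: "omega_hat2 \<xi> = ereal w" "2 \<le> w" "w \<le> golden\<^sup>2"
    by (cases "omega_hat2 \<xi>") auto
  have "1 - 1 / w \<le> l"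
  proof (cases "w = 2")
    case True
    then show ?thesis using l(2) by simp
  next
    case False
    have "l' \<le> l" if l': "l' < 1 - 1 / w" for l'
    proof -
      have "l' < 1" using l' w(2) by (smt (verit) divide_pos_pos)
      moreover have "1 / w < 1 - l'" using l' by simp
      ultimately have "max 2 (1 / (1 - l')) < w" using False w(2) by (simp add: field_simps)
      then obtain w1 where w1: "max 2 (1 / (1 - l')) < w1" "w1 < w" using dense by blast
      have "omega_admissible \<xi> w1" using less_omega_hat2 w(1) w1(2) by simp
      moreover have "1 / w1 < 1 - l'" using w1(1) \<open>l' < 1\<close> by (simp add: field_simps)
      ultimately have "lambda_admissible \<xi> l'"
        using omega_admissible_imp_lambda_admissible[of w1 \<xi> l'] deg w1(1) by simp
      then show ?thesis using lambda_admissible_le l(1) by fastforce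
    qed
    then show ?thesis by (rule dense_le)
  qed
  moreover have "l \<le> 1 - 1 / w"
  proof (cases "l = 1 / 2")
    case True
    moreover have "1 / w \<le> 1 / 2" using w(2) by (simp add: field_simps)
    ultimately show ?thesis by simp
  next
    case False
    have "1 / golden < 1" using g(1) by simp
    then have l1: "l < 1" using l(3) by linarith
    have "w' \<le> w" if w': "w' < 1 / (1 - l)" for w'
    proof (cases "w' \<le> 2")
      case True
      then show ?thesis using w(2) by simp
    next
      case w'2: False
      have "1 - 1 / w' < l" using w' w'2 l1 by (simp add: field_simps)
      then have "max (1 / 2) (1 - 1 / w') < l" using False l(2) by simp
      then obtain l' where l': "max (1 / 2) (1 - 1 / w') < l'" "l' < l" using dense by blast
      have "lambda_admissible \<xi> l'" using less_lambda_hat2 l(1) l'(2) by simp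
      moreover have "w' < 1 / (1 - l')" using l' l1 w'2 by (simp add: field_simps)
      ultimately have "omega_admissible \<xi> w'"
        using lambda_admissible_imp_omega_admissible[of l' \<xi> w'] l' l1 by simp
      then show ?thesis using omega_admissible_le w(1) by fastforce
    qed
    then have "1 / (1 - l) \<le> w" by (rule dense_le)
    then show ?thesis using l1 w(2) by (simp add: field_simps)
  qed
  ultimately have "l = 1 - 1 / w" by simp
  then show ?thesis using l(1) w unfolding curveC_def by blast
qed

theorem mainTheorem1:
  shows "(\<forall>\<xi>. deg_gt_2 \<xi> \<longrightarrow>
            (\<exists>l w. lambda_hat2 \<xi> = ereal l \<and> omega_hat2 \<xi> = ereal w \<and> (l, w) \<in> curveC))
       \<and> curveC \<subseteq> closure {(real_of_ereal (lambda_hat2 \<xi>), real_of_ereal (omega_hat2 \<xi>)) | \<xi>. deg_gt_2 \<xi>}"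
proof (intro conjI allI impI subsetI)
  show "\<exists>l w. lambda_hat2 \<xi> = ereal l \<and> omega_hat2 \<xi> = ereal w \<and> (l, w) \<in> curveC" if "deg_gt_2 \<xi>" for \<xi>
    using exponents_in_curveC that .
next
  fix p assume "p \<in> curveC"
  then obtain w where p: "p = (1 - 1 / w, w)" and w: "2 \<le> w" "w \<le> golden\<^sup>2" unfolding curveC_def by blast
  let ?E = "{(real_of_ereal (lambda_hat2 \<xi>), real_of_ereal (omega_hat2 \<xi>)) | \<xi>. deg_gt_2 \<xi>}"
  \<comment> \<open>The curve is a graph over its second coordinate, so by continuity it suffices to
    approximate \<open>w\<close>.\<close>
  have "isCont (\<lambda>x::real. (1 - 1 / x, x)) w" using w(1) by (intro continuous_intros) auto
  then have cont: "\<exists>d>0. \<forall>x. dist x w < d \<longrightarrow> dist (1 - 1 / x, x) p < e" if "e > 0" for e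
    using that unfolding continuous_at_eps_delta p by blast
  show "p \<in> closure ?E"
    unfolding closure_approachable
  proof (intro allI impI)
    fix e :: real assume "e > 0"
    then obtain d where d: "d > 0" "\<And>x. dist x w < d \<Longrightarrow> dist (1 - 1 / x, x) p < e" using cont by blast
    have "2 < golden\<^sup>2" using golden_facts by simp
    then have "max 2 (w - d / 2) < min (golden\<^sup>2) (w + d / 2)" using w d(1) by auto
    then obtain w1 where "max 2 (w - d / 2) < w1" "w1 < min (golden\<^sup>2) (w + d / 2)" using dense by blast
    then have w1: "2 < w1" "w1 < golden\<^sup>2" "w - d / 2 < w1" "w1 < w + d / 2" by simp_all
    have "d / 4 > 0" using d(1) by simp
    from exists_omega_hat2_near[OF w1(1,2) this] obtain \<xi> where
      \<xi>: "deg_gt_2 \<xi>" "ereal (w1 - d / 4) \<le> omega_hat2 \<xi>" "omega_hat2 \<xi> \<le> ereal (w1 + d / 4)" .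
    obtain l x where lx: "lambda_hat2 \<xi> = ereal l" "omega_hat2 \<xi> = ereal x" "(l, x) \<in> curveC"
      using exponents_in_curveC[OF \<xi>(1)] by blast
    have "l = 1 - 1 / x" using lx(3) unfolding curveC_def by auto
    moreover have "dist x w < d" using \<xi>(2,3) w1 unfolding lx(2) dist_real_def by simp
    ultimately have "dist (l, x) p < e" using d(2) by blast
    moreover have "(l, x) \<in> ?E" using \<xi>(1) lx(1,2) by force
    ultimately show "\<exists>y\<in>?E. dist y p < e" by blast
  qed
qed

end
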